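(* Let $(\mathcal{A},V,\mathcal{R})$ be an irreducible crystallographic arrangement of rank three, $V=\mathbb{R}^3$. Then for every one-dimensional subspace $X$ of $V$ which is an intersection of hyperplanes of $\mathcal{A}$, the number of hyperplanes $H\in\mathcal{A}$ with $X\subseteq H$ (equivalently, the number of positive roots of the rank-two localization of $\mathcal{A}$ at $X$, i.e. $\tfrac12|\{\alpha\in\mathcal{R}\mid X\subseteq\ker\alpha\}|$) is at most $128$.
   Context: A hyperplane arrangement in $V$ is a finite set of linear hyperplanes; chambers are the connected components of the complement. It is simplicial if each chamber is an open simplicial cone $\{\sum a_iv_i\mid a_i>0\}$ for a basis $(v_i)$ of $V$. $(\mathcal{A},V,\mathcal{R})$, $\mathcal{R}\subseteq V^*$ finite, is a crystallographic arrangement if $\mathcal{A}$ is simplicial, $\mathcal{A}=\{\ker\alpha\mid\alpha\in\mathcal{R}\}$, $\mathbb{R}\alpha\cap\mathcal{R}=\{\pm\alpha\}$ for all $\alpha\in\mathcal{R}$, and for every chamber $K$, $\mathcal{R}\subseteq\sum_{\alpha\in B^K}\mathbb{Z}\alpha$, where $B^K$ is the set of $\alpha\in\mathcal{R}$ nonnegative on $K$ with $\ker\alpha\cap\overline K$ spanning $\ker\alpha$. The rank is $\dim V-\dim\bigcap_{H\in\mathcal{A}}H$. $\mathcal{A}$ is reducible if there is a nontrivial decomposition $V=V_1\oplus V_2$ and arrangements $\mathcal{A}_i$ in $V_i$ with $\mathcal{A}=\{H_1\oplus V_2\mid H_1\in\mathcal{A}_1\}\cup\{V_1\oplus H_2\mid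 H_2\in\mathcal{A}_2\}$; irreducible otherwise. *)

theory Defs
  imports "HOL-Analysis.Analysis"
begin

text \<open>Linear functionals on a finite-dimensional real inner product space V are
  represented by vectors via the inner product: alpha(v) = alpha \<bullet> v.\<close>

definition kerf :: "'a::euclidean_space \<Rightarrow> 'a set" where
  "kerf \<alpha> = {v. \<alpha> \<bullet> v = 0}"

definition hyperplane_arrangement :: "'a::euclidean_space set set \<Rightarrow> bool" where
  "hyperplane_arrangement A \<longleftrightarrow> finite A \<and> (\<forall>H\<in>A. \<exists>\<alpha>. \<alpha> \<noteq> 0 \<and> H = kerf \<alpha>)"

definition chambers :: "'a::euclidean_space set set \<Rightarrow> 'a set set" where
  "chambers A = {connected_component_set (- \<Union>A) x | x. x \<in> - \<Union>A}"

definition simplicial_arrangement :: "'a::euclidean_space set set \<Rightarrow> bool" where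
  "simplicial_arrangement A \<longleftrightarrow> hyperplane_arrangement A \<and>
     (\<forall>K\<in>chambers A. \<exists>B. independent B \<and> span B = UNIV \<and>
        K = {(\<Sum>v\<in>B. a v *\<^sub>R v) | a. \<forall>v\<in>B. 0 < a v})"

definition walls :: "'a::euclidean_space set \<Rightarrow> 'a set \<Rightarrow> 'a set" where
  "walls R K = {\<alpha>\<in>R. (\<forall>v\<in>K. 0 \<le> \<alpha> \<bullet> v) \<and> span (kerf \<alpha> \<inter> closure K) = kerf \<alpha>}"

definition crystallographic :: "'a::euclidean_space set set \<Rightarrow> 'a set \<Rightarrow> bool" where
  "crystallographic A R \<longleftrightarrow>
     finite R \<and> 0 \<notin> R \<and> simplicial_arrangement A \<and> A = kerf ` R \<and>
     (\<forall>\<alpha>\<in>R. {c *\<^sub>R \<alpha> | c. True} \<inter> R = {\<alpha>, -\<alpha>}) \<and>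
     (\<forall>K\<in>chambers A. \<forall>\<beta>\<in>R. \<exists>c::'a \<Rightarrow> int.
         \<beta> = (\<Sum>\<alpha>\<in>walls R K. of_int (c \<alpha>) *\<^sub>R \<alpha>))"

definition arr_rank :: "'a::euclidean_space set set \<Rightarrow> nat" where
  "arr_rank A = DIM('a) - dim (\<Inter>A)"

definition dsum :: "'a::real_vector set \<Rightarrow> 'a set \<Rightarrow> 'a set" where
  "dsum X Y = {x + y | x y. x \<in> X \<and> y \<in> Y}"

definition arrangement_in :: "'a::euclidean_space set \<Rightarrow> 'a set set \<Rightarrow> bool" where
  "arrangement_in W A \<longleftrightarrow> finite A \<and> (\<forall>H\<in>A. subspace H \<and> H \<subseteq> W \<and> dim H + 1 = dim W)"

definition reducible_arrangement :: "'a::euclidean_space set set \<Rightarrow> bool" where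
  "reducible_arrangement A \<longleftrightarrow>
     (\<exists>V1 V2 A1 A2. subspace V1 \<and> subspace V2 \<and> V1 \<noteq> {0} \<and> V2 \<noteq> {0} \<and>
        V1 \<inter> V2 = {0} \<and> dsum V1 V2 = UNIV \<and>
        arrangement_in V1 A1 \<and> arrangement_in V2 A2 \<and>
        A = (\<lambda>H. dsum H V2) ` A1 \<union> (\<lambda>H. dsum V1 H) ` A2)"

definition irreducible_arrangement :: "'a::euclidean_space set set \<Rightarrow> bool" where
  "irreducible_arrangement A \<longleftrightarrow> \<not> reducible_arrangement A"

end

theory Submission
  imports Defs
begin

text \<open>Fix a line X and a chamber adjacent to it, and write the roots in the basis of walls of that
  chamber, as integer triples (h, x, y) with h = 0 exactly for the roots vanishing on X. Let m be the
  number of hyperplanes through X. Chambers around X and the roots of height h = 1 correspond to a lattice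
  polygon P whose edges are parallel to the roots of height 0: the chambers are the normal cones of P,
  and its vertices are the third walls. Five facts drive the argument. (1) If two roots of height 1 differ
  by k d with d primitive and k \<ge> 2, then d is a root. (2) The roots of height 1 are all lattice
  points of P. (3) By irreducibility, two neighbouring roots of height 0 cannot both fail to give an edge at the
  same vertex of P; hence P has at least m vertices, so at least m lattice points, and width at least
  (m - 2) / 2 in the direction of every root. (4) If c + 1 is the number of slopes of roots (0, 1, j) and
  (0, 0, 1) is a root, then two consecutive columns of P have total length at least c. (5) By (3) the slopes of
  the boundary of P change slowly, so that the third column after the first has length at least 3 c - 24.

  Now let m > 128 and let L be the length of the longest chord of P in the direction of a root, say (0, 0, 1).
  Since the points of P are distinct modulo L + 1, P has at most (L + 1)^2 of them, so L \<ge> 11. As P is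
  wide, the column two steps away from the longest one is almost as long, and (1) gives c \<ge> 9 and
  31 L \<le> 32 c + 62. With (5) this yields L \<le> 15, whereas by (4) P has at least
  64 + 32 * 9 = 352 > 16^2 points.\<close>

section \<open>Integral root systems of rank three\<close>

text \<open>No reflection group moves the chambers around; all that is available is an integral
  basis at each chamber. Hence the local statements are proved in one way: choose a linear form,
  degenerate on purpose, whose chamber is forced to have prescribed roots as walls, and contradict
  determinant one or the equal signs of the coordinates. The delicate point is existence of roots at
  prescribed lattice points. Chambers only confine the roots of height one to P; filling P rests on
  \<open>crystal_triangle\<close>, a descent on the number of roots. Constants: 129 vertices, at
  most two in each column, need 65 columns, so P reaches 32 columns to one side of the longest
  chord, wherever that chord lies. The column two steps away is compared with it, rather than the
  next one, because 2 d is the smallest difference to which (1) applies; with 32 columns this costs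
  only a sixteenth of the chord. The bound L \<ge> 11 comes from 129 > 11 * 11.\<close>

type_synonym v3 = "int \<times> int \<times> int"

definition scale3 :: "int \<Rightarrow> v3 \<Rightarrow> v3" where
  "scale3 n v = (n * fst v, n * fst (snd v), n * snd (snd v))"

lemma scale3_simp [simp]: "scale3 n (x, y, z) = (n * x, n * y, n * z)"
  by (simp add: scale3_def)

definition linform :: "(v3 \<Rightarrow> int) \<Rightarrow> bool" where
  "linform u \<longleftrightarrow> (\<exists>a b c. \<forall>x y z. u (x, y, z) = a * x + b * y + c * z)"

lemma linformI: "(\<And>x y z. u (x, y, z) = a * x + b * y + c * z) \<Longrightarrow> linform u"
  unfolding linform_def by blast

lemma linform_scale: "linform u \<Longrightarrow> u (scale3 n v) = n * u v"
  unfolding linform_def by (cases v) (auto simp: algebra_simps)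

lemma linform_add: "linform u \<Longrightarrow> u (v + w) = u v + u w"
  unfolding linform_def by (cases v; cases w) (auto simp: algebra_simps)

lemma linform_uminus: "linform u \<Longrightarrow> u (- v) = - u v"
  unfolding linform_def by (cases v) (auto simp: algebra_simps)

lemma linform_coords:
  "linform u \<Longrightarrow> u (x, y, z) = x * u (1,0,0) + y * u (0,1,0) + z * u (0,0,1)"
  unfolding linform_def by (auto simp: algebra_simps)

text \<open>The forms are the dual basis of the three vectors, which therefore form a basis of the
  lattice; this is how determinant one enters.\<close>

definition frame where
  "frame b1 b2 b3 c1 c2 c3 \<longleftrightarrow> linform c1 \<and> linform c2 \<and> linform c3 \<and>
     (\<forall>v. v = scale3 (c1 v) b1 + scale3 (c2 v) b2 + scale3 (c3 v) b3) \<and>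
     c1 b1 = 1 \<and> c1 b2 = 0 \<and> c1 b3 = 0 \<and> c2 b1 = 0 \<and> c2 b2 = 1 \<and> c2 b3 = 0 \<and>
     c3 b1 = 0 \<and> c3 b2 = 0 \<and> c3 b3 = 1"

definition posbasis where
  "posbasis S P b1 b2 b3 c1 c2 c3 \<longleftrightarrow> frame b1 b2 b3 c1 c2 c3 \<and> b1 \<in> S \<and> b2 \<in> S \<and> b3 \<in> S \<and>
     (\<forall>r\<in>S. P r \<longrightarrow> 0 \<le> c1 r \<and> 0 \<le> c2 r \<and> 0 \<le> c3 r)"

text \<open>A generic linear form plays the role of a point of a chamber.\<close>

definition crystal :: "v3 set \<Rightarrow> bool" where
  "crystal S \<longleftrightarrow> finite S \<and> 0 \<notin> S \<and> (\<forall>r\<in>S. - r \<in> S) \<and>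
     (\<forall>r\<in>S. \<forall>s\<in>S. \<forall>m n. m \<noteq> 0 \<longrightarrow> scale3 m r = scale3 n s \<longrightarrow> s = r \<or> s = - r) \<and>
     (\<forall>u. linform u \<longrightarrow> (\<forall>r\<in>S. u r \<noteq> 0) \<longrightarrow>
        (\<exists>b1 b2 b3 c1 c2 c3. posbasis S (\<lambda>r. 0 < u r) b1 b2 b3 c1 c2 c3))"

lemma frameD: "frame b1 b2 b3 c1 c2 c3 \<Longrightarrow> v = scale3 (c1 v) b1 + scale3 (c2 v) b2 + scale3 (c3 v) b3"
  unfolding frame_def by blast

lemma frame_expand:
  assumes "frame b1 b2 b3 c1 c2 c3" "linform u"
  shows "u v = c1 v * u b1 + c2 v * u b2 + c3 v * u b3"
proof -
  have "u v = u (scale3 (c1 v) b1 + scale3 (c2 v) b2 + scale3 (c3 v) b3)"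
    by (rule arg_cong[OF frameD[OF assms(1)]])
  then show ?thesis using assms(2) by (simp add: linform_add linform_scale)
qed

lemma frame_swap12:
  assumes "frame b1 b2 b3 c1 c2 c3"
  shows "frame b2 b1 b3 c2 c1 c3"
proof -
  have "v = scale3 (c2 v) b2 + scale3 (c1 v) b1 + scale3 (c3 v) b3" for v
    by (rule trans[OF frameD[OF assms]]) (simp only: ac_simps)
  then show ?thesis using assms unfolding frame_def by blast
qed

lemma frame_swap23:
  assumes "frame b1 b2 b3 c1 c2 c3"
  shows "frame b1 b3 b2 c1 c3 c2"
proof -
  have "v = scale3 (c1 v) b1 + scale3 (c3 v) b3 + scale3 (c2 v) b2" for v
    by (rule trans[OF frameD[OF assms]]) (simp only: ac_simps)
  then show ?thesis using assms unfolding frame_def by blast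
qed

lemma posbasis_swap12: "posbasis S P b1 b2 b3 c1 c2 c3 \<Longrightarrow> posbasis S P b2 b1 b3 c2 c1 c3"
  unfolding posbasis_def using frame_swap12 by blast

lemma posbasis_swap23: "posbasis S P b1 b2 b3 c1 c2 c3 \<Longrightarrow> posbasis S P b1 b3 b2 c1 c3 c2"
  unfolding posbasis_def using frame_swap23 by blast

section \<open>Chambers adjacent to a flag, described by lexicographic signs\<close>

definition lexpos :: "(v3 \<Rightarrow> int) \<Rightarrow> (v3 \<Rightarrow> int) \<Rightarrow> (v3 \<Rightarrow> int) \<Rightarrow> v3 \<Rightarrow> bool" where
  "lexpos u0 u1 u2 r \<longleftrightarrow> 0 < u0 r \<or> u0 r = 0 \<and> (0 < u1 r \<or> u1 r = 0 \<and> 0 < u2 r)"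

lemma posbasis_pos:
  assumes "posbasis S P b1 b2 b3 c1 c2 c3" "\<forall>r\<in>S. - r \<in> S" "\<forall>r\<in>S. P r \<or> P (- r)"
  shows "P b1" "P b2" "P b3"
proof -
  have lf: "linform c1" "linform c2" "linform c3" using assms(1) unfolding posbasis_def frame_def by auto
  have one: "c1 b1 = 1" "c2 b2 = 1" "c3 b3 = 1" using assms(1) unfolding posbasis_def frame_def by auto
  have "\<not> P (- b1)" "\<not> P (- b2)" "\<not> P (- b3)"
    using assms(1,2) lf one unfolding posbasis_def by (force simp: linform_uminus)+
  then show "P b1" "P b2" "P b3" using assms unfolding posbasis_def by blast+
qed

text \<open>On a finite set, lexicographic signs are the signs of a single integral form, so a
  chamber touching a prescribed face may be chosen.\<close>

lemma lex_posbasis: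
  assumes S: "crystal S" and u: "linform u0" "linform u1" "linform u2"
    and nz: "\<And>r. r \<in> S \<Longrightarrow> u0 r = 0 \<Longrightarrow> u1 r = 0 \<Longrightarrow> u2 r \<noteq> 0"
  obtains b1 b2 b3 c1 c2 c3 where "posbasis S (lexpos u0 u1 u2) b1 b2 b3 c1 c2 c3"
    "lexpos u0 u1 u2 b1" "lexpos u0 u1 u2 b2" "lexpos u0 u1 u2 b3"
proof -
  have fin: "finite S" and sym: "\<forall>r\<in>S. - r \<in> S" using S unfolding crystal_def by auto
  define M where "M = Max (insert 1 ((\<lambda>r. \<bar>u1 r\<bar> + \<bar>u2 r\<bar>) ` S))"
  have M1: "1 \<le> M" unfolding M_def using fin by (intro Max_ge) auto
  have M: "\<bar>u1 r\<bar> \<le> M" "\<bar>u2 r\<bar> \<le> M" if "r \<in> S" for r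
  proof -
    have "\<bar>u1 r\<bar> + \<bar>u2 r\<bar> \<le> M" unfolding M_def using fin that by (intro Max_ge) auto
    then show "\<bar>u1 r\<bar> \<le> M" "\<bar>u2 r\<bar> \<le> M" by auto
  qed
  \<comment> \<open>K exceeds twice every value of u1 and u2, so that in base K a lower digit never
    overturns a higher one.\<close>
  define K where "K = 2 * M + 1"
  define v where "v = (\<lambda>r. K * K * u0 r + K * u1 r + u2 r)"
  have lv: "linform v"
    using u unfolding linform_def v_def
  proof (elim exE)
    fix a b c a' b' c' a'' b'' c''
    assume "\<forall>x y z. u0 (x, y, z) = a * x + b * y + c * z" "\<forall>x y z. u1 (x, y, z) = a' * x + b' * y + c' * z"
      "\<forall>x y z. u2 (x, y, z) = a'' * x + b'' * y + c'' * z"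
    then show "\<exists>a b c. \<forall>x y z. K * K * u0 (x, y, z) + K * u1 (x, y, z) + u2 (x, y, z) = a * x + b * y + c * z"
      by (intro exI[of _ "K*K*a+K*a'+a''"] exI[of _ "K*K*b+K*b'+b''"] exI[of _ "K*K*c+K*c'+c''"])
         (simp add: algebra_simps)
  qed
  have vpos: "0 < v r" if "r \<in> S" "lexpos u0 u1 u2 r" for r
  proof -
    consider "1 \<le> u0 r" | "u0 r = 0" "1 \<le> u1 r" | "u0 r = 0" "u1 r = 0" "0 < u2 r"
      using \<open>lexpos u0 u1 u2 r\<close> unfolding lexpos_def by force
    then show ?thesis
    proof cases
      case 1
      have a: "K * K * 1 \<le> K * K * u0 r" using 1 M1 by (intro mult_left_mono) (auto simp: K_def)
      have b: "K * (- M) \<le> K * u1 r" using M(1)[OF that(1)] M1 by (intro mult_left_mono) (auto simp: K_def)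
      have c: "K * (M + 1) \<ge> M + 1" using M1 by (simp add: K_def)
      have d: "K * K - K * M = K * (M + 1)" by (simp add: K_def algebra_simps)
      show ?thesis using a b c d M(2)[OF that(1)] unfolding v_def by linarith
    next
      case 2
      have "K * 1 \<le> K * u1 r" using 2 M1 by (intro mult_left_mono) (auto simp: K_def)
      moreover have "v r = K * u1 r + u2 r" using 2 by (simp add: v_def)
      ultimately show ?thesis using M(2)[OF that(1)] M1 K_def by linarith
    next
      case 3 then show ?thesis by (simp add: v_def)
    qed
  qed
  have dich: "lexpos u0 u1 u2 r \<or> lexpos u0 u1 u2 (- r)" if "r \<in> S" for r
    using nz[OF that] u unfolding lexpos_def by (auto simp: linform_uminus)
  have vneg: "v r < 0" if "r \<in> S" "\<not> lexpos u0 u1 u2 r" for r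
    using vpos[of "- r"] dich[OF that(1)] that sym lv by (auto simp: linform_uminus)
  have eq: "0 < v r \<longleftrightarrow> lexpos u0 u1 u2 r" if "r \<in> S" for r
    using vpos[OF that] vneg[OF that] by fastforce
  have "\<forall>r\<in>S. v r \<noteq> 0" using vpos vneg by force
  then obtain b1 b2 b3 c1 c2 c3 where "posbasis S (\<lambda>r. 0 < v r) b1 b2 b3 c1 c2 c3"
    using S lv unfolding crystal_def by meson
  then have pb: "posbasis S (lexpos u0 u1 u2) b1 b2 b3 c1 c2 c3"
    unfolding posbasis_def using eq by blast
  show thesis
    using that[OF pb] posbasis_pos[OF pb] sym dich by blast
qed

text \<open>The three terms are nonnegative and sum to u0 r = 0, so a positive root on the face
  involves only walls through that face. \<open>lex_expand1\<close> repeats this one level deeper in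
  the flag.\<close>

lemma lex_expand0:
  assumes "frame b1 b2 b3 c1 c2 c3" "linform u0"
    and lp: "lexpos u0 u1 u2 b1" "lexpos u0 u1 u2 b2" "lexpos u0 u1 u2 b3"
    and cn: "0 \<le> c1 r" "0 \<le> c2 r" "0 \<le> c3 r" and r: "u0 r = 0"
  shows "c1 r * u0 b1 = 0" "c2 r * u0 b2 = 0" "c3 r * u0 b3 = 0"
proof -
  have "c1 r * u0 b1 + c2 r * u0 b2 + c3 r * u0 b3 = 0" using frame_expand[OF assms(1,2), of r] r by simp
  moreover have "0 \<le> u0 b1" "0 \<le> u0 b2" "0 \<le> u0 b3" using lp unfolding lexpos_def by auto
  ultimately show "c1 r * u0 b1 = 0" "c2 r * u0 b2 = 0" "c3 r * u0 b3 = 0"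
    using mult_nonneg_nonneg[OF cn(1)] mult_nonneg_nonneg[OF cn(2)] mult_nonneg_nonneg[OF cn(3)]
    by (smt (verit))+
qed

lemma lex_coeff_nonneg: "lexpos u0 u1 u2 b \<Longrightarrow> c * u0 b = 0 \<Longrightarrow> 0 \<le> c \<Longrightarrow> 0 \<le> c * u1 b"
  unfolding lexpos_def by (cases "c = 0") auto

lemma lex_expand1:
  assumes "frame b1 b2 b3 c1 c2 c3" "linform u0" "linform u1"
    and lp: "lexpos u0 u1 u2 b1" "lexpos u0 u1 u2 b2" "lexpos u0 u1 u2 b3"
    and cn: "0 \<le> c1 r" "0 \<le> c2 r" "0 \<le> c3 r" and r: "u0 r = 0" "u1 r = 0"
  shows "c1 r * u1 b1 = 0" "c2 r * u1 b2 = 0" "c3 r * u1 b3 = 0"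
proof -
  note q0 = lex_expand0[OF assms(1,2) lp cn r(1)]
  have "c1 r * u1 b1 + c2 r * u1 b2 + c3 r * u1 b3 = 0" using frame_expand[OF assms(1,3), of r] r by simp
  then show "c1 r * u1 b1 = 0" "c2 r * u1 b2 = 0" "c3 r * u1 b3 = 0"
    using lex_coeff_nonneg[OF lp(1) q0(1) cn(1)] lex_coeff_nonneg[OF lp(2) q0(2) cn(2)]
      lex_coeff_nonneg[OF lp(3) q0(3) cn(3)] by linarith+
qed

text \<open>Choose a flag whose first two forms cut out the line of r. Then r is itself a wall of
  the adjacent chamber, so a coordinate form takes the value 1 on it; this value is n times an
  integer.\<close>

lemma crystal_primitive:
  assumes S: "crystal S" and r: "r \<in> S" "r = scale3 n z"
  shows "n = 1 \<or> n = - 1"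
proof -
  obtain a b c where z: "z = (a, b, c)" by (cases z)
  have sym: "\<forall>r\<in>S. - r \<in> S" and nz: "0 \<notin> S"
    and red: "\<And>r s m n. r \<in> S \<Longrightarrow> s \<in> S \<Longrightarrow> m \<noteq> 0 \<Longrightarrow> scale3 m r = scale3 n s \<Longrightarrow> s = r \<or> s = - r"
    using S unfolding crystal_def by metis+
  have n0: "n \<noteq> 0" using r nz z by (auto simp: zero_prod_def)
  have z0: "a \<noteq> 0 \<or> b \<noteq> 0 \<or> c \<noteq> 0" using r nz z by (auto simp: zero_prod_def)
  obtain u0 u1 where u: "linform u0" "linform u1" and uz: "u0 z = 0" "u1 z = 0"
    and par: "\<And>s. u0 s = 0 \<Longrightarrow> u1 s = 0 \<Longrightarrow> \<exists>m k. m \<noteq> 0 \<and> scale3 m s = scale3 k z"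
  proof (cases "a = 0")
    case False
    show thesis
    proof (rule that[of "\<lambda>(x,y,w). b * x - a * y" "\<lambda>(x,y,w). c * x - a * w"])
      show "linform (\<lambda>(x,y,w). b * x - a * y)" by (rule linformI[of _ b "-a" 0]) simp
      show "linform (\<lambda>(x,y,w). c * x - a * w)" by (rule linformI[of _ c 0 "-a"]) simp
      show "\<exists>m k. m \<noteq> 0 \<and> scale3 m s = scale3 k z"
        if "(\<lambda>(x,y,w). b * x - a * y) s = 0" "(\<lambda>(x,y,w). c * x - a * w) s = 0" for s
        using that False z by (intro exI[of _ a] exI[of _ "fst s"]) (cases s, auto simp: mult.commute)
    qed (auto simp: z)
  next
    case True
    show thesis
    proof (rule that[of "\<lambda>(x,y,w). x" "\<lambda>(x,y,w). c * y - b * w"])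
      show "linform (\<lambda>(x,y,w). x)" by (rule linformI[of _ 1 0 0]) simp
      show "linform (\<lambda>(x,y,w). c * y - b * w)" by (rule linformI[of _ 0 c "-b"]) simp
      show "\<exists>m k. m \<noteq> 0 \<and> scale3 m s = scale3 k z"
        if h: "(\<lambda>(x,y,w). x) s = 0" "(\<lambda>(x,y,w). c * y - b * w) s = 0" for s
      proof (cases "b = 0")
        case False
        then show ?thesis
          using h True z by (intro exI[of _ b] exI[of _ "fst (snd s)"]) (cases s, auto simp: mult.commute)
      next
        case True
        with z0 \<open>a = 0\<close> have "c \<noteq> 0" by simp
        then show ?thesis
          using h True z \<open>a = 0\<close> by (intro exI[of _ c] exI[of _ "snd (snd s)"]) (cases s, auto simp: mult.commute)
      qed
    qed (auto simp: z True)
  qed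
  have par': "s = r \<or> s = - r" if s: "s \<in> S" "u0 s = 0" "u1 s = 0" for s
  proof -
    obtain m k where mk: "m \<noteq> 0" "scale3 m s = scale3 k z" using par s by blast
    have "scale3 (n * m) s = scale3 k r"
      using mk(2) r(2) z by (cases s) (auto simp: mult.assoc mult.left_commute)
    then have "r = s \<or> r = - s" using red[OF s(1) r(1), of "n * m" k] n0 mk(1) by simp
    then show ?thesis by auto
  qed
  \<comment> \<open>The factor n makes u2 r equal to n * n times a sum of squares, hence
    positive.\<close>
  define u2 where "u2 = (\<lambda>(x,y,w). n * (a * x + b * y + c * w))"
  have lu2: "linform u2" by (rule linformI[of _ "n*a" "n*b" "n*c"]) (simp add: u2_def algebra_simps)
  have sq: "0 < a * a + b * b + c * c"
  proof -
    have "0 < a * a \<or> 0 < b * b \<or> 0 < c * c" using z0 by (auto simp: zero_less_mult_iff linorder_neq_iff)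
    then show ?thesis using zero_le_square[of a] zero_le_square[of b] zero_le_square[of c] by linarith
  qed
  have u2r: "0 < u2 r"
  proof -
    have "u2 r = (n * n) * (a * a + b * b + c * c)" using r z by (simp add: u2_def algebra_simps)
    moreover have "0 < n * n" using n0 by (auto simp: zero_less_mult_iff linorder_neq_iff)
    ultimately show ?thesis using sq by simp
  qed
  have ur: "u0 r = 0" "u1 r = 0" using r uz u by (auto simp: linform_scale)
  obtain b1 b2 b3 c1 c2 c3 where pb: "posbasis S (lexpos u0 u1 u2) b1 b2 b3 c1 c2 c3"
    and lp: "lexpos u0 u1 u2 b1" "lexpos u0 u1 u2 b2" "lexpos u0 u1 u2 b3"
    using lex_posbasis[OF S u lu2] par' u2r lu2 by (metis linform_uminus neg_equal_0_iff_equal order_less_irrefl)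
  have fr: "frame b1 b2 b3 c1 c2 c3" and bS: "b1 \<in> S" "b2 \<in> S" "b3 \<in> S"
    and cn: "0 \<le> c1 r" "0 \<le> c2 r" "0 \<le> c3 r"
    using pb r(1) ur u2r unfolding posbasis_def lexpos_def by auto
  have lc: "linform c1" "linform c2" "linform c3" using fr unfolding frame_def by auto
  note q0 = lex_expand0[OF fr u(1) lp cn ur(1)]
  note q1 = lex_expand1[OF fr u(1,2) lp cn ur]
  have key: "bi = r" if "bi \<in> S" "lexpos u0 u1 u2 bi" "u0 bi = 0" "u1 bi = 0" for bi
    using par'[OF that(1,3,4)] that u2r lu2 unfolding lexpos_def by (auto simp: linform_uminus)
  have "c1 r \<noteq> 0 \<or> c2 r \<noteq> 0 \<or> c3 r \<noteq> 0"
    using frame_expand[OF fr lu2, of r] u2r by auto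
  moreover have "b1 = r" if "c1 r \<noteq> 0" using key[OF bS(1) lp(1)] that q0 q1 by simp
  moreover have "b2 = r" if "c2 r \<noteq> 0" using key[OF bS(2) lp(2)] that q0 q1 by simp
  moreover have "b3 = r" if "c3 r \<noteq> 0" using key[OF bS(3) lp(3)] that q0 q1 by simp
  moreover have "c1 b1 = 1" "c2 b2 = 1" "c3 b3 = 1" using fr unfolding frame_def by auto
  ultimately have "c1 r = 1 \<or> c2 r = 1 \<or> c3 r = 1" by blast
  then have "n * c1 z = 1 \<or> n * c2 z = 1 \<or> n * c3 z = 1"
    using r(2) lc by (simp add: linform_scale)
  then show ?thesis by (metis zmult_eq_1_iff)
qed

lemma scale3_0 [simp]: "scale3 0 v = 0" and scale3_1 [simp]: "scale3 1 v = v"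
  by (cases v, simp add: zero_prod_def)+

lemma frame_eq1:
  assumes "frame b1 b2 b3 c1 c2 c3" "c1 w = 1" "c2 w = 0" "c3 w = 0"
  shows "w = b1"
proof -
  have "w = scale3 (c1 w) b1 + scale3 (c2 w) b2 + scale3 (c3 w) b3" by (rule frameD[OF assms(1)])
  also have "\<dots> = b1" using assms(2-4) by simp
  finally show ?thesis .
qed

text \<open>On positive roots in the kernel of u0, integrality makes u1 at least 1, so a root of
  value 1 cannot be split into several walls.\<close>

lemma lex_simple:
  assumes pb: "posbasis S (lexpos u0 u1 u2) b1 b2 b3 c1 c2 c3"
    and lp: "lexpos u0 u1 u2 b1" "lexpos u0 u1 u2 b2" "lexpos u0 u1 u2 b3"
    and u: "linform u0" "linform u1"
    and nz: "\<And>r. r \<in> S \<Longrightarrow> u0 r = 0 \<Longrightarrow> u1 r \<noteq> 0"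
    and w: "w \<in> S" "u0 w = 0" "u1 w = 1"
  shows "w = b1 \<or> w = b2 \<or> w = b3"
proof -
  have fr: "frame b1 b2 b3 c1 c2 c3" and bS: "b1 \<in> S" "b2 \<in> S" "b3 \<in> S"
    and cn: "0 \<le> c1 w" "0 \<le> c2 w" "0 \<le> c3 w"
    using pb w unfolding posbasis_def lexpos_def by auto
  note q0 = lex_expand0[OF fr u(1) lp cn w(2)]
  have le: "c \<le> c * u1 b" if "b \<in> S" "lexpos u0 u1 u2 b" "c * u0 b = 0" "0 \<le> c" for b c
  proof (cases "c = 0")
    case False
    then have "u0 b = 0" using that by simp
    then have "1 \<le> u1 b" using nz[OF that(1)] that(2) unfolding lexpos_def by auto
    then show ?thesis using mult_left_mono[of 1 "u1 b" c] that(4) by simp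
  qed simp
  have "c1 w * u1 b1 + c2 w * u1 b2 + c3 w * u1 b3 = 1" using frame_expand[OF fr u(2), of w] w by simp
  then have s: "c1 w + c2 w + c3 w \<le> 1"
    using le[OF bS(1) lp(1) q0(1) cn(1)] le[OF bS(2) lp(2) q0(2) cn(2)] le[OF bS(3) lp(3) q0(3) cn(3)] by linarith
  have "\<not> (c1 w = 0 \<and> c2 w = 0 \<and> c3 w = 0)" using frame_expand[OF fr u(2), of w] w by auto
  then consider "c1 w = 1" "c2 w = 0" "c3 w = 0" | "c1 w = 0" "c2 w = 1" "c3 w = 0" | "c1 w = 0" "c2 w = 0" "c3 w = 1"
    using s cn by linarith
  then show ?thesis
    using frame_eq1[OF fr] frame_eq1[OF frame_swap12[OF fr]] frame_eq1[OF frame_swap12[OF frame_swap23[OF fr]]]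
    by cases blast+
qed

text \<open>Two indecomposable roots of one chamber belong to a common lattice basis. The form u1 is
  repeated because it already breaks every tie left by u0.\<close>

lemma lex_two_simple:
  assumes S: "crystal S" and u: "linform u0" "linform u1"
    and nz: "\<And>r. r \<in> S \<Longrightarrow> u0 r = 0 \<Longrightarrow> u1 r \<noteq> 0"
    and w1: "w1 \<in> S" "u0 w1 = 0" "u1 w1 = 1" and w2: "w2 \<in> S" "u0 w2 = 0" "u1 w2 = 1"
    and ne: "w1 \<noteq> w2"
  obtains b3 c1 c2 c3 where "posbasis S (lexpos u0 u1 u1) w1 w2 b3 c1 c2 c3" "lexpos u0 u1 u1 b3"
proof -
  obtain b1 b2 b3 c1 c2 c3 where pb: "posbasis S (lexpos u0 u1 u1) b1 b2 b3 c1 c2 c3"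
    and lp: "lexpos u0 u1 u1 b1" "lexpos u0 u1 u1 b2" "lexpos u0 u1 u1 b3"
    using lex_posbasis[OF S u u(2)] nz by blast
  have "w1 = b1 \<or> w1 = b2 \<or> w1 = b3" "w2 = b1 \<or> w2 = b2 \<or> w2 = b3"
    using lex_simple[OF pb lp u nz] w1 w2 by auto
  then consider "w1 = b1" "w2 = b2" | "w1 = b2" "w2 = b1" | "w1 = b1" "w2 = b3" | "w1 = b3" "w2 = b1"
    | "w1 = b2" "w2 = b3" | "w1 = b3" "w2 = b2" using ne by blast
  then show thesis
  proof cases
    case 1 then show ?thesis using that pb lp by blast
  next
    case 2 then show ?thesis using that posbasis_swap12[OF pb] lp by blast
  next
    case 3 then show ?thesis using that posbasis_swap23[OF pb] lp by blast
  next
    case 4 then show ?thesis using that posbasis_swap12[OF posbasis_swap23[OF pb]] lp by blast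
  next
    case 5 then show ?thesis using that posbasis_swap23[OF posbasis_swap12[OF pb]] lp by blast
  next
    case 6 then show ?thesis using that posbasis_swap12[OF posbasis_swap23[OF posbasis_swap12[OF pb]]] lp by blast
  qed
qed

section \<open>Unimodular changes of coordinates\<close>

definition linmap :: "(v3 \<Rightarrow> v3) \<Rightarrow> bool" where
  "linmap T \<longleftrightarrow> (\<forall>v w. T (v + w) = T v + T w) \<and> (\<forall>n v. T (scale3 n v) = scale3 n (T v)) \<and>
     (\<forall>u. linform u \<longrightarrow> linform (\<lambda>v. u (T v)))"

lemma linmapI:
  assumes "\<And>x y z. T (x, y, z) = (a1 * x + b1 * y + d1 * z, a2 * x + b2 * y + d2 * z, a3 * x + b3 * y + d3 * z)"
  shows "linmap T"
proof -
  have "T (v + w) = T v + T w" for v w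
  proof -
    obtain x y z x' y' z' where vw: "v = (x, y, z)" "w = (x', y', z')" by (cases v; cases w)
    show ?thesis unfolding vw by (simp add: assms distrib_left)
  qed
  moreover have "T (scale3 n v) = scale3 n (T v)" for n v
  proof -
    obtain x y z where v: "v = (x, y, z)" by (cases v)
    show ?thesis unfolding v assms scale3_simp prod.inject by (intro conjI; algebra)
  qed
  moreover have "linform (\<lambda>v. u (T v))" if lu: "linform u" for u
  proof -
    obtain p q r where u: "\<And>x y z. u (x, y, z) = p * x + q * y + r * z" using lu unfolding linform_def by blast
    show ?thesis
    proof (rule linformI)
      fix x y z
      show "u (T (x, y, z)) = (p*a1+q*a2+r*a3)*x + (p*b1+q*b2+r*b3)*y + (p*d1+q*d2+r*d3)*z"
        unfolding assms u by algebra
    qed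
  qed
  ultimately show ?thesis unfolding linmap_def by blast
qed

lemma linmap_uminus: "linmap T \<Longrightarrow> T (- v) = - T v"
proof -
  assume T: "linmap T"
  have e: "- w = scale3 (- 1) w" for w by (cases w) simp
  have "T (scale3 (- 1) v) = scale3 (- 1) (T v)" using T unfolding linmap_def by blast
  then show ?thesis by (simp only: e)
qed

lemma crystal_finite: "crystal S \<Longrightarrow> finite S"
  and crystal_zero: "crystal S \<Longrightarrow> 0 \<notin> S"
  unfolding crystal_def by (elim conjE, assumption)+

lemma crystal_sym: "crystal S \<Longrightarrow> r \<in> S \<Longrightarrow> - r \<in> S"
  unfolding crystal_def by (elim conjE, drule (1) bspec)

lemma crystal_reduced:
  assumes "crystal S"
  shows "r \<in> S \<Longrightarrow> s \<in> S \<Longrightarrow> m \<noteq> 0 \<Longrightarrow> scale3 m r = scale3 n s \<Longrightarrow> s = r \<or> s = - r"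
proof -
  have "\<forall>r\<in>S. \<forall>s\<in>S. \<forall>m n. m \<noteq> 0 \<longrightarrow> scale3 m r = scale3 n s \<longrightarrow> s = r \<or> s = - r"
    using assms unfolding crystal_def by (elim conjE)
  then show "r \<in> S \<Longrightarrow> s \<in> S \<Longrightarrow> m \<noteq> 0 \<Longrightarrow> scale3 m r = scale3 n s \<Longrightarrow> s = r \<or> s = - r" by blast
qed

lemma crystal_posbasis:
  assumes "crystal S" "linform u" "\<forall>r\<in>S. u r \<noteq> 0"
  obtains b1 b2 b3 c1 c2 c3 where "posbasis S (\<lambda>r. 0 < u r) b1 b2 b3 c1 c2 c3"
proof -
  have "\<forall>u. linform u \<longrightarrow> (\<forall>r\<in>S. u r \<noteq> 0) \<longrightarrow>
        (\<exists>b1 b2 b3 c1 c2 c3. posbasis S (\<lambda>r. 0 < u r) b1 b2 b3 c1 c2 c3)"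
    using assms(1) unfolding crystal_def by (elim conjE)
  with assms(2,3) that show thesis by metis
qed

lemma crystal_vimage:
  assumes S: "crystal S" and T: "linmap T" "linmap T'" and inv: "\<And>v. T (T' v) = v" "\<And>v. T' (T v) = v"
  shows "crystal {v. T v \<in> S}" (is "crystal ?S")
proof -
  have eq: "?S = T' ` S"
  proof (intro set_eqI iffI)
    fix v assume "v \<in> ?S"
    then show "v \<in> T' ` S" using inv(2)[of v] by (metis imageI mem_Collect_eq)
  next
    fix v assume "v \<in> T' ` S"
    then show "v \<in> ?S" using inv(1) by auto
  qed
  have lin: "T (v + w) = T v + T w" "T (scale3 n v) = scale3 n (T v)"
     "T' (v + w) = T' v + T' w" "T' (scale3 n v) = scale3 n (T' v)"
     "linform u \<Longrightarrow> linform (\<lambda>v. u (T v))" "linform u \<Longrightarrow> linform (\<lambda>v. u (T' v))" for v w n u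
    using T unfolding linmap_def by blast+
  have T0: "T 0 = 0" using lin(2)[of 0 0] by simp
  have "finite ?S" unfolding eq using crystal_finite[OF S] by blast
  moreover have "0 \<notin> ?S" using crystal_zero[OF S] T0 by simp
  moreover have "- r \<in> ?S" if "r \<in> ?S" for r using crystal_sym[OF S] that T by (simp add: linmap_uminus)
  moreover have "s = r \<or> s = - r"
    if "r \<in> ?S" "s \<in> ?S" "m \<noteq> 0" "scale3 m r = scale3 n s" for r s m n
  proof -
    have "scale3 m (T r) = scale3 n (T s)" using that(4) lin(2) by metis
    then have "T s = T r \<or> T s = T (- r)" using crystal_reduced[OF S, of "T r" "T s" m n] that T by (simp add: linmap_uminus)
    then show ?thesis using inv(2) by metis
  qed
  moreover have "\<exists>b1 b2 b3 c1 c2 c3. posbasis ?S (\<lambda>r. 0 < u r) b1 b2 b3 c1 c2 c3"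
    if u: "linform u" "\<forall>r\<in>?S. u r \<noteq> 0" for u
  proof -
    have "\<forall>r\<in>S. u (T' r) \<noteq> 0"
    proof
      fix r assume "r \<in> S"
      then show "u (T' r) \<noteq> 0" using bspec[OF u(2), of "T' r"] inv(1)[of r] by simp
    qed
    then obtain b1 b2 b3 c1 c2 c3 where pb: "posbasis S (\<lambda>r. 0 < u (T' r)) b1 b2 b3 c1 c2 c3"
      using crystal_posbasis[OF S lin(6)[OF u(1)]] by metis
    then have fr: "frame b1 b2 b3 c1 c2 c3" unfolding posbasis_def by blast
    have "v = scale3 (c1 (T v)) (T' b1) + scale3 (c2 (T v)) (T' b2) + scale3 (c3 (T v)) (T' b3)" for v
      using arg_cong[OF frameD[OF fr, of "T v"], of T'] by (simp only: lin inv)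
    then have "frame (T' b1) (T' b2) (T' b3) (\<lambda>v. c1 (T v)) (\<lambda>v. c2 (T v)) (\<lambda>v. c3 (T v))"
      using fr lin(5) unfolding frame_def inv by blast
    moreover have "0 \<le> c1 (T r) \<and> 0 \<le> c2 (T r) \<and> 0 \<le> c3 (T r)" if "T r \<in> S" "0 < u r" for r
      using pb that inv(2)[of r] unfolding posbasis_def by metis
    moreover have "T' b1 \<in> ?S" "T' b2 \<in> ?S" "T' b3 \<in> ?S"
      using pb inv(1) unfolding posbasis_def by simp_all
    ultimately have "posbasis ?S (\<lambda>r. 0 < u r) (T' b1) (T' b2) (T' b3) (\<lambda>v. c1 (T v)) (\<lambda>v. c2 (T v)) (\<lambda>v. c3 (T v))"
      unfolding posbasis_def by blast
    then show ?thesis by blast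
  qed
  ultimately show ?thesis unfolding crystal_def by blast
qed

lemma crystal_sym_iff: "crystal S \<Longrightarrow> - r \<in> S \<longleftrightarrow> r \<in> S"
  using crystal_sym by fastforce

lemma crystal_nonzero: "crystal S \<Longrightarrow> (0, 0, 0) \<notin> S"
  using crystal_zero by (auto simp: zero_prod_def)

lemma linform_proj [simp]:
  "linform (\<lambda>(x, y, z). x)" "linform (\<lambda>(x, y, z). y)" "linform (\<lambda>(x, y, z). z)"
  "linform (\<lambda>(x, y, z). x - y)" "linform (\<lambda>(x, y, z). y + z)"
  by (rule linformI[of _ 1 0 0], simp, rule linformI[of _ 0 1 0], simp, rule linformI[of _ 0 0 1], simp,
      rule linformI[of _ 1 "-1" 0], simp, rule linformI[of _ 0 1 1], simp)

lemma posbasis_coeffs: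
  assumes "posbasis S P b1 b2 b3 c1 c2 c3"
  shows "linform c1" "linform c2" "linform c3"
    "c1 b1 = 1" "c1 b2 = 0" "c1 b3 = 0" "c2 b1 = 0" "c2 b2 = 1" "c2 b3 = 0" "c3 b1 = 0" "c3 b2 = 0" "c3 b3 = 1"
    "frame b1 b2 b3 c1 c2 c3" "b1 \<in> S" "b2 \<in> S" "b3 \<in> S"
    "r \<in> S \<Longrightarrow> P r \<Longrightarrow> 0 \<le> c1 r" "r \<in> S \<Longrightarrow> P r \<Longrightarrow> 0 \<le> c2 r" "r \<in> S \<Longrightarrow> P r \<Longrightarrow> 0 \<le> c3 r"
  using assms unfolding posbasis_def frame_def by blast+

text \<open>If the sum of two roots that are part of a lattice basis is not a root, then the two roots
  are neighbours in their rank two localization.\<close>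

lemma crystal_neighbours:
  assumes S: "crystal S" and e: "(1,0,0) \<in> S" "(0,1,0) \<in> S" and n: "(1,1,0) \<notin> S" and r: "(i,j,0) \<in> S"
  shows "i * j \<le> 0"
proof -
  \<comment> \<open>x - y takes the value 1 on (1,0,0) and on (0,-1,0), and by primitivity only
    (1,1,0) and its negative could be zeros in the plane. So both roots are walls of one
    chamber.\<close>
  let ?u0 = "\<lambda>(x, y, z). z :: int" and ?u1 = "\<lambda>(x, y, z::int). x - y :: int"
  have nz: "?u1 r \<noteq> 0" if rS: "r \<in> S" and r0: "?u0 r = 0" for r
  proof
    assume "?u1 r = 0"
    then obtain m where m: "r = scale3 m (1,1,0)" using r0 by (cases r) auto
    then have "m = 1 \<or> m = - 1" using crystal_primitive[OF S rS] by blast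
    then have "r = (1,1,0) \<or> r = - (1,1,0)" using m by auto
    then show False using n rS crystal_sym_iff[OF S] by metis
  qed
  have m: "(0,-1,0) \<in> S" using crystal_sym[OF S e(2)] by simp
  obtain b3 c1 c2 c3 where pb: "posbasis S (lexpos ?u0 ?u1 ?u1) (1,0,0) (0,-1,0) b3 c1 c2 c3"
    by (rule lex_two_simple[OF S, of ?u0 ?u1 "(1,0,0)" "(0,-1,0)"]) (use nz e m in auto)
  note pc = posbasis_coeffs[OF pb]
  have c: "c1 (x,y,0) = x" "c2 (x,y,0) = - y" for x y
    using linform_coords[OF pc(1), of x y 0] linform_coords[OF pc(2), of x y 0] pc(4,5,7,8)
      linform_uminus[OF pc(1), of "(0,1,0)"] linform_uminus[OF pc(2), of "(0,1,0)"] by auto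
  show ?thesis
  proof (cases "lexpos ?u0 ?u1 ?u1 (i,j,0)")
    case True
    then have "0 \<le> i" "0 \<le> - j" using pc(17)[OF r] pc(18)[OF r] c by auto
    then show ?thesis by (simp add: mult_nonneg_nonpos)
  next
    case False
    have r': "(-i,-j,0) \<in> S" using crystal_sym[OF S r] by simp
    have "lexpos ?u0 ?u1 ?u1 (-i,-j,0)" using False nz[OF r] unfolding lexpos_def by auto
    then have "0 \<le> - i" "0 \<le> j" using pc(17)[OF r'] pc(18)[OF r'] c by auto
    then show ?thesis by (simp add: mult_nonpos_nonneg)
  qed
qed

text \<open>Otherwise x has no zeros on the roots with z = 0; the two given roots have its least
  positive value and so belong to one lattice basis, although their determinant is k. This is fact
  (1).\<close>

lemma crystal_divided_difference:
  assumes S: "crystal S" and e: "(1,0,0) \<in> S" "(1,k,0) \<in> S" and k: "2 \<le> k"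
  shows "(0,1,0) \<in> S"
proof (rule ccontr)
  assume n: "(0,1,0) \<notin> S"
  let ?u0 = "\<lambda>(x, y, z). z :: int" and ?u1 = "\<lambda>(x, y, z). x :: int"
  have nz: "?u1 r \<noteq> 0" if rS: "r \<in> S" and r0: "?u0 r = 0" for r
  proof
    assume "?u1 r = 0"
    then obtain m where m: "r = scale3 m (0,1,0)" using r0 by (cases r) auto
    then have "m = 1 \<or> m = - 1" using crystal_primitive[OF S rS] by blast
    then have "r = (0,1,0) \<or> r = - (0,1,0)" using m by auto
    then show False using n rS crystal_sym_iff[OF S] by metis
  qed
  obtain b3 c1 c2 c3 where pb: "posbasis S (lexpos ?u0 ?u1 ?u1) (1,0,0) (1,k,0) b3 c1 c2 c3"
    by (rule lex_two_simple[OF S, of ?u0 ?u1 "(1,0,0)" "(1,k,0)"]) (use nz e k in auto)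
  note pc = posbasis_coeffs[OF pb]
  have "k * c2 (0,1,0) = 1" using linform_coords[OF pc(2), of 1 k 0] pc(7,8) by simp
  then show False using zmult_eq_1_iff[of k "c2 (0,1,0)"] k by auto
qed

section \<open>Columns of roots\<close>

lemma crystal_shear:
  assumes "crystal S"
  shows "crystal {v. (\<lambda>(x, y, z). (x, y + a * x, z + w * x)) v \<in> S}"
  by (rule crystal_vimage[OF assms, of _ "\<lambda>(x, y, z). (x, y - a * x, z - w * x)"])
     (rule linmapI[of _ 1 0 0 a 1 0 w 0 1], simp, rule linmapI[of _ 1 0 0 "- a" 1 0 "- w" 0 1], simp, auto)

lemma crystal_rotate:
  assumes "crystal S"
  shows "crystal {v. (\<lambda>(x, y, z). (x, z, - y)) v \<in> S}"
  by (rule crystal_vimage[OF assms, of _ "\<lambda>(x, y, z). (x, - z, y)"])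
     (rule linmapI[of _ 1 0 0 0 0 1 0 "-1" 0], simp, rule linmapI[of _ 1 0 0 0 0 "-1" 0 1 0], simp, auto)

text \<open>At a first gap, the last root before it and (0,1,0) are neighbours by
  \<open>crystal_neighbours\<close>, yet the root at b is a positive combination of the two.\<close>

lemma crystal_interval:
  assumes S: "crystal S" and e: "(0,1,0) \<in> S" and ab: "(1,a,w) \<in> S" "(1,b,w) \<in> S" and y: "a \<le> y" "y \<le> b"
  shows "(1,y,w) \<in> S"
proof -
  have "a + int k \<le> b \<Longrightarrow> (1,a + int k,w) \<in> S" for k
  proof (induction k)
    case 0 then show ?case using ab by simp
  next
    case (Suc k)
    then have k: "(1,a + int k,w) \<in> S" by simp
    define S' where "S' = {v. (\<lambda>(x, y, z). (x, y + (a + int k) * x, z + w * x)) v \<in> S}"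
    have S': "crystal S'" unfolding S'_def by (rule crystal_shear[OF S])
    have "(1,0,0) \<in> S'" "(0,1,0) \<in> S'" "(1,b - (a + int k),0) \<in> S'" using k e ab unfolding S'_def by simp_all
    then have "(1,1,0) \<in> S'" using crystal_neighbours[OF S', of 1 "b - (a + int k)"] Suc.prems by auto
    then show ?case unfolding S'_def by (simp add: ac_simps)
  qed
  from this[of "nat (y - a)"] y show ?thesis by simp
qed

text \<open>Suppose there is none. In the chamber given by x - y, then x, then z, one wall is
  (0,0,1) and the other two have x - y positive. Modulo (0,0,1) the roots (1,0,0) and (0,-1,0), of
  value 1, are these two walls, so the negative of (1,n,s) gets the coordinates -1 and n of opposite
  signs.\<close>

lemma crystal_step:
  assumes S: "crystal S" and e: "(1,0,0) \<in> S" "(0,1,0) \<in> S" "(0,0,1) \<in> S" and r: "(1,n,s) \<in> S" and n: "1 \<le> n"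
  shows "\<exists>s'. (1,1,s') \<in> S"
proof (rule ccontr)
  assume no: "\<nexists>s'. (1,1,s') \<in> S"
  let ?u0 = "\<lambda>(x, y, z::int). x - y :: int" and ?u1 = "\<lambda>(x, y::int, z::int). x :: int"
    and ?u2 = "\<lambda>(x::int, y::int, z). z :: int"
  let ?P = "lexpos ?u0 ?u1 ?u2"
  have n2: "2 \<le> n" using no r n by (cases "n = 1") auto
  have nz: "?u2 r \<noteq> 0" if "r \<in> S" "?u0 r = 0" "?u1 r = 0" for r
    using that crystal_nonzero[OF S] by (cases r) auto
  obtain d1 d2 d3 k1 k2 k3 where pd: "posbasis S ?P d1 d2 d3 k1 k2 k3" and ld: "?P d1" "?P d2" "?P d3"
    by (rule lex_posbasis[OF S linform_proj(4,1,3) nz])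
  note pk = posbasis_coeffs[OF pd]
  have lpe: "?P (0,0,1)" by (simp add: lexpos_def)
  have cn: "0 \<le> k1 (0,0,1)" "0 \<le> k2 (0,0,1)" "0 \<le> k3 (0,0,1)" using pk(17-19)[OF e(3) lpe] .
  note q0 = lex_expand0[OF pk(13) linform_proj(4) ld cn, simplified]
  note q1 = lex_expand1[OF pk(13) linform_proj(4,1) ld cn, simplified]
  have key: "d = (0,0,1)" if d: "d \<in> S" "?P d" "?u0 d = 0" "?u1 d = 0" for d
  proof -
    obtain t where t: "d = scale3 t (0,0,1)" using d(3,4) by (cases d) auto
    then have "t = 1 \<or> t = - 1" using crystal_primitive[OF S d(1)] by blast
    then show ?thesis using t d(2) by (auto simp: lexpos_def)
  qed
  have "k1 (0,0,1) \<noteq> 0 \<or> k2 (0,0,1) \<noteq> 0 \<or> k3 (0,0,1) \<noteq> 0"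
    using frame_expand[OF pk(13) linform_proj(3), of "(0,0,1)"] by auto
  then have "d1 = (0,0,1) \<or> d2 = (0,0,1) \<or> d3 = (0,0,1)"
    using key[OF pk(14) ld(1)] key[OF pk(15) ld(2)] key[OF pk(16) ld(3)] q0 q1 by auto
  then obtain b2 b3 c1 c2 c3 where pb: "posbasis S ?P (0,0,1) b2 b3 c1 c2 c3" and lp: "?P b2" "?P b3"
    using pd ld posbasis_swap12[OF pd] posbasis_swap12[OF posbasis_swap23[OF pd]] by metis
  \<comment> \<open>A second wall with x = y would be a root (1,1,s'), which is excluded.\<close>
  have u0pos: "1 \<le> ?u0 b2" if pb: "posbasis S ?P (0,0,1) b2 b3 c1 c2 c3" and lp: "?P b2" for b2 b3 c1 c2 c3
  proof (rule ccontr)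
    assume "\<not> 1 \<le> ?u0 b2"
    then have z: "?u0 b2 = 0" using lp unfolding lexpos_def by auto
    note pc = posbasis_coeffs[OF pb]
    have "?u0 b3 \<noteq> 0" using frame_expand[OF pc(13) linform_proj(4), of "(1,0,0)"] z by auto
    then have c3: "c3 (1,1,0) = 0" using frame_expand[OF pc(13) linform_proj(4), of "(1,1,0)"] z by auto
    have "c2 (1,1,0) * ?u1 b2 = 1" using frame_expand[OF pc(13) linform_proj(1), of "(1,1,0)"] c3 by auto
    then have "?u1 b2 = 1 \<or> ?u1 b2 = - 1" using zmult_eq_1_iff by blast
    then have "?u1 b2 = 1" using lp z unfolding lexpos_def by auto
    then show False using z pc(15) no by (cases b2) auto
  qed
  have u: "1 \<le> ?u0 b2" "1 \<le> ?u0 b3" using u0pos[OF pb lp(1)] u0pos[OF posbasis_swap23[OF pb] lp(2)] .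
  note pc = posbasis_coeffs[OF pb]
  have m: "(0,-1,0) \<in> S" using crystal_sym[OF S e(2)] by simp
  have split: "c2 w = 1 \<and> c3 w = 0 \<or> c2 w = 0 \<and> c3 w = 1" if w: "w \<in> S" "?u0 w = 1" for w
  proof -
    have "?P w" using w by (simp add: lexpos_def)
    then have c: "0 \<le> c2 w" "0 \<le> c3 w" using pc(18,19)[OF w(1)] by auto
    have eq: "c2 w * ?u0 b2 + c3 w * ?u0 b3 = 1" using frame_expand[OF pc(13) linform_proj(4), of w] w by auto
    have "c2 w * 1 \<le> c2 w * ?u0 b2" "c3 w * 1 \<le> c3 w * ?u0 b3" using u c by (intro mult_left_mono; simp)+
    then have "c2 w + c3 w \<le> 1" using eq by linarith
    moreover have "c2 w \<noteq> 0 \<or> c3 w \<noteq> 0" using eq by auto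
    ultimately show ?thesis using c by linarith
  qed
  have r': "(-1,-n,-s) \<in> S" using crystal_sym[OF S r] by simp
  have lr: "?P (-1,-n,-s)" using n2 by (simp add: lexpos_def)
  have pos: "0 \<le> c2 (-1,-n,-s)" "0 \<le> c3 (-1,-n,-s)" using pc(18,19)[OF r' lr] .
  \<comment> \<open>(1,1,0) is no multiple of (0,0,1), so (1,0,0) and (0,-1,0) do not project to the
    same wall.\<close>
  have c11: "\<not> (c2 (1,1,0) = 0 \<and> c3 (1,1,0) = 0)"
    using frame_expand[OF pc(13) linform_proj(1), of "(1,1,0)"] by auto
  note lc2 = linform_coords[OF pc(2)] and lc3 = linform_coords[OF pc(3)]
  show False
    using split[OF e(1)] split[OF m] pos c11 lc2[of "-1" "-n" "-s"] lc3[of "-1" "-n" "-s"]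
      lc2[of 0 "-1" 0] lc3[of 0 "-1" 0] lc2[of 1 1 0] lc3[of 1 1 0] pc(7,10) n2 by auto
qed

text \<open>Shear the root found last to (1,0,0); \<open>crystal_step\<close> then reaches the next
  column.\<close>

lemma crystal_full:
  assumes S: "crystal S" and e: "(0,1,0) \<in> S" "(0,0,1) \<in> S" and ab: "(1,a,w) \<in> S" "(1,b,w') \<in> S"
    and t: "a \<le> t" "t \<le> b"
  shows "\<exists>s. (1,t,s) \<in> S"
proof -
  have "a + int k \<le> b \<Longrightarrow> \<exists>s. (1,a + int k,s) \<in> S" for k
  proof (induction k)
    case 0 then show ?case using ab by auto
  next
    case (Suc k)
    then obtain s where k: "(1,a + int k,s) \<in> S" by auto
    define S' where "S' = {v. (\<lambda>(x, y, z). (x, y + (a + int k) * x, z + s * x)) v \<in> S}"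
    have S': "crystal S'" unfolding S'_def by (rule crystal_shear[OF S])
    have "(1,0,0) \<in> S'" "(0,1,0) \<in> S'" "(0,0,1) \<in> S'" "(1,b - (a + int k),w' - s) \<in> S'"
      using k e ab unfolding S'_def by simp_all
    then obtain s' where "(1,1,s') \<in> S'" using crystal_step[OF S'] Suc.prems by force
    then show ?case unfolding S'_def by (auto simp: ac_simps)
  qed
  from this[of "nat (t - a)"] t show ?thesis by simp
qed

text \<open>If no difference of the basis vectors is a root, then no root may separate (1,0,0) and
  (0,0,1) across (0,1,0). Otherwise the columns of roots (1, _, -h) change sign between some h and h + 1, and these two
  columns yield a smaller counterexample on the other side of (0,1,0).\<close>

lemma crystal_triangle:
  assumes "crystal S" "(1,0,0) \<in> S" "(0,1,0) \<in> S" "(0,0,1) \<in> S"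
    and "(1,-1,0) \<notin> S" "(0,1,-1) \<notin> S" "(1,0,-1) \<notin> S" and "1 \<le> n"
  shows "(1,n,-1) \<notin> S"
  using assms
proof (induction "card (S \<inter> {v. 0 < fst v \<and> snd (snd v) < 0})" arbitrary: S n rule: less_induct)
  case less
  note S = \<open>crystal S\<close> and e = \<open>(1,0,0) \<in> S\<close> \<open>(0,1,0) \<in> S\<close> \<open>(0,0,1) \<in> S\<close>
    and d = \<open>(1,-1,0) \<notin> S\<close> \<open>(0,1,-1) \<notin> S\<close> \<open>(1,0,-1) \<notin> S\<close>
  show ?case
  proof
    assume r: "(1,n,-1) \<in> S"
    let ?u0 = "\<lambda>(x, y::int, z::int). x :: int" and ?u1 = "\<lambda>(x::int, y, z). y + z :: int"
    have nz: "?u1 r \<noteq> 0" if rS: "r \<in> S" and r0: "?u0 r = 0" for r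
    proof
      assume "?u1 r = 0"
      then obtain m where m: "r = scale3 m (0,1,-1)" using r0 by (cases r) auto
      then have "m = 1 \<or> m = - 1" using crystal_primitive[OF S rS] by blast
      then have "r = (0,1,-1) \<or> r = - (0,1,-1)" using m by auto
      then show False using d(2) rS crystal_sym_iff[OF S] by metis
    qed
    obtain b3 c1 c2 c3 where pb: "posbasis S (lexpos ?u0 ?u1 ?u1) (0,1,0) (0,0,1) b3 c1 c2 c3"
      and lb: "lexpos ?u0 ?u1 ?u1 b3"
      by (rule lex_two_simple[OF S, of ?u0 ?u1 "(0,1,0)" "(0,0,1)"]) (use nz e in auto)
    note pc = posbasis_coeffs[OF pb]
    have "c3 (1,0,0) * ?u0 b3 = 1" using frame_expand[OF pc(13) linform_proj(1), of "(1,0,0)"] by auto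
    then have "?u0 b3 = 1 \<or> ?u0 b3 = - 1" using zmult_eq_1_iff by blast
    then have ub: "?u0 b3 = 1" using lb unfolding lexpos_def by auto
    then obtain i' j' where b3: "b3 = (1,i',j')" by (cases b3) auto
    \<comment> \<open>The third wall at this vertex is (1,-i,-j). Since (1,0,0) and (1,n,-1) are
      positive in this chamber, i \<ge> 0 and j \<ge> 1.\<close>
    define i j where "i = - i'" and "j = - j'"
    have bS: "(1,-i,-j) \<in> S" using pc(16) b3 i_def j_def by simp
    have a: "c1 (1,0,0) = i" "c2 (1,0,0) = j"
      using linform_coords[OF pc(1), of 1 i' j'] linform_coords[OF pc(2), of 1 i' j'] pc(4,5,7,8) pc(6,9) b3 i_def j_def
      by auto
    have c1: "c1 (x,y,z) = x * i + y" and c2: "c2 (x,y,z) = x * j + z" for x y z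
      using linform_coords[OF pc(1), of x y z] linform_coords[OF pc(2), of x y z] pc(4,5,7,8) a by auto
    have i0: "0 \<le> i" using pc(17)[OF e(1)] c1 by (simp add: lexpos_def)
    have j1: "1 \<le> j" using pc(18)[OF r] c2 by (simp add: lexpos_def)
    define S1 where "S1 = {v. (\<lambda>(x, y, z). (x, z, - y)) v \<in> S}"
    have S1: "crystal S1" unfolding S1_def by (rule crystal_rotate[OF S])
    have m3: "(0,0,-1) \<in> S" using crystal_sym[OF S e(3)] by simp
    have f1: "(1,0,0) \<in> S1" "(0,1,0) \<in> S1" "(1,1,0) \<notin> S1" "(0,0,1) \<in> S1" "(1,j,-i) \<in> S1"
      using e m3 d(3) bS unfolding S1_def by auto
    have row0: "(1,0,-h) \<notin> S" if "1 \<le> h" for h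
      using crystal_neighbours[OF S1 f1(1,2,3), of 1 h] that unfolding S1_def by auto
    have col: "\<exists>s. (1,s,-h) \<in> S" if "0 \<le> h" "h \<le> j" for h
      using crystal_full[OF S1 f1(2,4,1,5) that] unfolding S1_def by auto
    \<comment> \<open>For h \<ge> 1 the row y = 0 has no root at z = -h, so the column there lies
      strictly on one side of it: above for h = 1 because of (1,n,-1), below for h = j because of
      the third wall.\<close>
    have sgn: "0 < s \<longleftrightarrow> 0 < s'" if h: "1 \<le> h" and s: "(1,s,-h) \<in> S" "(1,s',-h) \<in> S" for h s s'
    proof (rule ccontr)
      assume "\<not> ?thesis"
      then have "s \<le> 0 \<and> 0 \<le> s' \<or> s' \<le> 0 \<and> 0 \<le> s" by auto
      then have "(1,0,-h) \<in> S" using crystal_interval[OF S e(2)] s by blast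
      then show False using row0[OF h] by blast
    qed
    have inz: "\<not> 0 < - i" using i0 by simp
    define up where "up = (\<lambda>h::nat. \<exists>s>0. (1,s,- int h) \<in> S)"
    have up1: "up 1" unfolding up_def using r \<open>1 \<le> n\<close> by (intro exI[of _ n]) auto
    have upj: "\<not> up (nat j)" unfolding up_def using sgn[OF j1 bS] j1 inz by auto
    have "\<exists>h\<ge>1. h < nat j \<and> up h \<and> \<not> up (Suc h)"
    proof (rule ccontr)
      assume no: "\<not> ?thesis"
      have "1 \<le> k \<Longrightarrow> k \<le> nat j \<Longrightarrow> up k" for k
      proof (induction k rule: nat_induct_at_least)
        case base then show ?case using up1 by simp
      next
        case (Suc k) then show ?case using no by auto
      qed
      then show False using upj j1 by auto
    qed
    then obtain hn where hn: "1 \<le> hn" "hn < nat j" "up hn" "\<not> up (Suc hn)" by blast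
    define h where "h = int hn"
    have h1: "1 \<le> h" "h + 1 \<le> j" using hn unfolding h_def by auto
    define gn where "gn = (LEAST k::nat. 0 < k \<and> (1,int k,-h) \<in> S)"
    define g where "g = int gn"
    obtain s0 where s0: "0 < s0" "(1,s0,-h) \<in> S" using hn(3) unfolding up_def h_def by auto
    then have ex: "0 < nat s0 \<and> (1,int (nat s0),-h) \<in> S" by simp
    have g: "0 < g" "(1,g,-h) \<in> S" using LeastI[of "\<lambda>k. 0 < k \<and> (1,int k,-h) \<in> S", OF ex] unfolding g_def gn_def by auto
    have gmin: "(1,g - 1,-h) \<notin> S"
    proof
      assume a: "(1,g - 1,-h) \<in> S"
      show False
      proof (cases "g = 1")
        case True then show False using a row0[OF h1(1)] by simp
      next
        case False
        then have "0 < nat (g - 1) \<and> (1,int (nat (g - 1)),-h) \<in> S" using a g by simp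
        then have "gn \<le> nat (g - 1)" unfolding gn_def by (rule Least_le)
        then show False using g unfolding g_def by simp
      qed
    qed
    have upS: "- int (Suc hn) = - (h + 1)" unfolding h_def by simp
    have nup: "s \<le> 0" if "(1,s,-(h+1)) \<in> S" for s
      using hn(4) that unfolding up_def upS by force
    obtain s1 where s1: "(1,s1,-(h+1)) \<in> S" using col[of "h+1"] h1 by auto
    have s1neg: "s1 \<le> -1" using nup[OF s1] row0[of "h+1"] s1 h1 by (cases "s1 = 0") auto
    \<comment> \<open>The new basis is (0,0,1), (0,1,0) and (1,g,-h), the lowest root above the row
      in the last positive column. Its differences are no roots by the hypothesis on (0,1,-1), the
      minimality of g and the sign change; the negative of (1,s1,-(h+1)) becomes (1,g -
      s1,-1).\<close>
    define S2 where "S2 = {v. (\<lambda>(x, y, z). (z, y + g * z, x - h * z)) v \<in> S}"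
    have S2: "crystal S2" unfolding S2_def
      by (rule crystal_vimage[OF S, of _ "\<lambda>(x, y, z). (z + h * x, y - g * x, x)"])
         (rule linmapI[of _ 0 0 1 0 1 g 1 0 "-h"], simp, rule linmapI[of _ h 0 1 "- g" 1 0 1 0 0], simp, auto)
    have memb: "(x,y,z) \<in> S2 \<longleftrightarrow> (z, y + g * z, x - h * z) \<in> S" for x y z unfolding S2_def by simp
    have neg: "(x,y,z) \<in> S \<longleftrightarrow> (-x,-y,-z) \<in> S" for x y z using crystal_sym_iff[OF S, of "(x,y,z)"] by simp
    have k: "(1,0,0) \<in> S2" "(0,1,0) \<in> S2" "(0,0,1) \<in> S2" using e g unfolding memb by simp_all
    have k2: "(1,-1,0) \<notin> S2" "(0,1,-1) \<notin> S2" "(1,0,-1) \<notin> S2"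
      unfolding memb using d(2) neg[of 0 "-1" 1] gmin neg[of "-1" "1-g" h] nup[of g] g neg[of "-1" "-g" "1+h"]
      by (auto simp: algebra_simps)
    have k3: "(1, g - s1, -1) \<in> S2" unfolding memb using s1 neg[of 1 s1 "-(h+1)"] by (simp add: algebra_simps)
    let ?A = "\<lambda>S. S \<inter> {v. 0 < fst v \<and> snd (snd v) < (0::int)} :: v3 set"
    \<comment> \<open>The negative of the coordinate change maps the counted roots of S2 into those
      of S. It misses (1,g,-h), whose preimage would need x = 0, so the measure drops.\<close>
    let ?f = "\<lambda>(x, y, z). (- z, - y - g * z, h * z - x)"
    have inj: "inj_on ?f (?A S2)" by (auto simp: inj_on_def)
    have sub: "?f ` ?A S2 \<subseteq> ?A S - {(1,g,-h)}"
    proof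
      fix v assume "v \<in> ?f ` ?A S2"
      then obtain x y z where xyz: "(x,y,z) \<in> S2" "0 < x" "z < 0" "v = (- z, - y - g * z, h * z - x)" by auto
      have vS: "v \<in> S" using xyz(1,4) neg[of z "y + g * z" "x - h * z"] unfolding memb by (simp add: algebra_simps)
      have "h * z < 0" using xyz h1 by (simp add: mult_pos_neg)
      moreover have "v \<noteq> (1,g,-h)" using xyz by auto
      ultimately show "v \<in> ?A S - {(1,g,-h)}" using vS xyz by auto
    qed
    have fin: "finite (?A S)" using crystal_finite[OF S] by blast
    have gA: "(1,g,-h) \<in> ?A S" using g h1 by simp
    have "card (?A S2) = card (?f ` ?A S2)" using card_image[OF inj] by simp
    also have "\<dots> \<le> card (?A S - {(1,g,-h)})" using sub fin by (intro card_mono) auto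
    also have "\<dots> < card (?A S)" using gA fin by (intro card_Diff1_less)
    finally have lt: "card (?A S2) < card (?A S)" .
    have "(1, g - s1, -1) \<notin> S2" by (rule less.hyps[OF lt S2 k k2]) (use g s1neg in simp)
    then show False using k3 by blast
  qed
qed

section \<open>Chambers at a vertex\<close>

text \<open>\<open>crystal_triangle\<close> in the basis (0,1,k), (0,0,1), -(1,t,f): the three
  forbidden vectors are (0,1,k-1), (1,t,f+1) and (1,t+1,f+k). With k the least slope and f the top
  of a column, the next column begins no higher than f + k, which is the source of fact (4).\<close>

lemma crystal_columns_meet:
  assumes S: "crystal S" and b: "(0,0,1) \<in> S" and a: "(0,1,k) \<in> S" "(0,1,k-1) \<notin> S"
    and f: "(1,t,f) \<in> S" "(1,t,f+1) \<notin> S" and y: "(1,t+1,y) \<in> S"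
  shows "\<exists>y'\<le>f+k. (1,t+1,y') \<in> S"
proof (rule ccontr)
  assume no: "\<not> ?thesis"
  define S' where "S' = {v. (\<lambda>(x, y, z). (- z, x - t * z, k * x + y - f * z)) v \<in> S}"
  have S': "crystal S'" unfolding S'_def
    by (rule crystal_vimage[OF S, of _ "\<lambda>(h, x, y). (x - t * h, y - k * (x - t * h) - f * h, - h)"])
       (rule linmapI[of _ 0 0 "-1" 1 0 "-t" k 1 "-f"], simp,
        rule linmapI[of _ "-t" 1 0 "k*t-f" "-k" 1 "-1" 0 0], simp add: algebra_simps, auto simp: algebra_simps)
  have m: "(x,y,z) \<in> S' \<longleftrightarrow> (- z, x - t * z, k * x + y - f * z) \<in> S" for x y z unfolding S'_def by simp
  have n: "(-1,-t,-f) \<in> S" using crystal_sym[OF S f(1)] by simp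
  have y1: "f + k + 1 \<le> y" using no y by (meson int_one_le_iff_zero_less not_le zless_add1_eq add1_zle_eq)
  have "(1, y - f - k, -1) \<notin> S'"
    by (rule crystal_triangle[OF S']) (use a b f n no y y1 in \<open>auto simp: m algebra_simps not_le\<close>)
  then show False using y by (simp add: m algebra_simps)
qed

section \<open>The plane of roots of height zero and the chambers around X\<close>

definition cross :: "int \<times> int \<Rightarrow> int \<times> int \<Rightarrow> int" where
  "cross a b = fst a * snd b - snd a * fst b"

definition scale2 :: "int \<Rightarrow> int \<times> int \<Rightarrow> int \<times> int" where
  "scale2 n a = (n * fst a, n * snd a)"

lemma cross_simp [simp]: "cross (a1,a2) (b1,b2) = a1 * b2 - a2 * b1"
  by (simp add: cross_def)

lemma scale2_simp [simp]: "scale2 n (a1,a2) = (n * a1, n * a2)"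
  by (simp add: scale2_def)

lemma crystal_plane:
  assumes S: "crystal S" and D: "cross (a1,a2) (b1,b2) = 1 \<or> cross (a1,a2) (b1,b2) = - 1"
  shows "crystal {v. (\<lambda>(h, x, y). (h, h * p1 + x * a1 + y * b1, h * p2 + x * a2 + y * b2)) v \<in> S}"
proof -
  define D where "D = a1 * b2 - a2 * b1"
  have DD: "D * D = 1" using assms(2) unfolding D_def by auto
  show ?thesis
  proof (rule crystal_vimage[OF S, of _ "\<lambda>(h, x, y). (h, D * ((x - h * p1) * b2 - (y - h * p2) * b1), D * (a1 * (y - h * p2) - a2 * (x - h * p1)))"])
    show "linmap (\<lambda>(h, x, y). (h, h * p1 + x * a1 + y * b1, h * p2 + x * a2 + y * b2))"
      by (rule linmapI[of _ 1 0 0 p1 a1 b1 p2 a2 b2]) simp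
    show "linmap (\<lambda>(h, x, y). (h, D * ((x - h * p1) * b2 - (y - h * p2) * b1), D * (a1 * (y - h * p2) - a2 * (x - h * p1))))"
      by (rule linmapI[of _ 1 0 0 "D * (p2 * b1 - p1 * b2)" "D * b2" "- D * b1" "D * (a2 * p1 - a1 * p2)" "- D * a2" "D * a1"])
         (simp add: algebra_simps)
  next
    fix v :: v3
    obtain h x y where v: "v = (h, x, y)" by (cases v)
    have 1: "h * p1 + (D * ((x - h * p1) * b2 - (y - h * p2) * b1)) * a1 + (D * (a1 * (y - h * p2) - a2 * (x - h * p1))) * b1
       = h * p1 + D * D * (x - h * p1)" unfolding D_def by algebra
    have 2: "h * p2 + (D * ((x - h * p1) * b2 - (y - h * p2) * b1)) * a2 + (D * (a1 * (y - h * p2) - a2 * (x - h * p1))) * b2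
       = h * p2 + D * D * (y - h * p2)" unfolding D_def by algebra
    have 3: "D * ((h * p1 + x * a1 + y * b1 - h * p1) * b2 - (h * p2 + x * a2 + y * b2 - h * p2) * b1) = D * D * x"
      unfolding D_def by algebra
    have 4: "D * (a1 * (h * p2 + x * a2 + y * b2 - h * p2) - a2 * (h * p1 + x * a1 + y * b1 - h * p1)) = D * D * y"
      unfolding D_def by algebra
    show "(\<lambda>(h, x, y). (h, h * p1 + x * a1 + y * b1, h * p2 + x * a2 + y * b2))
      ((\<lambda>(h, x, y). (h, D * ((x - h * p1) * b2 - (y - h * p2) * b1), D * (a1 * (y - h * p2) - a2 * (x - h * p1)))) v) = v"
      unfolding v by (simp only: case_prod_conv 1 2 DD) simp
    show "(\<lambda>(h, x, y). (h, D * ((x - h * p1) * b2 - (y - h * p2) * b1), D * (a1 * (y - h * p2) - a2 * (x - h * p1))))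
      ((\<lambda>(h, x, y). (h, h * p1 + x * a1 + y * b1, h * p2 + x * a2 + y * b2)) v) = v"
      unfolding v by (simp only: case_prod_conv 3 4 DD) simp
  qed
qed

text \<open>A chamber at the vertex X has walls a, b through X and p opposite to X; \<open>corner S a b p\<close> states
  that a, b, p is its basis.\<close>

definition corner :: "v3 set \<Rightarrow> int \<times> int \<Rightarrow> int \<times> int \<Rightarrow> int \<times> int \<Rightarrow> bool" where
  "corner S a b p \<longleftrightarrow> (0, a) \<in> S \<and> (0, b) \<in> S \<and> (1, p) \<in> S \<and> cross a b = 1 \<and>
     (\<forall>r. (0, r) \<in> S \<longrightarrow> 0 \<le> cross r b \<and> 0 \<le> cross a r \<or> cross r b \<le> 0 \<and> cross a r \<le> 0) \<and>
     (\<forall>h r. (h, r) \<in> S \<longrightarrow> 0 < h \<longrightarrow> 0 \<le> cross (r - scale2 h p) b \<and> 0 \<le> cross a (r - scale2 h p))"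

lemma cross_expand: "cross a b = 1 \<Longrightarrow> r = scale2 (cross r b) a + scale2 (cross a r) b"
proof -
  assume h: "cross a b = 1"
  obtain a1 a2 b1 b2 r1 r2 where [simp]: "a = (a1,a2)" "b = (b1,b2)" "r = (r1,r2)" by (cases a; cases b; cases r)
  have "(r1 * b2 - r2 * b1) * a1 + (a1 * r2 - a2 * r1) * b1 = (a1 * b2 - a2 * b1) * r1"
    "(r1 * b2 - r2 * b1) * a2 + (a1 * r2 - a2 * r1) * b2 = (a1 * b2 - a2 * b1) * r2" by algebra+
  then show ?thesis using h by simp
qed

lemma linform_fst [simp]: "linform fst"
  by (rule linformI[of _ 1 0 0]) simp

lemma lex_corner:
  assumes S: "crystal S" and e: "(0,1,0) \<in> S" "(0,0,1) \<in> S"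
    and nz: "\<And>r. (0,r) \<in> S \<Longrightarrow> s1 * fst r + s2 * snd r = 0 \<Longrightarrow> t1 * fst r + t2 * snd r \<noteq> 0"
  obtains a b p where "corner S a b p"
    "0 < s1 * fst a + s2 * snd a \<or> s1 * fst a + s2 * snd a = 0 \<and> 0 < t1 * fst a + t2 * snd a"
    "0 < s1 * fst b + s2 * snd b \<or> s1 * fst b + s2 * snd b = 0 \<and> 0 < t1 * fst b + t2 * snd b"
proof -
  note result = that
  let ?u0 = "fst :: v3 \<Rightarrow> int" and ?u1 = "\<lambda>(h::int, x, y). s1 * x + s2 * y :: int"
    and ?u2 = "\<lambda>(h::int, x, y). t1 * x + t2 * y :: int"
  let ?P = "lexpos ?u0 ?u1 ?u2"
  have lu: "linform ?u1" "linform ?u2"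
    by (rule linformI[of _ 0 s1 s2], simp, rule linformI[of _ 0 t1 t2], simp)
  have nz': "?u2 r \<noteq> 0" if "r \<in> S" "?u0 r = 0" "?u1 r = 0" for r
    using that nz[of "snd r"] by (cases r) auto
  obtain d1 d2 d3 k1 k2 k3 where pd: "posbasis S ?P d1 d2 d3 k1 k2 k3" and ld: "?P d1" "?P d2" "?P d3"
    by (rule lex_posbasis[OF S linform_fst lu nz'])
  \<comment> \<open>If two walls had nonzero height, all roots of height zero would be multiples of
    the third one, against the independence of (0,1,0) and (0,0,1).\<close>
  have two: "?u0 b1 = 0 \<or> ?u0 b2 = 0"
    if pb: "posbasis S ?P b1 b2 b3 c1 c2 c3" and lp: "?P b1" "?P b2" "?P b3" for b1 b2 b3 c1 c2 c3
  proof (rule ccontr)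
    assume n: "\<not> ?thesis"
    note pc = posbasis_coeffs[OF pb]
    have z: "c1 w = 0 \<and> c2 w = 0" if w: "w \<in> S" "?u0 w = 0" "?P w" for w
      using lex_expand0[OF pc(13) linform_fst lp pc(17-19)[OF w(1,3)] w(2)] n by auto
    have z': "c1 w = 0 \<and> c2 w = 0" if w: "w \<in> S" "?u0 w = 0" for w
    proof (cases "?P w")
      case True then show ?thesis using z w by blast
    next
      case False
      then have "?P (- w)" using nz'[OF w] w(2) unfolding lexpos_def by (cases w) auto
      moreover have "?u0 (- w) = 0" using w(2) by (cases w) auto
      ultimately have "c1 (- w) = 0 \<and> c2 (- w) = 0" using z[of "- w"] crystal_sym[OF S w(1)] by blast
      then show ?thesis using pc(1,2) by (simp add: linform_uminus)
    qed
    have "c3 (0,1,0) * snd (snd b3) = 0" "c3 (0,1,0) * fst (snd b3) = 1" "c3 (0,0,1) * snd (snd b3) = 1"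
      using frame_expand[OF pc(13) linform_proj(3), of "(0,1,0)"] frame_expand[OF pc(13) linform_proj(2), of "(0,1,0)"]
        frame_expand[OF pc(13) linform_proj(3), of "(0,0,1)"] z'[OF e(1)] z'[OF e(2)] by (auto simp: case_prod_beta)
    then show False by auto
  qed
  have "?u0 d1 = 0 \<and> ?u0 d2 = 0 \<or> ?u0 d1 = 0 \<and> ?u0 d3 = 0 \<or> ?u0 d2 = 0 \<and> ?u0 d3 = 0"
    using two[OF pd ld] two[OF posbasis_swap23[OF pd] ld(1,3,2)]
      two[OF posbasis_swap23[OF posbasis_swap12[OF pd]] ld(2,3,1)] by blast
  then obtain b1 b2 b3 c1 c2 c3 where pb: "posbasis S ?P b1 b2 b3 c1 c2 c3" and lp: "?P b1" "?P b2" "?P b3"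
    and h0: "?u0 b1 = 0" "?u0 b2 = 0"
    using pd ld posbasis_swap23[OF pd] posbasis_swap23[OF posbasis_swap12[OF pd]] by blast
  have goal: thesis if pb: "posbasis S ?P (0,a) (0,b) b3 c1 c2 c3" and lp: "?P (0,a)" "?P (0,b)" "?P b3"
    and cr: "cross a b = 1" for a b b3 c1 c2 c3
  proof -
    note pc = posbasis_coeffs[OF pb]
    have "c3 (1,0,0) * ?u0 b3 = 1" using frame_expand[OF pc(13) linform_fst, of "(1,0,0)"] by auto
    then have "?u0 b3 = 1 \<or> ?u0 b3 = - 1" using zmult_eq_1_iff by blast
    then have "?u0 b3 = 1" using lp unfolding lexpos_def by auto
    then obtain p where p: "b3 = (1,p)" by (cases b3) auto
    have c: "c3 (h,r) = h \<and> c1 (h,r) = cross (r - scale2 h p) b \<and> c2 (h,r) = cross a (r - scale2 h p)" for h r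
    proof -
      obtain a1 a2 b1 b2 r1 r2 p1 p2 where [simp]: "a = (a1,a2)" "b = (b1,b2)" "r = (r1,r2)" "p = (p1,p2)"
        by (cases a; cases b; cases r; cases p)
      have h: "c3 (h,r) = h" using frame_expand[OF pc(13) linform_fst, of "(h,r)"] p by simp
      have 1: "r1 - h * p1 = c1 (h,r) * a1 + c2 (h,r) * b1" "r2 - h * p2 = c1 (h,r) * a2 + c2 (h,r) * b2"
        using frame_expand[OF pc(13) linform_proj(2), of "(h,r)"] frame_expand[OF pc(13) linform_proj(3), of "(h,r)"] p h
        by simp_all
      have D: "a1 * b2 - a2 * b1 = 1" using cr by simp
      have "(r1 - h * p1) * b2 - (r2 - h * p2) * b1 = c1 (h,r) * (a1 * b2 - a2 * b1)"
        "a1 * (r2 - h * p2) - a2 * (r1 - h * p1) = c2 (h,r) * (a1 * b2 - a2 * b1)" unfolding 1 by algebra+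
      then show ?thesis using h D by simp
    qed
    have "0 \<le> cross r b \<and> 0 \<le> cross a r \<or> cross r b \<le> 0 \<and> cross a r \<le> 0" if r: "(0,r) \<in> S" for r
    proof (cases "?P (0,r)")
      case True
      then show ?thesis using pc(17,18)[OF r True] c[of 0 r] by (cases r; cases p) auto
    next
      case False
      have P: "?P (- (0,r))" using False nz'[OF r] unfolding lexpos_def by (cases r) auto
      have "0 \<le> - c1 (0,r)" "0 \<le> - c2 (0,r)"
        using pc(17,18)[OF crystal_sym[OF S r] P] pc(1,2) by (simp_all only: linform_uminus)
      then show ?thesis using c[of 0 r] by (cases r; cases p) auto
    qed
    moreover have "0 \<le> cross (r - scale2 h p) b \<and> 0 \<le> cross a (r - scale2 h p)"
      if r: "(h,r) \<in> S" "0 < h" for h r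
    proof -
      have "?P (h,r)" using r(2) by (simp add: lexpos_def)
      then show ?thesis using pc(17,18)[OF r(1)] c[of h r] by auto
    qed
    ultimately have "corner S a b p" using cr pc(14,15,16) p unfolding corner_def by auto
    then show thesis by (rule result) (use lp in \<open>auto simp: lexpos_def case_prod_beta\<close>)
  qed
  obtain a b where ab: "b1 = (0,a)" "b2 = (0,b)" using h0 by (cases b1; cases b2) auto
  \<comment> \<open>(0,1,0) and (0,0,1) are integral combinations of the two walls, so the
    determinant of the walls divides 1.\<close>
  have "cross a b = 1 \<or> cross a b = - 1"
  proof -
    note pc = posbasis_coeffs[OF pb]
    obtain a1 a2 bb1 bb2 where [simp]: "a = (a1,a2)" "b = (bb1,bb2)" by (cases a; cases b)
    have nb: "?u0 b3 \<noteq> 0" using frame_expand[OF pc(13) linform_fst, of "(1,0,0)"] h0 by auto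
    have c3: "c3 (0,1,0) = 0" "c3 (0,0,1) = 0"
      using frame_expand[OF pc(13) linform_fst, of "(0,1,0)"] frame_expand[OF pc(13) linform_fst, of "(0,0,1)"] h0 nb
      by auto
    have eqs: "1 = c1 (0,1,0) * a1 + c2 (0,1,0) * bb1" "0 = c1 (0,1,0) * a2 + c2 (0,1,0) * bb2"
      "0 = c1 (0,0,1) * a1 + c2 (0,0,1) * bb1" "1 = c1 (0,0,1) * a2 + c2 (0,0,1) * bb2"
      using frame_expand[OF pc(13) linform_proj(2), of "(0,1,0)"] frame_expand[OF pc(13) linform_proj(3), of "(0,1,0)"]
        frame_expand[OF pc(13) linform_proj(2), of "(0,0,1)"] frame_expand[OF pc(13) linform_proj(3), of "(0,0,1)"] c3 ab
      by simp_all
    have "(c1 (0,1,0) * c2 (0,0,1) - c2 (0,1,0) * c1 (0,0,1)) * (a1 * bb2 - a2 * bb1)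
      = (c1 (0,1,0) * a1 + c2 (0,1,0) * bb1) * (c1 (0,0,1) * a2 + c2 (0,0,1) * bb2)
        - (c1 (0,1,0) * a2 + c2 (0,1,0) * bb2) * (c1 (0,0,1) * a1 + c2 (0,0,1) * bb1)" by algebra
    then have "(c1 (0,1,0) * c2 (0,0,1) - c2 (0,1,0) * c1 (0,0,1)) * (a1 * bb2 - a2 * bb1) = 1"
      unfolding eqs[symmetric] by simp
    then show ?thesis using zmult_eq_1_iff by auto
  qed
  then show thesis
  proof
    assume "cross a b = 1"
    then show thesis using goal[of a b b3 c1 c2 c3] pb lp ab by blast
  next
    assume "cross a b = - 1"
    then have "cross b a = 1" unfolding cross_def by (simp add: algebra_simps)
    then show thesis using goal[of b a b3 c2 c1 c3] posbasis_swap12[OF pb] lp ab by blast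
  qed
qed

lemma crystal_column_interval:
  assumes S: "crystal S" and e: "(0,0,1) \<in> S" and ab: "(1,t,a) \<in> S" "(1,t,b) \<in> S" and y: "a \<le> y" "y \<le> b"
  shows "(1,t,y) \<in> S"
proof -
  define S1 where "S1 = {v. (\<lambda>(x, y, z). (x, z, - y)) v \<in> S}"
  have S1: "crystal S1" unfolding S1_def by (rule crystal_rotate[OF S])
  have "(0,0,-1) \<in> S" using crystal_sym[OF S e] by simp
  then have "(0,1,0) \<in> S1" "(1,-b,t) \<in> S1" "(1,-a,t) \<in> S1" using ab unfolding S1_def by auto
  then have "(1,-y,t) \<in> S1" by (rule crystal_interval[OF S1]) (use y in auto)
  then show ?thesis unfolding S1_def by simp
qed

lemma int_last_before:
  assumes "P (a::int)" "\<not> P b" "a < b"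
  shows "\<exists>c. a \<le> c \<and> c < b \<and> P c \<and> \<not> P (c + 1)"
proof (rule ccontr)
  assume no: "\<not> ?thesis"
  have "a + int k \<le> b \<Longrightarrow> P (a + int k)" for k
  proof (induction k)
    case (Suc k)
    then show ?case using no by (auto simp: ac_simps dest!: spec[of _ "a + int k"])
  qed (use assms in simp)
  from this[of "nat (b - a)"] assms show False by simp
qed

text \<open>If (1,0,0) were missing, the columns to the left of it would have to jump over the row of (1,0,0).\<close>

lemma crystal_quadrant:
  assumes S: "crystal S" and e: "(0,1,0) \<in> S" "(0,0,1) \<in> S" "(0,1,-1) \<notin> S"
    and k: "(1,k,0) \<in> S" "0 \<le> k" and l: "(1,0,l) \<in> S" "0 \<le> l" and p: "(1,-i,-j) \<in> S" "0 \<le> i" "0 \<le> j"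
  shows "(1,0,0) \<in> S"
proof (rule ccontr)
  assume n: "(1,0,0) \<notin> S"
  \<comment> \<open>Going left from column 0, every column stays above row 0: a root below the row
    would be carried back into the previous column by \<open>crystal_columns_meet\<close> with slope
    0. At m = i this contradicts the root (1,-i,-j).\<close>
  have "int m \<le> i \<Longrightarrow> (1,- int m,y) \<in> S \<Longrightarrow> 0 < y" for m y
  proof (induction m arbitrary: y)
    case 0
    then show ?case using crystal_column_interval[OF S e(2), of 0 y l 0] l n by force
  next
    case (Suc m)
    show ?case
    proof (rule ccontr)
      assume y: "\<not> 0 < y"
      have z: "(1,- int (Suc m),0) \<notin> S"
        using crystal_interval[OF S e(1) _ k(1), of "- int (Suc m)" 0] k(2) n by auto
      then have "y < 0" using y Suc.prems by (cases "y = 0") auto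
      then obtain y1 where y1: "y1 < 0" "(1,- int (Suc m),y1) \<in> S" "(1,- int (Suc m),y1 + 1) \<notin> S"
        using int_last_before[of "\<lambda>y. (1,- int (Suc m),y) \<in> S", OF Suc.prems(2) z] by blast
      obtain y2 where "(1,- int m,y2) \<in> S"
        using crystal_full[OF S e(1,2) p(1) l(1), of "- int m"] Suc.prems by auto
      then obtain y3 where "y3 \<le> y1" "(1,- int m,y3) \<in> S"
        using crystal_columns_meet[OF S e(2), of 0 "- int (Suc m)" y1 y2] e y1 by auto
      then show False using Suc.IH[of y3] Suc.prems y1(1) by auto
    qed
  qed
  from this[of "nat i" "-j"] p show False by simp
qed

section \<open>Coordinates based at a point of height one\<close>

definition coords :: "v3 set \<Rightarrow> int \<times> int \<Rightarrow> int \<times> int \<Rightarrow> int \<times> int \<Rightarrow> v3 set" where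
  "coords S p a b = {v. (fst v, scale2 (fst v) p + scale2 (fst (snd v)) a + scale2 (snd (snd v)) b) \<in> S}"

lemma mem_coords [simp]: "(h,x,y) \<in> coords S p a b \<longleftrightarrow> (h, scale2 h p + scale2 x a + scale2 y b) \<in> S"
  by (simp add: coords_def)

lemma scale2_0 [simp]: "scale2 0 v = 0" and scale2_1 [simp]: "scale2 1 v = v"
  and scale2_m1 [simp]: "scale2 (- 1) v = - v" and scale2_zero [simp]: "scale2 n 0 = 0"
  by (cases v, simp add: zero_prod_def scale2_def)+

lemma scale2_minus: "scale2 (- n) v = - scale2 n v" "scale2 n (- v) = - scale2 n v"
  by (cases v, simp)+

lemma scale2_add: "scale2 (m + n) v = scale2 m v + scale2 n v"
  by (cases v) (simp add: algebra_simps)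

lemma cross_lin [simp]:
  "cross (a + b) c = cross a c + cross b c" "cross a (b + c) = cross a b + cross a c"
  "cross (a - b) c = cross a c - cross b c" "cross a (b - c) = cross a b - cross a c"
  "cross (- a) b = - cross a b" "cross a (- b) = - cross a b"
  "cross (scale2 n a) b = n * cross a b" "cross a (scale2 n b) = n * cross a b"
  "cross a a = 0" "cross 0 a = 0" "cross a 0 = 0"
  unfolding cross_def scale2_def by (simp_all add: algebra_simps)

lemma cross_commute: "cross a b = - cross b a"
  unfolding cross_def by simp

lemma crystal_coords:
  assumes S: "crystal S" and D: "cross a b = 1 \<or> cross a b = - 1"
  shows "crystal (coords S p a b)"
proof -
  obtain a1 a2 b1 b2 p1 p2 where ab: "a = (a1,a2)" "b = (b1,b2)" "p = (p1,p2)" by (cases a; cases b; cases p)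
  have "coords S p a b = {v. (\<lambda>(h, x, y). (h, h * p1 + x * a1 + y * b1, h * p2 + x * a2 + y * b2)) v \<in> S}"
    unfolding coords_def ab by auto
  then show ?thesis using crystal_plane[OF S, of a1 a2 b1 b2 p1 p2] D ab by simp
qed

lemma coords_surj:
  assumes "cross a b = 1" "(h, r) \<in> S"
  shows "(h, cross (r - scale2 h p) b, cross a (r - scale2 h p)) \<in> coords S p a b"
proof -
  have "scale2 h p + (scale2 (cross (r - scale2 h p) b) a + scale2 (cross a (r - scale2 h p)) b) = r"
    using cross_expand[OF assms(1), of "r - scale2 h p"] by (metis diff_add_cancel add.commute)
  then show ?thesis using assms(2) by (simp add: add.assoc del: cross_lin)
qed

lemma cornerD:
  assumes "corner S a b p"
  shows "(0,a) \<in> S" "(0,b) \<in> S" "(1,p) \<in> S" "cross a b = 1"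
    "(0,r) \<in> S \<Longrightarrow> 0 \<le> cross r b \<and> 0 \<le> cross a r \<or> cross r b \<le> 0 \<and> cross a r \<le> 0"
    "(h,r) \<in> S \<Longrightarrow> 0 < h \<Longrightarrow> 0 \<le> cross (r - scale2 h p) b \<and> 0 \<le> cross a (r - scale2 h p)"
    "(1,r) \<in> S \<Longrightarrow> 0 \<le> cross (r - p) b \<and> 0 \<le> cross a (r - p)"
proof -
  have all: "(h,r) \<in> S \<Longrightarrow> 0 < h \<Longrightarrow> 0 \<le> cross (r - scale2 h p) b \<and> 0 \<le> cross a (r - scale2 h p)" for h r
    using assms unfolding corner_def by blast
  then show "(h,r) \<in> S \<Longrightarrow> 0 < h \<Longrightarrow> 0 \<le> cross (r - scale2 h p) b \<and> 0 \<le> cross a (r - scale2 h p)" .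
  show "(1,r) \<in> S \<Longrightarrow> 0 \<le> cross (r - p) b \<and> 0 \<le> cross a (r - p)" using all[of 1 r] by simp
  show "(0,a) \<in> S" "(0,b) \<in> S" "(1,p) \<in> S" "cross a b = 1"
    "(0,r) \<in> S \<Longrightarrow> 0 \<le> cross r b \<and> 0 \<le> cross a r \<or> cross r b \<le> 0 \<and> cross a r \<le> 0"
    using assms unfolding corner_def by blast+
qed

text \<open>Take \<open>cross \<beta>\<close> as the first form; among the roots of height zero it
  vanishes only at \<beta> and its negative, and the tie-breaker selects one of these two rays. A
  wall of the resulting chamber must lie on the ray, since otherwise \<beta> would have coordinates
  of opposite signs.\<close>

lemma corner_exists:
  assumes S: "crystal S" and e: "(0,1,0) \<in> S" "(0,0,1) \<in> S" and b: "(0,\<beta>) \<in> S"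
  shows "\<exists>b p. corner S \<beta> b p" "\<exists>b p. corner S b (- \<beta>) p"
proof -
  obtain \<beta>1 \<beta>2 where \<beta>: "\<beta> = (\<beta>1,\<beta>2)" by (cases \<beta>)
  have b0: "\<beta>1 \<noteq> 0 \<or> \<beta>2 \<noteq> 0" using b crystal_nonzero[OF S] \<beta> by auto
  have sq: "0 < \<beta>1 * \<beta>1 + \<beta>2 * \<beta>2"
    using b0 by (metis sum_squares_gt_zero_iff)
  have par: "r = \<beta> \<or> r = - \<beta>" if r: "(0,r) \<in> S" "cross \<beta> r = 0" for r
  proof -
    obtain r1 r2 where rr: "r = (r1,r2)" by (cases r)
    have c: "\<beta>1 * r2 = \<beta>2 * r1" using r(2) \<beta> rr by simp
    have "\<exists>m n. m \<noteq> 0 \<and> scale3 m (0,\<beta>) = scale3 n (0,r)"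
    proof (cases "r1 = 0")
      case True
      then have "r2 \<noteq> 0" using r crystal_nonzero[OF S] rr by auto
      then show ?thesis using c True \<beta> rr by (intro exI[of _ r2] exI[of _ \<beta>2]) (auto simp: mult.commute)
    next
      case False
      then show ?thesis using c \<beta> rr by (intro exI[of _ r1] exI[of _ \<beta>1]) (auto simp: mult.commute)
    qed
    then have "(0,r) = (0,\<beta>) \<or> (0,r) = - (0::int,\<beta>)" using crystal_reduced[OF S b r(1)] by blast
    then show ?thesis by auto
  qed
  have nz: "e * \<beta>1 * fst r + e * \<beta>2 * snd r \<noteq> 0"
    if e: "e = 1 \<or> e = - 1" and r: "(0,r) \<in> S" "- \<beta>2 * fst r + \<beta>1 * snd r = 0" for r and e :: int
  proof -
    have "cross \<beta> r = 0" using r(2) \<beta> by (simp add: cross_def)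
    then show ?thesis using par[OF r(1)] e sq \<beta> by auto
  qed
  have s: "- \<beta>2 * fst r + \<beta>1 * snd r = cross \<beta> r" for r by (simp add: cross_def \<beta>)
  have nz1: "\<beta>1 * fst r + \<beta>2 * snd r \<noteq> 0" if "(0,r) \<in> S" "- \<beta>2 * fst r + \<beta>1 * snd r = 0" for r
    using nz[of 1, OF _ that] by simp
  have nz2: "- \<beta>1 * fst r + - \<beta>2 * snd r \<noteq> 0" if "(0,r) \<in> S" "- \<beta>2 * fst r + \<beta>1 * snd r = 0" for r
    using nz[of "- 1", OF _ that] by simp
  obtain a b p where 1: "corner S a b p"
    "0 < cross \<beta> a \<or> cross \<beta> a = 0 \<and> 0 < \<beta>1 * fst a + \<beta>2 * snd a"
    "0 < cross \<beta> b \<or> cross \<beta> b = 0 \<and> 0 < \<beta>1 * fst b + \<beta>2 * snd b"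
    by (rule lex_corner[where ?s1.0 = "- \<beta>2" and ?s2.0 = \<beta>1, OF S e nz1, unfolded s])
  obtain a' b' p' where 2: "corner S a' b' p'"
    "0 < cross \<beta> a' \<or> cross \<beta> a' = 0 \<and> 0 < - \<beta>1 * fst a' + - \<beta>2 * snd a'"
    "0 < cross \<beta> b' \<or> cross \<beta> b' = 0 \<and> 0 < - \<beta>1 * fst b' + - \<beta>2 * snd b'"
    by (rule lex_corner[where ?s1.0 = "- \<beta>2" and ?s2.0 = \<beta>1, OF S e nz2, unfolded s])
  have zero: "cross \<beta> a = 0 \<or> cross \<beta> b = 0" if c: "corner S a b p" and n: "0 \<le> cross \<beta> a" "0 \<le> cross \<beta> b" for a b p
  proof (rule ccontr)
    assume "\<not> ?thesis"
    then have pos: "0 < cross \<beta> a" "0 < cross \<beta> b" using n by auto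
    have "0 \<le> cross \<beta> b \<and> 0 \<le> cross a \<beta> \<or> cross \<beta> b \<le> 0 \<and> cross a \<beta> \<le> 0" using c b unfolding corner_def by blast
    then show False using pos cross_commute[of a \<beta>] by auto
  qed
  have "a = \<beta>"
  proof -
    have cab: "(0,a) \<in> S" "(0,b) \<in> S" "cross a b = 1" using 1(1) unfolding corner_def by auto
    consider "cross \<beta> a = 0" | "cross \<beta> b = 0" using zero[OF 1(1)] 1(2,3) by auto
    then show ?thesis
    proof cases
      case 1
      then show ?thesis using par[OF cab(1)] \<open>0 < cross \<beta> a \<or> _\<close> sq \<beta> by auto
    next
      case 2
      then have "b = \<beta>" using par[OF cab(2)] \<open>0 < cross \<beta> b \<or> _\<close> sq \<beta> by auto
      then show ?thesis using cab(3) cross_commute[of a \<beta>] \<open>0 < cross \<beta> a \<or> _\<close> by auto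
    qed
  qed
  then show "\<exists>b p. corner S \<beta> b p" using 1(1) by blast
  have "b' = - \<beta>"
  proof -
    have cab: "(0,a') \<in> S" "(0,b') \<in> S" "cross a' b' = 1" using 2(1) unfolding corner_def by auto
    consider "cross \<beta> a' = 0" | "cross \<beta> b' = 0" using zero[OF 2(1)] 2(2,3) by auto
    then show ?thesis
    proof cases
      case 2
      then show ?thesis using par[OF cab(2)] \<open>0 < cross \<beta> b' \<or> _\<close> sq \<beta> by auto
    next
      case 1
      then have "a' = - \<beta>" using par[OF cab(1)] \<open>0 < cross \<beta> a' \<or> _\<close> sq \<beta> by auto
      then show ?thesis using cab(3) \<open>0 < cross \<beta> b' \<or> _\<close> by auto
    qed
  qed
  then show "\<exists>b p. corner S b (- \<beta>) p" using 2(1) by blast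
qed

lemma planar_interval:
  assumes S: "crystal S" and e: "(0,1,0) \<in> S" "(0,0,1) \<in> S" and a: "(0,a) \<in> S"
    and p: "(1,p) \<in> S" "(1,p + scale2 n a) \<in> S" and i: "0 \<le> i" "i \<le> n"
  shows "(1,p + scale2 i a) \<in> S"
proof -
  obtain b c where c: "corner S a b c" using corner_exists[OF S e a] by blast
  then have "cross a b = 1" unfolding corner_def by blast
  then have S': "crystal (coords S p a b)" by (intro crystal_coords[OF S]) auto
  have "(1,i,0) \<in> coords S p a b" by (rule crystal_interval[OF S' _ _ _ i]) (use a p in auto)
  then show ?thesis by simp
qed

lemma planar_full:
  assumes S: "crystal S" and e: "(0,1,0) \<in> S" "(0,0,1) \<in> S" and a: "(0,a) \<in> S"
    and p: "(1,p) \<in> S" "(1,q) \<in> S" and t: "cross a p \<le> t" "t \<le> cross a q"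
  shows "\<exists>r. (1,r) \<in> S \<and> cross a r = t"
proof -
  obtain b c where c: "corner S a b c" using corner_exists[OF S e a] by blast
  then have cr: "cross a b = 1" "(0,b) \<in> S" unfolding corner_def by auto
  then have ba: "cross (- b) a = 1" using cross_commute[of b a] by simp
  have S': "crystal (coords S 0 (- b) a)" using ba by (intro crystal_coords[OF S]) auto
  have m: "(0,- b) \<in> S" using crystal_sym[OF S cr(2)] by simp
  have 1: "(1, - cross a r, y) \<in> coords S 0 (- b) a \<longleftrightarrow> (1, scale2 (cross a r) b + scale2 y a) \<in> S" for r y
    by (simp add: scale2_minus)
  have "\<exists>s. (1, - t, s) \<in> coords S 0 (- b) a"
  proof (rule crystal_full[OF S'])
    show "(1, - cross a q, cross (- b) q) \<in> coords S 0 (- b) a"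
      using coords_surj[OF ba p(2), of 0] cross_commute[of q a] by simp
    show "(1, - cross a p, cross (- b) p) \<in> coords S 0 (- b) a"
      using coords_surj[OF ba p(1), of 0] cross_commute[of p a] by simp
  qed (use m a t in auto)
  then obtain s where "(1, scale2 (- t) (- b) + scale2 s a) \<in> S" by auto
  moreover have "cross a (scale2 (- t) (- b) + scale2 s a) = t" using cr by simp
  ultimately show ?thesis by blast
qed

lemma planar_divided_difference:
  assumes S: "crystal S" and d: "coprime (fst d) (snd d)"
    and p: "(1,p) \<in> S" "(1,p + scale2 k d) \<in> S" and k: "2 \<le> k"
  shows "(0,d) \<in> S"
proof -
  obtain d1 d2 where dd: "d = (d1,d2)" by (cases d)
  obtain u v where "u * d1 + v * d2 = 1" using bezout_int[of d1 d2] d dd by auto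
  then have "cross d (- v, u) = 1" unfolding dd by (simp add: algebra_simps)
  then have S': "crystal (coords S p d (- v, u))" by (intro crystal_coords[OF S]) auto
  have "(0,1,0) \<in> coords S p d (- v, u)" by (rule crystal_divided_difference[OF S' _ _ k]) (use p in \<open>simp_all del: scale2_simp\<close>)
  then show ?thesis by (simp del: scale2_simp)
qed

section \<open>Saturation of the roots of height one\<close>

text \<open>If the vertices of the chamber spanned by the walls (1,0,0), (0,1,0) and (1,0,0), (0,0,1) are
  double points, then reflecting the chamber at (1,0,0) fixes the other two walls, and no root can
  mix (1,0,0) with them.\<close>

lemma crystal_flip:
  assumes S: "crystal S" and e: "(1,0,0) \<in> S" "(0,1,0) \<in> S" "(0,0,1) \<in> S"
    and coh: "\<And>x y z. (x,y,z) \<in> S \<Longrightarrow> 0 \<le> x \<and> 0 \<le> y \<and> 0 \<le> z \<or> x \<le> 0 \<and> y \<le> 0 \<and> z \<le> 0"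
    and n: "(1,1,0) \<notin> S" "(1,0,1) \<notin> S" and r: "(x,y,z) \<in> S"
  shows "x = 0 \<or> y = 0 \<and> z = 0"
proof -
  have c2: "c = 0" if "(c,1,0) \<in> S" for c
    using crystal_neighbours[OF S e(1,2) n(1) that] coh[OF that] by auto
  have S': "crystal (coords S 0 (0,1) (1,0))" by (rule crystal_coords[OF S]) simp
  have c3: "c = 0" if "(c,0,1) \<in> S" for c
    using crystal_neighbours[OF S', of c 1] e n(2) that coh[OF that] by (auto simp: zero_prod_def)
  let ?u0 = "\<lambda>(x::int, y, z). y + z :: int" and ?u1 = "\<lambda>(x, y::int, z::int). - x :: int"
  let ?P = "lexpos ?u0 ?u1 ?u1"
  have lu1: "linform ?u1" by (rule linformI[of _ "-1" 0 0]) simp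
  have zero: "y = 0 \<and> z = 0" if "(x,y,z) \<in> S" "y + z = 0" for x y z
    using coh[OF that(1)] that(2) by linarith
  have nz: "?u1 r \<noteq> 0" if rS: "r \<in> S" and r0: "?u0 r = 0" for r
  proof -
    obtain x y z where "r = (x,y,z)" by (cases r)
    then show ?thesis using rS r0 zero[of x y z] crystal_nonzero[OF S] by auto
  qed
  obtain d1 d2 d3 k1 k2 k3 where pd: "posbasis S ?P d1 d2 d3 k1 k2 k3" and ld: "?P d1" "?P d2" "?P d3"
    by (rule lex_posbasis[OF S linform_proj(5) lu1 lu1 nz])
  have m: "(-1,0,0) \<in> S" using crystal_sym[OF S e(1)] by simp
  have "d1 = (-1,0,0) \<or> d2 = (-1,0,0) \<or> d3 = (-1,0,0)"
    using lex_simple[OF pd ld linform_proj(5) lu1 nz m] by auto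
  then obtain b2 b3 c1 c2 c3 where pb: "posbasis S ?P (-1,0,0) b2 b3 c1 c2 c3" and lp: "?P b2" "?P b3"
    using pd ld posbasis_swap12[OF pd] posbasis_swap12[OF posbasis_swap23[OF pd]] by metis
  note pc = posbasis_coeffs[OF pb]
  have upos: "1 \<le> ?u0 b" if b: "b \<in> S" "?P b" "c1 b = 0" for b
  proof (rule ccontr)
    assume "\<not> 1 \<le> ?u0 b"
    then have "?u0 b = 0" using b(2) unfolding lexpos_def by auto
    moreover obtain x y z where xyz: "b = (x,y,z)" by (cases b)
    ultimately have t: "b = (x,0,0)" using zero[of x y z] b(1) by simp
    have "c1 b = - x" using linform_coords[OF pc(1), of x 0 0] linform_coords[OF pc(1), of "-1" 0 0] pc(4) t by simp
    then show False using b(1,3) t crystal_nonzero[OF S] by auto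
  qed
  have u: "1 \<le> ?u0 b2" "1 \<le> ?u0 b3" using upos[OF pc(15) lp(1)] upos[OF pc(16) lp(2)] pc(5,6) by auto
  have simple: "c1 w = 0" if w: "w \<in> S" "?u0 w = 1" "?P w" "fst w = 0" and
    z: "\<And>c. (c, snd w) \<in> S \<Longrightarrow> c = 0" for w
  proof -
    have c: "0 \<le> c2 w" "0 \<le> c3 w" using pc(18,19)[OF w(1,3)] .
    have eq: "c2 w * ?u0 b2 + c3 w * ?u0 b3 = 1" using frame_expand[OF pc(13) linform_proj(5), of w] w by auto
    have "c2 w * 1 \<le> c2 w * ?u0 b2" "c3 w * 1 \<le> c3 w * ?u0 b3" using u c by (intro mult_left_mono; simp)+
    then have "c2 w + c3 w \<le> 1" using eq by linarith
    moreover have "c2 w \<noteq> 0 \<or> c3 w \<noteq> 0" using eq by auto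
    ultimately have cases: "c2 w = 1 \<and> c3 w = 0 \<or> c2 w = 0 \<and> c3 w = 1" using c by linarith
    obtain y z where wyz: "w = (0,y,z)" using w(4) by (cases w) auto
    obtain x2 y2 z2 x3 y3 z3 where bb: "b2 = (x2,y2,z2)" "b3 = (x3,y3,z3)" by (cases b2; cases b3)
    have "0 = - c1 w + c2 w * x2 + c3 w * x3" "y = c2 w * y2 + c3 w * y3" "z = c2 w * z2 + c3 w * z3"
      using frame_expand[OF pc(13) linform_proj(1), of w] frame_expand[OF pc(13) linform_proj(2), of w]
        frame_expand[OF pc(13) linform_proj(3), of w] wyz bb by simp_all
    then have "(c1 w, y, z) \<in> S" using cases pc(15,16) bb by auto
    then show ?thesis using z wyz by simp
  qed
  have z: "c1 (0,1,0) = 0" "c1 (0,0,1) = 0"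
    using simple[OF e(2)] simple[OF e(3)] c2 c3 by (auto simp: lexpos_def)
  have val: "c1 (x,y,z) = - x" for x y z
    using linform_coords[OF pc(1), of x y z] linform_coords[OF pc(1), of "-1" 0 0] z pc(4) by simp
  have key: "x = 0" if r: "(x,y,z) \<in> S" "0 < y + z" for x y z
    using pc(17)[OF r(1)] r val coh[OF r(1)] by (auto simp: lexpos_def)
  have r': "(-x,-y,-z) \<in> S" using crystal_sym[OF S r] by simp
  show ?thesis using key[OF r] key[OF r'] zero[OF r] by (cases "0 < y + z"; cases "y + z < 0") auto
qed

text \<open>The roots seen from X: the first coordinate is the height, which vanishes exactly on the roots
  through X, and the last condition is what irreducibility amounts to.\<close>

definition vertex_system :: "v3 set \<Rightarrow> bool" where
  "vertex_system S \<longleftrightarrow> crystal S \<and> (0,1,0) \<in> S \<and> (0,0,1) \<in> S \<and>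
     (\<forall>p. (1,p) \<in> S \<longrightarrow> (\<exists>r\<in>S. fst r \<noteq> 0 \<and> r \<noteq> (1,p) \<and> r \<noteq> - (1,p)))"

lemma vertex_systemD:
  assumes "vertex_system S"
  shows "crystal S" "(0,1,0) \<in> S" "(0,0,1) \<in> S"
    "(1,p) \<in> S \<Longrightarrow> \<exists>r\<in>S. fst r \<noteq> 0 \<and> r \<noteq> (1,p) \<and> r \<noteq> - (1,p)"
  using assms unfolding vertex_system_def by blast+

text \<open>This is the core of \<open>corner_step\<close>, fact (3). If p + b fails too,
  \<open>crystal_flip\<close> leaves (1,p) and its negative as the only roots of nonzero height,
  which the last condition of \<open>vertex_system\<close> forbids.\<close>

lemma corner_step_coords:
  assumes V: "vertex_system S" and p: "(1,p) \<in> S" "(0,a) \<in> S" "(0,b) \<in> S"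
    and D: "cross a b = 1 \<or> cross a b = - 1"
    and coh: "\<And>x y z. (x,y,z) \<in> coords S p a b \<Longrightarrow> 0 \<le> x \<and> 0 \<le> y \<and> 0 \<le> z \<or> x \<le> 0 \<and> y \<le> 0 \<and> z \<le> 0"
    and surj: "\<And>h r. (h,r) \<in> S \<Longrightarrow> \<exists>y z. (h,y,z) \<in> coords S p a b \<and> r = scale2 h p + scale2 y a + scale2 z b"
    and n: "(1,p + a) \<notin> S"
  shows "(1,p + b) \<in> S"
proof (rule ccontr)
  assume n2: "(1,p + b) \<notin> S"
  note S = vertex_systemD(1)[OF V]
  have S': "crystal (coords S p a b)" by (rule crystal_coords[OF S D])
  have fl: "h = 0 \<or> y = 0 \<and> z = 0" if "(h,y,z) \<in> coords S p a b" for h y z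
    by (rule crystal_flip[OF S' _ _ _ coh _ _ that]) (use p n n2 in auto)
  obtain r where r: "r \<in> S" "fst r \<noteq> 0" "r \<noteq> (1,p)" "r \<noteq> - (1,p)" using vertex_systemD(4)[OF V p(1)] by blast
  obtain h s where hs: "r = (h,s)" by (cases r)
  obtain y z where yz: "(h,y,z) \<in> coords S p a b" "s = scale2 h p + scale2 y a + scale2 z b" using surj r(1) hs by blast
  have "y = 0" "z = 0" using fl[OF yz(1)] r(2) hs by auto
  then have s: "s = scale2 h p" using yz(2) by simp
  then have "(h,s) = scale3 h (1,p)" by (cases p) simp
  then have "h = 1 \<or> h = - 1" using crystal_primitive[OF S] r(1) hs by metis
  then show False using r hs s by auto
qed

lemma corner_coherent:
  assumes S: "crystal S" and c: "corner S a b p" and e: "(x, scale2 x p + scale2 y a + scale2 z b) \<in> S"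
  shows "0 \<le> x \<and> 0 \<le> y \<and> 0 \<le> z \<or> x \<le> 0 \<and> y \<le> 0 \<and> z \<le> 0"
proof -
  note cr = cornerD(4)[OF c]
  have r': "(- x, - (scale2 x p + scale2 y a + scale2 z b)) \<in> S" using crystal_sym[OF S e] by simp
  consider "0 < x" | "x < 0" | "x = 0" by linarith
  then show ?thesis
  proof cases
    case 1 then show ?thesis using cornerD(6)[OF c e] cr by simp
  next
    case 2 then show ?thesis using cornerD(6)[OF c r'] cr by (simp add: scale2_minus)
  next
    case 3
    then have "(0, scale2 y a + scale2 z b) \<in> S" using e by simp
    then show ?thesis using cornerD(5)[OF c] cr 3 by fastforce
  qed
qed

lemma corner_step:
  assumes V: "vertex_system S" and c: "corner S a b p"
  shows "(1,p + a) \<notin> S \<Longrightarrow> (1,p + b) \<in> S"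
proof -
  note S = vertex_systemD(1)[OF V] and D = cornerD[OF c]
  show "(1,p + b) \<in> S" if "(1,p + a) \<notin> S"
  proof (rule corner_step_coords[OF V D(3,1,2) _ _ _ that])
    show "0 \<le> x \<and> 0 \<le> y \<and> 0 \<le> z \<or> x \<le> 0 \<and> y \<le> 0 \<and> z \<le> 0" if "(x,y,z) \<in> coords S p a b" for x y z
      using corner_coherent[OF S c] that by simp
    show "\<exists>y z. (h,y,z) \<in> coords S p a b \<and> r = scale2 h p + scale2 y a + scale2 z b" if "(h,r) \<in> S" for h r
    proof -
      have "r = scale2 h p + scale2 (cross (r - scale2 h p) b) a + scale2 (cross a (r - scale2 h p)) b"
        using cross_expand[OF D(4), of "r - scale2 h p"] by (metis add.assoc add.commute diff_add_cancel)
      then show ?thesis using coords_surj[OF D(4) that] by blast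
    qed
  qed (use D in simp)
qed

text \<open>A lattice point q of the polygon lies in the cone at every corner. If q is not a root, then each line
  through q in the direction of a root meets the roots of height one on one side of q only. At the chamber with the most
  such positive directions both walls point to the roots, which contradicts \<open>crystal_quadrant\<close>.\<close>

lemma crystal_fill:
  assumes S: "crystal S" and e: "(0,1,0) \<in> S" "(0,0,1) \<in> S"
    and q: "\<And>s1 s2. \<exists>r. (1,r) \<in> S \<and> s1 * fst r + s2 * snd r \<le> s1 * fst q + s2 * snd q"
  shows "(1,q) \<in> S"
proof (rule ccontr)
  assume nq: "(1,q) \<notin> S"
  have qc: "\<exists>r. (1,r) \<in> S \<and> cross a r \<le> cross a q" "\<exists>r. (1,r) \<in> S \<and> cross r a \<le> cross q a" for a
    using q[of "- snd a" "fst a"] q[of "snd a" "- fst a"] unfolding cross_def by (auto simp: mult.commute)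
  define H where "H = (\<lambda>r. \<exists>n>0. (1,q + scale2 n r) \<in> S)"
  have dich: "H a \<or> H (- a)" if a: "(0,a) \<in> S" for a
  proof -
    obtain r1 r2 where r12: "(1,r1) \<in> S" "cross a r1 \<le> cross a q" "(1,r2) \<in> S" "cross r2 a \<le> cross q a"
      using qc by blast
    then have "cross a q \<le> cross a r2" using cross_commute[of a] by simp
    then obtain r where r: "(1,r) \<in> S" "cross a r = cross a q" using planar_full[OF S e a r12(1,3,2)] by blast
    obtain b c where "corner S a b c" using corner_exists[OF S e a] by blast
    note D = cornerD[OF this]
    define n where "n = cross (r - q) b"
    have rq: "r = q + scale2 n a" using cross_expand[OF D(4), of "r - q"] r(2) unfolding n_def
      by (simp add: algebra_simps)
    have "n \<noteq> 0" using rq r(1) nq by auto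
    then show ?thesis using r(1) rq unfolding H_def
      by (cases "0 < n") (auto intro: exI[of _ n] exI[of _ "- n"] simp: scale2_minus)
  qed
  define gen where "gen = (\<lambda>s::int\<times>int. \<forall>r. (0,r) \<in> S \<longrightarrow> fst s * fst r + snd s * snd r \<noteq> 0)"
  define hits where "hits = (\<lambda>s::int\<times>int. {r. (0,r) \<in> S \<and> 0 < fst s * fst r + snd s * snd r \<and> H r})"
  have fin: "finite {r. (0,r) \<in> S \<and> P r}" for P
  proof -
    have "(\<lambda>r. (0::int,r)) ` {r. (0,r) \<in> S \<and> P r} \<subseteq> S" by auto
    then have "finite ((\<lambda>r. (0::int,r)) ` {r. (0,r) \<in> S \<and> P r})" using crystal_finite[OF S] finite_subset by blast
    then show ?thesis by (rule finite_imageD) (simp add: inj_on_def)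
  qed
  define M where "M = (\<lambda>f::int\<times>int\<Rightarrow>int. Max (insert 0 ((\<lambda>r. \<bar>f r\<bar>) ` {r. (0,r) \<in> S})) + 1)"
  have M: "\<bar>f r\<bar> < M f" if "(0,r) \<in> S" for f r
  proof -
    have "\<bar>f r\<bar> \<le> Max (insert 0 ((\<lambda>r. \<bar>f r\<bar>) ` {r. (0,r) \<in> S}))"
      using fin[of "\<lambda>_. True"] that by (intro Max_ge) auto
    then show ?thesis unfolding M_def by simp
  qed
  have mult: "0 < m * j - i" if "1 \<le> j" "\<bar>i\<bar> < m" for m j i :: int
  proof -
    have "m * 1 \<le> m * j" using that by (intro mult_left_mono) auto
    then show ?thesis using that by linarith
  qed
  \<comment> \<open>\<open>M snd\<close> exceeds all second coordinates, so this functional is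
    generic. Together with the bound on \<open>card (hits s)\<close> this provides a chamber with
    the most hits.\<close>
  have "gen (M snd, 1)"
    unfolding gen_def
  proof (intro allI impI)
    fix r assume r: "(0,r) \<in> S"
    show "fst (M snd, 1::int) * fst r + snd (M snd, 1::int) * snd r \<noteq> 0"
    proof (cases "fst r = 0")
      case True
      then have "snd r \<noteq> 0" using r crystal_nonzero[OF S] by (cases r) auto
      then show ?thesis using True by simp
    next
      case False
      then have "0 < M snd * \<bar>fst r\<bar> - \<bar>snd r\<bar>" using mult[of "\<bar>fst r\<bar>" "\<bar>snd r\<bar>"] M[OF r, of snd] by auto
      then show ?thesis by (auto simp: abs_if split: if_splits)
    qed
  qed
  moreover have "card (hits s) \<le> card {r. (0,r) \<in> S \<and> True}" for s
    unfolding hits_def by (intro card_mono fin) auto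
  ultimately obtain s where s: "gen s" and smax: "\<And>s'. gen s' \<Longrightarrow> card (hits s') \<le> card (hits s)"
    using ex_has_greatest_nat[of gen _ "\<lambda>s. card (hits s)"] by (metis less_Suc_eq_le)
  obtain a b p where c: "corner S a b p"
    and ab: "0 < fst s * fst a + snd s * snd a" "0 < fst s * fst b + snd s * snd b"
    by (rule lex_corner[where ?s1.0 = "fst s" and ?s2.0 = "snd s" and ?t1.0 = "fst s" and ?t2.0 = "snd s", OF S e])
       (use s in \<open>auto simp: gen_def\<close>)
  note D = cornerD[OF c]
  text \<open>Reflecting at a wall that is not hit would increase the number of hit positive roots.\<close>
  have hit: "H d" if d: "(0,d) \<in> S" "0 < fst s * fst d + snd s * snd d"
    and f: "\<And>r. f r = f1 * fst r + f2 * snd r" "f d = 0" and g: "\<And>r. g r = g1 * fst r + g2 * snd r" "g d = 1"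
    and pos: "\<And>r. (0,r) \<in> S \<Longrightarrow> 0 < fst s * fst r + snd s * snd r \<Longrightarrow> r = d \<or> 0 < f r"
    for d f g f1 f2 g1 g2
  proof (rule ccontr)
    assume nH: "\<not> H d"
    then have Hm: "H (- d)" using dich[OF d(1)] by blast
    \<comment> \<open>\<open>M g * f - g\<close> is positive on every positive root other than d,
      because f \<ge> 1 there, and equals -1 at d: it belongs to the chamber across the wall
      d.\<close>
    define s' where "s' = (M g * f1 - g1, M g * f2 - g2)"
    have s': "fst s' * fst r + snd s' * snd r = M g * f r - g r" for r
      unfolding s'_def f g by (simp add: algebra_simps)
    have up: "0 < M g * f r - g r" if "(0,r) \<in> S" "0 < fst s * fst r + snd s * snd r" "r \<noteq> d" for r
      using mult[of "f r" "g r" "M g"] pos[OF that(1,2)] that(3) M[OF that(1), of g] by auto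
    have neg: "f (- r) = - f r" "g (- r) = - g r" for r unfolding f g by simp_all
    have "gen s'" unfolding gen_def s'
    proof (intro allI impI)
      fix r assume r: "(0,r) \<in> S"
      have r': "(0,- r) \<in> S" using crystal_sym[OF S r] by simp
      have "fst s * fst r + snd s * snd r \<noteq> 0" using s r unfolding gen_def by blast
      then consider "r = d" | "- r = d" | "r \<noteq> d" "0 < fst s * fst r + snd s * snd r"
        | "- r \<noteq> d" "0 < fst s * fst (- r) + snd s * snd (- r)" by fastforce
      then show "M g * f r - g r \<noteq> 0"
      proof cases
        case 1 then show ?thesis using f g by simp
      next
        case 2 then show ?thesis using neg[of r] f(2) g(2) by auto
      next
        case 3 then show ?thesis using up[OF r] by auto
      next
        case 4 then show ?thesis using up[OF r'] neg[of r] by (auto simp: algebra_simps)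
      qed
    qed
    then have le: "card (hits s') \<le> card (hits s)" by (rule smax)
    have "hits s \<subset>
       hits s'"
    proof
      show "hits s \<subseteq>
        hits s'"
        unfolding hits_def s' using up nH by blast
      have "- d \<in> hits s'"
        unfolding hits_def s' using Hm crystal_sym[OF S d(1)] neg[of d] f(2) g(2) by simp
      moreover have "- d \<notin> hits s" using d(2) by (simp add: hits_def)
      ultimately show "hits s \<noteq>
        hits s'" by blast
    qed
    then have "card (hits s) < card (hits s')" by (rule psubset_card_mono[rotated]) (unfold hits_def, rule fin)
    then show False using le by simp
  qed
  have sexp: "fst s * fst r + snd s * snd r =
      cross r b * (fst s * fst a + snd s * snd a) + cross a r * (fst s * fst b + snd s * snd b)" for r
  proof -
    have "r = scale2 (cross r b) a + scale2 (cross a r) b" by (rule cross_expand[OF D(4)])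
    then have "fst r = cross r b * fst a + cross a r * fst b" "snd r = cross r b * snd a + cross a r * snd b"
      by (metis fst_add fst_conv scale2_def, metis snd_add snd_conv scale2_def)
    then show ?thesis by (simp add: algebra_simps)
  qed
  have coh: "0 \<le> cross r b \<and> 0 \<le> cross a r" if r: "(0,r) \<in> S" "0 < fst s * fst r + snd s * snd r" for r
  proof (rule ccontr)
    assume "\<not> ?thesis"
    then have "cross r b \<le> 0" "cross a r \<le> 0" using D(5)[OF r(1)] by auto
    then have "cross r b * (fst s * fst a + snd s * snd a) \<le> 0" "cross a r * (fst s * fst b + snd s * snd b) \<le> 0"
      using ab by (simp_all add: mult_nonpos_nonneg)
    then show False using sexp[of r] r(2) by linarith
  qed
  have mul: "r = d" if "(0,r) \<in> S" "r = scale2 m d" "0 \<le> m" for r d m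
  proof -
    have "(0,r) = scale3 m (0,d)" using that(2) by (cases d) simp
    then have "m = 1" using crystal_primitive[OF S that(1)] that(3) by fastforce
    then show ?thesis using that(2) by simp
  qed
  have Ha: "H a"
  proof (rule hit[OF D(1) ab(1), of "\<lambda>r. cross a r" "- snd a" "fst a" "\<lambda>r. cross r b" "snd b" "- fst b"])
    show "r = a \<or> 0 < cross a r" if r: "(0,r) \<in> S" "0 < fst s * fst r + snd s * snd r" for r
      using coh[OF r] mul[OF r(1), of "cross r b" a] cross_expand[OF D(4), of r] by (cases "cross a r = 0") auto
  qed (use D(4) in \<open>auto simp: cross_def\<close>)
  have Hb: "H b"
  proof (rule hit[OF D(2) ab(2), of "\<lambda>r. cross r b" "snd b" "- fst b" "\<lambda>r. cross a r" "- snd a" "fst a"])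
    show "r = b \<or> 0 < cross r b" if r: "(0,r) \<in> S" "0 < fst s * fst r + snd s * snd r" for r
      using coh[OF r] mul[OF r(1), of "cross a r" b] cross_expand[OF D(4), of r] by (cases "cross r b = 0") auto
  qed (use D(4) in \<open>auto simp: cross_def\<close>)
  obtain k l where kl: "0 < k" "(1,q + scale2 k a) \<in> S" "0 < l" "(1,q + scale2 l b) \<in> S"
    using Ha Hb unfolding H_def by blast
  have i: "0 \<le> cross (q - p) b"
  proof -
    obtain r where "(1,r) \<in> S" "cross r b \<le> cross q b" using qc(2) by blast
    then show ?thesis using D(7)[of r] by simp
  qed
  have j: "0 \<le> cross a (q - p)"
  proof -
    obtain r where "(1,r) \<in> S" "cross a r \<le> cross a q" using qc(1) by blast
    then show ?thesis using D(7)[of r] by simp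
  qed
  have S': "crystal (coords S q a b)" using D(4) by (intro crystal_coords[OF S]) auto
  have "(0,1,-1) \<notin> coords S q a b" using D(4) D(5)[of "a - b"] by auto
  moreover have "(1, - cross (q - p) b, - cross a (q - p)) \<in> coords S q a b"
    using coords_surj[OF D(4,3), of q] by simp
  ultimately have "(1,0,0) \<in> coords S q a b"
    using crystal_quadrant[OF S', where k = k and l = l and i = "cross (q - p) b" and j = "cross a (q - p)"] D(1,2) kl i j by auto
  then show False using nq by simp
qed

section \<open>The width of the roots of height one\<close>

lemma root_parallel:
  assumes S: "crystal S" and e: "(0,1,0) \<in> S" "(0,0,1) \<in> S" and r: "(0,r) \<in> S" "(0,s) \<in> S" "cross r s = 0"
  shows "s = r \<or> s = - r"
proof -
  obtain b p where "corner S r b p" using corner_exists[OF S e r(1)] by blast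
  note D = cornerD[OF this]
  have s: "s = scale2 (cross s b) r" using cross_expand[OF D(4), of s] r(3) by simp
  then have "(0,s) = scale3 (cross s b) (0,r)" by (cases r) simp
  then have "cross s b = 1 \<or> cross s b = - 1" using crystal_primitive[OF S r(2)] by blast
  then show ?thesis using s by (metis scale2_1 scale2_m1)
qed

lemma root_not_zero: "crystal S \<Longrightarrow> (0,r) \<in> S \<Longrightarrow> r \<noteq> 0"
  using crystal_nonzero by (auto simp: zero_prod_def)

lemma finite_slice:
  assumes "crystal S"
  shows "finite {r. (h,r) \<in> S}"
proof -
  have "(\<lambda>r. (h,r)) ` {r. (h,r) \<in> S} \<subseteq> S" by auto
  then have "finite ((\<lambda>r. (h,r)) ` {r. (h,r) \<in> S})" using crystal_finite[OF assms] finite_subset by blast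
  then show ?thesis by (rule finite_imageD) (simp add: inj_on_def)
qed

lemma three_distinct:
  assumes "3 \<le> card A"
  obtains x y z where "x \<in> A" "y \<in> A" "z \<in> A" "x \<noteq> y" "y \<noteq> z" "x \<noteq> z"
proof -
  obtain B where "B \<subseteq> A" "card B = 3" using obtain_subset_with_card_n[OF assms] by metis
  then show thesis using that unfolding card_3_iff by blast
qed

text \<open>If P lay on a line parallel to \<beta>, its only edges would be parallel to \<beta>. For
  another root c, \<open>corner_step\<close> then makes \<beta> up to sign the second wall of the
  chambers on both sides of c, so all roots of height zero lie on two lines and there are at most
  four.\<close>

lemma vertex_system_spread:
  assumes V: "vertex_system S" and m: "5 \<le> card {r. (0,r) \<in> S}" and b: "(0,\<beta>) \<in> S"
  shows "\<exists>r r'. (1,r) \<in> S \<and> (1,r') \<in> S \<and> cross \<beta> r \<noteq> cross \<beta> r'"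
proof (rule ccontr)
  assume no: "\<not> ?thesis"
  note S = vertex_systemD(1)[OF V] and e = vertex_systemD(2,3)[OF V]
  have "\<not> {r. (0,r) \<in> S} \<subseteq> {\<beta>, - \<beta>}"
  proof
    assume "{r. (0,r) \<in> S} \<subseteq> {\<beta>, - \<beta>}"
    then have "card {r. (0,r) \<in> S} \<le> card {\<beta>, - \<beta>}" by (intro card_mono) auto
    also have "\<dots> \<le> 2" by (simp add: card_insert_if)
    finally show False using m by simp
  qed
  then obtain c where c: "(0,c) \<in> S" "c \<noteq> \<beta>" "c \<noteq> - \<beta>" by blast
  have bc: "cross \<beta> c \<noteq> 0" using root_parallel[OF S e b c(1)] c by blast
  have step: "d = \<beta> \<or> d = - \<beta>" if "(1,p) \<in> S" "(0,d) \<in> S" "(1,p + d) \<in> S" for p d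
  proof -
    have "cross \<beta> (p + d) = cross \<beta> p" using no that by blast
    then show ?thesis using root_parallel[OF S e b that(2)] by simp
  qed
  obtain d p where c1: "corner S c d p" using corner_exists(1)[OF S e c(1)] by blast
  obtain d' p' where c2: "corner S d' (- c) p'" using corner_exists(2)[OF S e c(1)] by blast
  note D1 = cornerD[OF c1] and D2 = cornerD[OF c2]
  have "(1,p + c) \<notin> S" using step[OF D1(3,1)] c by blast
  then have d: "d = \<beta> \<or> d = - \<beta>" using step[OF D1(3,2)] corner_step[OF V c1] by blast
  have "(1,p' + - c) \<notin> S" using step[OF D2(3,2)] c by (metis minus_minus)
  then have d': "d' = \<beta> \<or> d' = - \<beta>" using step[OF D2(3,1)] corner_step[OF V c2] by blast
  have "cross c d = 1" "cross c d' = 1" using D1(4) D2(4) cross_commute[of d' c] by auto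
  then have dd: "d' = d" using d d' by auto
  have "{r. (0,r) \<in> S} \<subseteq> {c, - c, d, - d}"
  proof
    fix r assume "r \<in> {r. (0,r) \<in> S}"
    then have r: "(0,r) \<in> S" by simp
    have "cross r d = 0 \<or> cross c r = 0"
      using D1(5)[OF r] D2(5)[OF r] cross_commute[of d r] cross_commute[of c r] dd by auto
    then show "r \<in> {c, - c, d, - d}"
      using root_parallel[OF S e D1(2) r] root_parallel[OF S e D1(1) r] cross_commute[of d r] by auto
  qed
  then have "card {r. (0,r) \<in> S} \<le> card {c, - c, d, - d}" by (intro card_mono) auto
  also have "\<dots> \<le> 4" by (simp add: card_insert_if)
  finally show False using m by simp
qed

text \<open>The corner between the other two has no edge along x2, which points out of the
  half-plane of x3, hence it has one along b2. The half-plane of x1 and the position of the chamber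
  leave only b2 = - x1, and p - x1 violates the corner of x1.\<close>

lemma corner_middle:
  assumes V: "vertex_system S" and c: "corner S x1 b1 p" "corner S x2 b2 p" "corner S x3 b3 p"
    and D: "0 < cross x1 x2" "0 < cross x2 x3"
  shows False
proof -
  note S = vertex_systemD(1)[OF V] and e = vertex_systemD(2,3)[OF V]
  note D1 = cornerD[OF c(1)] and D2 = cornerD[OF c(2)] and D3 = cornerD[OF c(3)]
  have "(1,p + x2) \<notin> S" using D3(7)[of "p + x2"] D(2) cross_commute[of x3 x2] by auto
  then have pb: "(1,p + b2) \<in> S" using corner_step[OF V c(2)] by blast
  have m: "(0,- x1) \<in> S" using crystal_sym[OF S D1(1)] by simp
  have "cross x1 b2 \<le> 0" using D2(5)[OF m] D(1) cross_commute[of x2 x1] by auto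
  moreover have "0 \<le> cross x1 b2" using D1(7)[OF pb] by simp
  ultimately have "b2 = x1 \<or> b2 = - x1" using root_parallel[OF S e D1(1) D2(2)] by simp
  then have "b2 = - x1" using D2(4) D(1) cross_commute[of x2 x1] by auto
  then show False using D1(7)[OF pb] D1(4) by simp
qed

text \<open>Among three first walls at one vertex, either one lies between the others, which
  \<open>corner_middle\<close> excludes, or they positively span the plane. In the latter case the
  three half-planes confine P to a line, against \<open>vertex_system_spread\<close>.\<close>

lemma corner_fibre:
  assumes V: "vertex_system S" and m: "5 \<le> card {r. (0,r) \<in> S}"
    and c: "corner S x1 b1 p" "corner S x2 b2 p" "corner S x3 b3 p"
    and ne: "x1 \<noteq> x2" "x2 \<noteq> x3" "x1 \<noteq> x3"
  shows False
proof -
  note S = vertex_systemD(1)[OF V] and e = vertex_systemD(2,3)[OF V]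
  have const: False if c: "corner S x b p" and z: "\<And>r. (1,r) \<in> S \<Longrightarrow> cross x (r - p) = 0" for x b
    using vertex_system_spread[OF V m cornerD(1)[OF c]] z by (metis cross_lin(4) eq_iff_diff_eq_0)
  have nz: "cross x y \<noteq> 0" if c: "corner S x b p" "corner S y d p" and ne: "x \<noteq> y" for x b y d
  proof
    assume "cross x y = 0"
    then have "y = - x" using root_parallel[OF S e cornerD(1)[OF c(1)] cornerD(1)[OF c(2)]] ne by auto
    then have "cross x (r - p) = 0" if "(1,r) \<in> S" for r
      using cornerD(7)[OF c(1) that] cornerD(7)[OF c(2) that] by simp
    then show False by (rule const[OF c(1)])
  qed
  have cyc: False if D: "0 < k * cross x1 x2" "0 < k * cross x2 x3" "0 < k * cross x3 x1" for k
  proof (rule const[OF c(1)])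
    fix r assume r: "(1,r) \<in> S"
    have d: "0 \<le> cross x1 (r - p)" "0 \<le> cross x2 (r - p)" "0 \<le> cross x3 (r - p)"
      using cornerD(7)[OF c(1) r] cornerD(7)[OF c(2) r] cornerD(7)[OF c(3) r] by blast+
    \<comment> \<open>The linear relation between three vectors of a plane, paired with v.\<close>
    have id: "cross x2 x3 * cross x1 v + cross x3 x1 * cross x2 v + cross x1 x2 * cross x3 v = 0" for v
      unfolding cross_def by algebra
    have "k * cross x2 x3 * cross x1 (r - p) + k * cross x3 x1 * cross x2 (r - p) + k * cross x1 x2 * cross x3 (r - p) = 0"
      using arg_cong[OF id[of "r - p"], of "\<lambda>x. k * x"] by (simp add: distrib_left mult.assoc del: cross_lin)
    moreover have "0 \<le> k * cross x2 x3 * cross x1 (r - p)" "0 \<le> k * cross x3 x1 * cross x2 (r - p)"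
      "0 \<le> k * cross x1 x2 * cross x3 (r - p)"
      using D d by (simp_all del: cross_lin)
    ultimately have "k * cross x2 x3 * cross x1 (r - p) = 0" by linarith
    then show "cross x1 (r - p) = 0" using D(2) by (metis less_irrefl mult_eq_0_iff)
  qed
  have n: "cross x1 x2 \<noteq> 0" "cross x2 x3 \<noteq> 0" "cross x3 x1 \<noteq> 0"
    using nz[OF c(1,2) ne(1)] nz[OF c(2,3) ne(2)] nz[OF c(3,1)] ne(3) by auto
  note cm = cross_commute[of x2 x1] cross_commute[of x3 x2] cross_commute[of x1 x3]
  note mids = corner_middle[OF V c] corner_middle[OF V c(2,3,1)] corner_middle[OF V c(3,1,2)]
    corner_middle[OF V c(3,2,1)] corner_middle[OF V c(2,1,3)] corner_middle[OF V c(1,3,2)]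
  consider "0 < cross x1 x2 \<and> 0 < cross x2 x3" | "cross x1 x2 < 0 \<and> cross x2 x3 < 0"
    | "0 < cross x1 x2 \<and> 0 < cross x3 x1" | "cross x1 x2 < 0 \<and> cross x3 x1 < 0"
    | "0 < cross x3 x1 \<and> 0 < cross x2 x3" | "cross x3 x1 < 0 \<and> cross x2 x3 < 0"
    using n by linarith
  then show False using mids cm by cases auto
qed

text \<open>Each of the 258 = 2 * 129 roots of height zero is the first wall of a corner, and
  \<open>corner_fibre\<close> allows at most two of them at the same vertex.\<close>

lemma many_starts:
  assumes V: "vertex_system S" and m: "258 \<le> card {r. (0,r) \<in> S}"
  obtains P where "129 \<le> card P" "\<And>p. p \<in> P \<Longrightarrow> \<exists>a b. corner S a b p"
proof -
  note S = vertex_systemD(1)[OF V] and e = vertex_systemD(2,3)[OF V]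
  let ?Q = "{r. (0,r) \<in> S}"
  define st where "st = (\<lambda>a. SOME p. \<exists>b. corner S a b p)"
  have st: "\<exists>b. corner S a b (st a)" if "a \<in> ?Q" for a
    unfolding st_def by (rule someI_ex) (use corner_exists(1)[OF S e] that in blast)
  have fin: "finite ?Q" by (rule finite_slice[OF S])
  have fib: "card {a \<in> ?Q. st a = p} \<le> 2" for p
  proof (rule ccontr)
    assume "\<not> ?thesis"
    then have "3 \<le> card {a \<in> ?Q. st a = p}" by simp
    then obtain x y z where xyz: "x \<in> {a \<in> ?Q. st a = p}" "y \<in> {a \<in> ?Q. st a = p}" "z \<in> {a \<in> ?Q. st a = p}"
      "x \<noteq> y" "y \<noteq> z" "x \<noteq> z" by (rule three_distinct)
    have ex: "\<exists>b. corner S a b p" if "a \<in> {a \<in> ?Q. st a = p}" for a using st[of a] that by auto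
    obtain b1 where b1: "corner S x b1 p" using ex[OF xyz(1)] by (rule exE)
    obtain b2 where b2: "corner S y b2 p" using ex[OF xyz(2)] by (rule exE)
    obtain b3 where b3: "corner S z b3 p" using ex[OF xyz(3)] by (rule exE)
    have "5 \<le> card ?Q" using m by simp
    then show False using corner_fibre[OF V _ b1 b2 b3 xyz(4-6)] by blast
  qed
  have "?Q = (\<Union>p\<in>st ` ?Q. {a \<in> ?Q. st a = p})" by auto
  then have "card ?Q = card (\<Union>p\<in>st ` ?Q. {a \<in> ?Q. st a = p})" by (rule arg_cong)
  also have "\<dots> \<le> (\<Sum>p\<in>st ` ?Q. card {a \<in> ?Q. st a = p})" by (rule card_UN_le) (use fin in blast)
  also have "\<dots> \<le> (\<Sum>p\<in>st ` ?Q. 2)" by (rule sum_mono) (rule fib)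
  finally have "129 \<le> card (st ` ?Q)" using m by simp
  then show thesis by (rule that) (use st in blast)
qed

text \<open>A vertex of P is an end of its column, so a column contains at most two vertices and 129
  vertices occupy at least 65 columns.\<close>

lemma vertex_system_width:
  assumes V: "vertex_system S" and m: "258 \<le> card {r. (0,r) \<in> S}"
  shows "\<exists>r r'. (1,r) \<in> S \<and> (1,r') \<in> S \<and> 64 \<le> fst r' - fst r" "129 \<le> card {r. (1,r) \<in> S}"
proof -
  note S = vertex_systemD(1)[OF V] and e = vertex_systemD(2,3)[OF V]
  obtain P where P: "129 \<le> card P" "\<And>p. p \<in> P \<Longrightarrow> \<exists>a b. corner S a b p" using many_starts[OF V m] by blast
  let ?R = "{r. (1,r) \<in> S}"
  have fin: "finite ?R" by (rule finite_slice[OF S])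
  have sub: "P \<subseteq> ?R" using P(2) cornerD(3) by blast
  then show "129 \<le> card ?R" using P(1) card_mono[OF fin sub] by linarith
  have ends: "\<not> ((1,x,y + 1) \<in> S \<and> (1,x,y - 1) \<in> S)" if xyP: "(x,y) \<in> P" for x y
  proof
    assume h: "(1,x,y + 1) \<in> S \<and> (1,x,y - 1) \<in> S"
    obtain a b where "corner S a b (x,y)" using P(2)[OF xyP] by blast
    note D = cornerD[OF this]
    have "0 \<le> cross (0,1) b" "0 \<le> cross a (0,1)" "0 \<le> cross (0,-1) b" "0 \<le> cross a (0,-1)"
      using D(7)[of "(x,y+1)"] D(7)[of "(x,y-1)"] h by (auto simp: cross_def)
    then have "cross (0,1) b = 0" "cross a (0,1) = 0" by (auto simp: cross_def)
    then show False using cross_expand[OF D(4), of "(0,1)"] by (simp add: zero_prod_def)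
  qed
  \<comment> \<open>The Boolean is true at the lower end of a column with several points and false
    at an upper end.\<close>
  define f where "f = (\<lambda>p. (fst p, (1::int, fst p, snd p + 1) \<in> S))"
  have inj: "inj_on f P"
  proof (rule inj_onI)
    fix p p' assume pp: "p \<in> P" "p' \<in> P" "f p = f p'"
    obtain x y y' where xy: "p = (x,y)" "p' = (x,y')" using pp(3) unfolding f_def by (cases p; cases p') auto
    have iff: "(1,x,y + 1) \<in> S \<longleftrightarrow> (1,x,y' + 1) \<in> S" using pp(3) xy unfolding f_def by simp
    have R: "(1,x,y) \<in> S" "(1,x,y') \<in> S" using sub pp xy by auto
    have False if "y < y'"
      using crystal_column_interval[OF S e(2) R, of "y + 1"] crystal_column_interval[OF S e(2) R, of "y' - 1"]
        ends[of x y'] pp(2) xy iff that by auto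
    moreover have False if "y' < y"
      using crystal_column_interval[OF S e(2) R(2,1), of "y' + 1"] crystal_column_interval[OF S e(2) R(2,1), of "y - 1"]
        ends[of x y] pp(1) xy iff that by auto
    ultimately show "p = p'" using xy by (metis linorder_neqE)
  qed
  let ?X = "fst ` ?R"
  have ne: "?X \<noteq> {}" using P(1) sub by (metis card.empty empty_is_image subset_empty not_numeral_le_zero)
  have finX: "finite ?X" using fin by blast
  have "f ` P \<subseteq> {Min ?X..Max ?X} \<times> (UNIV::bool set)"
  proof
    fix v assume "v \<in> f ` P"
    then obtain p where p: "p \<in> P" "v = f p" by blast
    then have "fst p \<in> ?X" using sub by blast
    then show "v \<in> {Min ?X..Max ?X} \<times> (UNIV::bool set)"
      unfolding p(2) f_def using Min_le[OF finX] Max_ge[OF finX] by simp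
  qed
  then have "card P \<le> card ({Min ?X..Max ?X} \<times> (UNIV::bool set))"
    using card_mono[of "{Min ?X..Max ?X} \<times> (UNIV::bool set)" "f ` P"] card_image[OF inj] by simp
  also have "\<dots> = nat (Max ?X - Min ?X + 1) * 2" by (simp add: card_cartesian_product)
  finally have "64 \<le> Max ?X - Min ?X" using P(1) by linarith
  moreover obtain r where "(1,r) \<in> S" "fst r = Min ?X" using Min_in[OF finX ne] by force
  moreover obtain r' where "(1,r') \<in> S" "fst r' = Max ?X" using Max_in[OF finX ne] by force
  ultimately show "\<exists>r r'. (1,r) \<in> S \<and> (1,r') \<in> S \<and> 64 \<le> fst r' - fst r" by metis
qed

section \<open>Long chords\<close>

lemma slope_interval:
  assumes S: "crystal S" and e: "(0,0,1) \<in> S" and ab: "(0,1,a) \<in> S" "(0,1,b) \<in> S" and j: "a \<le> j" "j \<le> b"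
  shows "(0,1,j) \<in> S"
proof -
  define S' where "S' = {v. (\<lambda>(x, y, z). (z, x, y)) v \<in> S}"
  have S': "crystal S'" unfolding S'_def
    by (rule crystal_vimage[OF S, of _ "\<lambda>(x, y, z). (y, z, x)"])
       (rule linmapI[of _ 0 0 1 1 0 0 0 1 0], simp, rule linmapI[of _ 0 1 0 0 0 1 1 0 0], simp, auto)
  have "(1,j,0) \<in> S'"
    by (rule crystal_interval[OF S' _ _ _ j]) (use e ab in \<open>simp_all add: S'_def\<close>)
  then show ?thesis by (simp add: S'_def)
qed

definition reflect :: "v3 set \<Rightarrow> v3 set" where
  "reflect S = coords S 0 (1,0) (0,-1)"

lemma mem_reflect [simp]: "(h,x,y) \<in> reflect S \<longleftrightarrow> (h,x,-y) \<in> S"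
  by (simp add: reflect_def)

lemma crystal_reflect: "crystal S \<Longrightarrow> crystal (reflect S)"
  unfolding reflect_def by (rule crystal_coords) simp_all

lemma plane_coords:
  assumes "cross a b = 1 \<or> cross a b = - 1"
  shows "\<exists>y z. r = scale2 y a + scale2 z b"
  using assms
proof
  assume "cross a b = 1"
  then show ?thesis using cross_expand by blast
next
  assume "cross a b = - 1"
  then have "cross b a = 1" using cross_commute[of b a] by simp
  then have "r = scale2 (cross r a) b + scale2 (cross b r) a" by (rule cross_expand)
  then show ?thesis by (metis add.commute)
qed

lemma coords_expand:
  assumes "cross a b = 1 \<or> cross a b = - 1" "(h,r) \<in> S"
  obtains y z where "(h,y,z) \<in> coords S p a b" "r = scale2 h p + scale2 y a + scale2 z b"
proof -
  obtain y z where yz: "r - scale2 h p = scale2 y a + scale2 z b" using plane_coords[OF assms(1)] by blast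
  then have "r = scale2 h p + scale2 y a + scale2 z b" by (simp add: algebra_simps)
  then show thesis using that assms(2) by simp
qed

lemma vertex_system_coords:
  assumes V: "vertex_system S" and D: "cross a b = 1 \<or> cross a b = - 1" and ab: "(0,a) \<in> S" "(0,b) \<in> S"
  shows "vertex_system (coords S p a b)"
  unfolding vertex_system_def
proof (intro conjI allI impI)
  note S = vertex_systemD(1)[OF V]
  show "crystal (coords S p a b)" by (rule crystal_coords[OF S D])
  show "(0,1,0) \<in> coords S p a b" "(0,0,1) \<in> coords S p a b" using ab by simp_all
  fix q assume q: "(1,q) \<in> coords S p a b"
  obtain q1 q2 where q12: "q = (q1,q2)" by (cases q)
  have "(1, p + scale2 q1 a + scale2 q2 b) \<in> S" using q q12 by simp
  from vertex_systemD(4)[OF V this] obtain r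
    where r: "r \<in> S" "fst r \<noteq> 0" "r \<noteq> (1,p + scale2 q1 a + scale2 q2 b)" "r \<noteq> - (1,p + scale2 q1 a + scale2 q2 b)"
    by blast
  obtain h s where hs: "r = (h,s)" by (cases r)
  have "(h,s) \<in> S" using r(1) hs by simp
  from coords_expand[OF D this, of p] obtain y z where yz: "(h,y,z) \<in> coords S p a b" "s = scale2 h p + scale2 y a + scale2 z b" .
  have "(h,y,z) \<noteq> (1,q)" using r(3) hs yz(2) q12 by auto
  moreover have "(h,y,z) \<noteq> - (1,q)" using r(4) hs yz(2) q12 by (auto simp: scale2_minus)
  ultimately show "\<exists>r\<in>coords S p a b. fst r \<noteq> 0 \<and> r \<noteq> (1,q) \<and> r \<noteq> - (1,q)"
    using yz(1) r(2) hs by (intro bexI[of _ "(h,y,z)"]) auto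
qed

lemma card_roots_coords:
  assumes S: "crystal S" and D: "cross a b = 1 \<or> cross a b = - 1"
  shows "card {r. (0,r) \<in> S} \<le> card {r. (0,r) \<in> coords S p a b}"
proof -
  have "{r. (0,r) \<in> S} \<subseteq> (\<lambda>r. scale2 (fst r) a + scale2 (snd r) b) ` {r. (0,r) \<in> coords S p a b}"
  proof
    fix r assume "r \<in> {r. (0,r) \<in> S}"
    then have r: "(0,r) \<in> S" by simp
    obtain y z where "(0,y,z) \<in> coords S p a b" "r = scale2 0 p + scale2 y a + scale2 z b" by (rule coords_expand[OF D r])
    then show "r \<in> (\<lambda>r. scale2 (fst r) a + scale2 (snd r) b) ` {r. (0,r) \<in> coords S p a b}"
      by (intro image_eqI[of _ _ "(y,z)"]) auto
  qed
  then show ?thesis using surj_card_le[OF finite_slice[OF crystal_coords[OF S D]]] by blast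
qed

lemma vertex_system_reflect: "vertex_system S \<Longrightarrow> vertex_system (reflect S)"
proof -
  assume V: "vertex_system S"
  have "(0,0,-1) \<in> S" using crystal_sym[OF vertex_systemD(1,3)[OF V]] by simp
  then show ?thesis unfolding reflect_def using vertex_systemD(2)[OF V] by (intro vertex_system_coords[OF V]) auto
qed

section \<open>Convexity and slopes along the boundary of P\<close>

lemma columns_meet_upper:
  assumes S: "crystal S" and b: "(0,0,1) \<in> S" and a: "(0,1,k) \<in> S" "(0,1,k+1) \<notin> S"
    and f: "(1,t,f) \<in> S" "(1,t,f-1) \<notin> S" and y: "(1,t+1,y) \<in> S"
  shows "\<exists>y'\<ge>f+k. (1,t+1,y') \<in> S"
proof -
  have "(0,0,-1) \<in> S" using crystal_sym[OF S b] by simp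
  then have "\<exists>y'\<le>-f + -k. (1,t+1,y') \<in> reflect S"
    using a f y by (intro crystal_columns_meet[OF crystal_reflect[OF S], of "-k" t "-f" "-y"]) (auto simp: algebra_simps)
  then obtain y' where "y' \<le> -f + -k" "(1,t+1,-y') \<in> S" by auto
  then show ?thesis by (intro exI[of _ "-y'"]) auto
qed

lemma weighted_min:
  fixes m1 m2 :: int
  assumes "0 \<le> m1" "0 \<le> m2" "m1 + m2 = N" "0 < N" "m1 * u1 + m2 * u2 \<le> N * u"
  shows "u1 \<le> u \<or> u2 \<le> u"
proof (rule ccontr)
  assume "\<not> ?thesis"
  then have "m1 * (u + 1) \<le> m1 * u1" "m2 * (u + 1) \<le> m2 * u2" using assms by (intro mult_left_mono; simp)+
  then have "(m1 + m2) * (u + 1) \<le> N * u" using assms(5) by (simp add: algebra_simps)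
  then show False using assms(3,4) by (simp add: algebra_simps)
qed

text \<open>The point lies above one segment and below another, both with endpoints in P. A
  functional with s2 \<ge> 0 is tested on the lower segment, any other on the upper one; one
  endpoint has no larger value, as \<open>crystal_fill\<close> requires.\<close>

lemma fill_segment:
  assumes V: "vertex_system S" and p: "(1,x1,y1) \<in> S" "(1,x2,y2) \<in> S" "(1,x3,y3) \<in> S" "(1,x4,y4) \<in> S"
    and m: "0 \<le> m1" "0 \<le> m2" "m1 + m2 = N" "0 \<le> m3" "0 \<le> m4" "m3 + m4 = N" "0 < N"
    and x: "m1 * x1 + m2 * x2 = N * x" "m3 * x3 + m4 * x4 = N * x"
    and y: "m1 * y1 + m2 * y2 \<le> N * y" "N * y \<le> m3 * y3 + m4 * y4"
  shows "(1,x,y) \<in> S"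
proof (rule crystal_fill[OF vertex_systemD(1-3)[OF V]])
  fix s1 s2 :: int
  show "\<exists>r. (1,r) \<in> S \<and> s1 * fst r + s2 * snd r \<le> s1 * fst (x,y) + s2 * snd (x,y)"
  proof (cases "0 \<le> s2")
    case True
    have "m1 * (s1 * x1 + s2 * y1) + m2 * (s1 * x2 + s2 * y2) = s1 * (m1 * x1 + m2 * x2) + s2 * (m1 * y1 + m2 * y2)"
      by algebra
    also have "\<dots> \<le> s1 * (N * x) + s2 * (N * y)" using True x(1) y(1) by (simp add: mult_left_mono)
    also have "\<dots> = N * (s1 * x + s2 * y)" by algebra
    finally have "s1 * x1 + s2 * y1 \<le> s1 * x + s2 * y \<or> s1 * x2 + s2 * y2 \<le> s1 * x + s2 * y"
      using weighted_min m by blast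
    then show ?thesis using p by force
  next
    case False
    have "m3 * (s1 * x3 + s2 * y3) + m4 * (s1 * x4 + s2 * y4) = s1 * (m3 * x3 + m4 * x4) + s2 * (m3 * y3 + m4 * y4)"
      by algebra
    also have "\<dots> \<le> s1 * (N * x) + s2 * (N * y)" using False x(2) y(2) by (simp add: mult_left_mono_neg)
    also have "\<dots> = N * (s1 * x + s2 * y)" by algebra
    finally have "s1 * x3 + s2 * y3 \<le> s1 * x + s2 * y \<or> s1 * x4 + s2 * y4 \<le> s1 * x + s2 * y"
      using weighted_min m by blast
    then show ?thesis using p by force
  qed
qed

text \<open>This is what bounds the change of slope of the boundary of P.\<close>

lemma no_common_maximizer:
  assumes V: "vertex_system S" and j: "(0,1,j+1) \<in> S" "(0,1,j) \<in> S"
    and p: "(1,x,y) \<in> S"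
    and up: "\<And>x' y'. (1,x',y') \<in> S \<Longrightarrow> y' - (j+1) * x' \<le> y - (j+1) * x"
    and left: "\<And>x' y'. (1,x',y') \<in> S \<Longrightarrow> y' - (j+1) * x' = y - (j+1) * x \<Longrightarrow> x \<le> x'"
    and lo: "\<And>x' y'. (1,x',y') \<in> S \<Longrightarrow> y' - (j-1) * x' \<le> y - (j-1) * x"
  shows False
proof -
  note S = vertex_systemD(1)[OF V] and e = vertex_systemD(2,3)[OF V]
  let ?p = "(x,y)"
  \<comment> \<open>One column to the left along slope j; \<open>e0\<close> is the same for slope j
    + 1.\<close>
  define a where "a = (- 1 :: int, - j)"
  define e0 where "e0 = (- 1 :: int, - (j + 1))"
  have aS: "(0,- a) \<in> S" "(0,a) \<in> S" using j(2) crystal_sym[OF S j(2)] unfolding a_def by simp_all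
  have eS: "(0,e0) \<in> S" using crystal_sym[OF S j(1)] unfolding e0_def by simp
  have ae: "cross a e0 = 1" unfolding a_def e0_def by (simp add: algebra_simps)
  \<comment> \<open>(x,y) is the only maximizer for the intermediate slope j, so the chambers on
    both sides of a belong to this vertex and have no edge along a.\<close>
  have uniq: "0 \<le> cross a (r - ?p) \<and> (cross a (r - ?p) = 0 \<longrightarrow> r = ?p)" if r: "(1,r) \<in> S" for r
  proof -
    obtain x' y' where r': "r = (x',y')" by (cases r)
    have "y' - j * x' - x' \<le> y - j * x - x" "y' - j * x' + x' \<le> y - j * x + x"
      "y' - j * x' - x' = y - j * x - x \<Longrightarrow> x \<le> x'"
      using up[of x' y'] lo[of x' y'] left[of x' y'] r r' by (simp_all add: algebra_simps)
    moreover have "cross a (r - ?p) = (y - j * x) - (y' - j * x')" unfolding a_def r' cross_def by (simp add: algebra_simps)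
    ultimately show ?thesis unfolding r' by auto
  qed
  obtain b p0 where c: "corner S a b p0" using corner_exists(1)[OF S e aS(2)] by blast
  obtain b' p0' where c': "corner S b' (- a) p0'" using corner_exists(2)[OF S e aS(2)] by blast
  note D = cornerD[OF c] and D' = cornerD[OF c']
  have p0: "p0 = ?p"
    using uniq[OF D(3)] D(7)[OF p] by auto
  have p0': "p0' = ?p"
    using uniq[OF D'(3)] D'(7)[OF p] cross_commute[of p0' a] cross_commute[of ?p a] by auto
  have "(1,p0 + a) \<notin> S" "(1,p0' + - a) \<notin> S"
    using uniq[of "p0 + a"] uniq[of "p0' + - a"] p0 p0' unfolding a_def by auto
  then have pb: "(1,?p + b) \<in> S" "(1,?p + b') \<in> S"
    using corner_step[OF V c] corner_step[OF V c'] p0 p0' by blast+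
  have i: "0 \<le> cross e0 b" using D(5)[OF eS] ae by auto
  have i': "0 \<le> cross b' e0" using D'(5)[OF eS] ae cross_commute[of e0 a] by auto
  have e1: "e0 = scale2 (cross e0 b) a + b" using cross_expand[OF D(4), of e0] ae by simp
  have e2: "e0 = b' - scale2 (cross b' e0) a"
    using cross_expand[OF D'(4), of e0] ae cross_commute[of e0 a] by (simp add: scale2_minus)
  \<comment> \<open>p + b and p + b' lie on the next lattice line parallel to a, with p + e0 between
    them. So p + e0 is a root: a maximizer for slope j + 1 further to the left.\<close>
  have eq: "?p + b' = ?p + b + scale2 (cross e0 b + cross b' e0) a"
    using e1 e2 unfolding scale2_add by (metis (no_types, lifting) add.assoc add.commute diff_add_cancel)
  have "(1,?p + b + scale2 (cross e0 b) a) \<in> S"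
    by (rule planar_interval[OF S e aS(2) pb(1) pb(2)[unfolded eq] i]) (use i' in simp)
  moreover have "?p + b + scale2 (cross e0 b) a = ?p + e0" using e1 by (metis add.assoc add.commute)
  moreover have "?p + e0 = (x - 1,y - (j + 1))" by (simp add: e0_def)
  ultimately have "(1,x - 1,y - (j + 1)) \<in> S" by metis
  then show False using left[of "x - 1" "y - (j + 1)"] by (simp add: algebra_simps)
qed

lemma leftmost_maximizer:
  assumes S: "crystal S" and ne: "(1,r) \<in> S"
  shows "\<exists>a Y. (1,a,Y) \<in> S \<and> (\<forall>x y. (1,x,y) \<in> S \<longrightarrow> y - j * x \<le> Y - j * a) \<and>
    (\<forall>x y. (1,x,y) \<in> S \<longrightarrow> y - j * x = Y - j * a \<longrightarrow> a \<le> x)"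
proof -
  let ?R = "{r. (1,r) \<in> S}"
  define g where "g = (\<lambda>r::int\<times>int. snd r - j * fst r)"
  have fin: "finite ?R" by (rule finite_slice[OF S])
  define T where "T = {r \<in> ?R. g r = Max (g ` ?R)}"
  have "Max (g ` ?R) \<in> g ` ?R" using fin ne by (intro Max_in) blast+
  then obtain r0 where "Max (g ` ?R) = g r0" "r0 \<in> ?R" by (rule imageE)
  then have "r0 \<in> T" unfolding T_def by simp
  moreover have "finite T" unfolding T_def by (rule finite_subset[OF _ fin]) auto
  ultimately have T: "T \<noteq> {}" "finite T" by auto
  then have "Min (fst ` T) \<in> fst ` T" by (intro Min_in) auto
  then obtain p where p': "Min (fst ` T) = fst p" "p \<in> T" by (rule imageE)
  note p = p'(2) p'(1)[symmetric]
  have 1: "g r \<le> g p" if "(1,r) \<in> S" for r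
  proof -
    have "g r \<le> Max (g ` ?R)" using fin that by (intro Max_ge) auto
    then show ?thesis using p(1) unfolding T_def by simp
  qed
  have 2: "fst p \<le> fst r" if "(1,r) \<in> S" "g r = g p" for r
  proof -
    have "r \<in> T" using that p(1) unfolding T_def by simp
    then show ?thesis unfolding p(2) using T by (intro Min_le) auto
  qed
  have "(1,fst p,snd p) \<in> S" using p(1) unfolding T_def by simp
  moreover have "y - j * x \<le> snd p - j * fst p" if "(1,x,y) \<in> S" for x y
    using 1[OF that] unfolding g_def by simp
  moreover have "fst p \<le> x" if "(1,x,y) \<in> S" "y - j * x = snd p - j * fst p" for x y
    using 2[OF that(1)] that(2) unfolding g_def by simp
  ultimately show ?thesis by blast
qed

text \<open>Comparing the two maximality conditions, a smaller slope never moves the leftmost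
  maximizer to the left. A decrease by two moves it strictly, by
  \<open>no_common_maximizer\<close>.\<close>

lemma maximizer_moves:
  assumes V: "vertex_system S" and A: "\<And>x y. (1,x,y) \<in> S \<Longrightarrow> A \<le> x" and ne: "(1,r) \<in> S"
    and sl: "\<And>j. k' \<le> j \<Longrightarrow> j \<le> k \<Longrightarrow> (0,1,j) \<in> S"
  shows "k' \<le> k - 2 * int i \<Longrightarrow> \<exists>a Y. (1,a,Y) \<in> S \<and> A + int i \<le> a \<and>
     (\<forall>x y. (1,x,y) \<in> S \<longrightarrow> y - (k - 2 * int i) * x \<le> Y - (k - 2 * int i) * a) \<and>
     (\<forall>x y. (1,x,y) \<in> S \<longrightarrow> y - (k - 2 * int i) * x = Y - (k - 2 * int i) * a \<longrightarrow> a \<le> x)"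
proof (induction i)
  case 0
  obtain a Y where aY: "(1,a,Y) \<in> S" "\<And>x y. (1,x,y) \<in> S \<Longrightarrow> y - k * x \<le> Y - k * a"
    "\<And>x y. (1,x,y) \<in> S \<Longrightarrow> y - k * x = Y - k * a \<Longrightarrow> a \<le> x"
    using leftmost_maximizer[OF vertex_systemD(1)[OF V] ne, of k] by blast
  then show ?case using A[OF aY(1)] by (intro exI[of _ a] exI[of _ Y]) auto
next
  case (Suc i)
  define j where "j = k - 2 * int i - 1"
  have jj: "k - 2 * int i = j + 1" "k - 2 * int (Suc i) = j - 1" unfolding j_def by auto
  obtain a Y where aY: "(1,a,Y) \<in> S" "A + int i \<le> a" "\<And>x y. (1,x,y) \<in> S \<Longrightarrow> y - (j+1) * x \<le> Y - (j+1) * a"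
    "\<And>x y. (1,x,y) \<in> S \<Longrightarrow> y - (j+1) * x = Y - (j+1) * a \<Longrightarrow> a \<le> x"
    using Suc unfolding jj by auto
  obtain a' Y' where aY': "(1,a',Y') \<in> S" "\<And>x y. (1,x,y) \<in> S \<Longrightarrow> y - (j-1) * x \<le> Y' - (j-1) * a'"
    "\<And>x y. (1,x,y) \<in> S \<Longrightarrow> y - (j-1) * x = Y' - (j-1) * a' \<Longrightarrow> a' \<le> x"
    using leftmost_maximizer[OF vertex_systemD(1)[OF V] ne, of "j - 1"] by blast
  have "(j + 1) * (a' - a) \<ge> Y' - Y" "(j - 1) * (a' - a) \<le> Y' - Y"
    using aY(3)[OF aY'(1)] aY'(2)[OF aY(1)] by (simp_all add: algebra_simps)
  then have "a \<le> a'" by (simp add: algebra_simps)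
  moreover have "a' \<noteq> a"
  proof
    assume eq: "a' = a"
    then have Y: "Y' = Y" using aY(3)[OF aY'(1)] aY'(2)[OF aY(1)] by simp
    have r: "(0,1,j+1) \<in> S" "(0,1,j) \<in> S" using sl[of "j+1"] sl[of j] Suc.prems unfolding j_def by simp_all
    show False
    proof (rule no_common_maximizer[OF V r aY(1)])
      fix x' y' assume h: "(1,x',y') \<in> S"
      show "y' - (j+1) * x' \<le> Y - (j+1) * a" by (rule aY(3)[OF h])
      show "y' - (j-1) * x' \<le> Y - (j-1) * a" using aY'(2)[OF h] unfolding Y eq .
      show "a \<le> x'" if "y' - (j+1) * x' = Y - (j+1) * a" by (rule aY(4)[OF h that])
    qed
  qed
  ultimately have ai: "A + int (Suc i) \<le> a'" using aY(2) by simp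
  have m: "\<forall>x y. (1,x,y) \<in> S \<longrightarrow> y - (j-1) * x \<le> Y' - (j-1) * a'"
    "\<forall>x y. (1,x,y) \<in> S \<longrightarrow> y - (j-1) * x = Y' - (j-1) * a' \<longrightarrow> a' \<le> x"
    using aY'(2,3) by blast+
  show ?case unfolding jj by (intro exI[of _ a'] exI[of _ Y'] conjI aY'(1) ai m)
qed

text \<open>The maximizer for slope k - 2 l lies in column A + l = t + 1 or beyond. The chord from
  (t,f) to it has at least this slope, so in column t + 1 it passes at or above the required point,
  and \<open>fill_segment\<close> applies.\<close>

lemma boundary_growth:
  assumes V: "vertex_system S" and A: "\<And>x y. (1,x,y) \<in> S \<Longrightarrow> A \<le> x"
    and sl: "\<And>j. k' \<le> j \<Longrightarrow> j \<le> k \<Longrightarrow> (0,1,j) \<in> S"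
    and l: "k' \<le> k - 2 * int l" "t + 1 = A + int l" and f: "(1,t,f) \<in> S" "(1,t+1,y0) \<in> S"
  shows "\<exists>y\<ge>f + (k - 2 * int l). (1,t+1,y) \<in> S"
proof (cases "f + (k - 2 * int l) \<le> y0")
  case True
  then show ?thesis using f by auto
next
  case False
  define j where "j = k - 2 * int l"
  have "\<exists>a Y. (1,a,Y) \<in> S \<and> A + int l \<le> a \<and>
     (\<forall>x y. (1,x,y) \<in> S \<longrightarrow> y - (k - 2 * int l) * x \<le> Y - (k - 2 * int l) * a) \<and>
     (\<forall>x y. (1,x,y) \<in> S \<longrightarrow> y - (k - 2 * int l) * x = Y - (k - 2 * int l) * a \<longrightarrow> a \<le> x)"
    by (rule maximizer_moves[where k' = k', OF V _ f(1) _ l(1)]) (fact A, fact sl)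
  then obtain a Y where aY: "(1,a,Y) \<in> S" "t + 1 \<le> a" "\<And>x y. (1,x,y) \<in> S \<Longrightarrow> y - j * x \<le> Y - j * a"
    unfolding j_def l(2) by blast
  define N where "N = a - t"
  have N: "1 \<le> N" using aY(2) unfolding N_def by simp
  have Y: "f + j * N \<le> Y" using aY(3)[OF f(1)] unfolding N_def by (simp add: algebra_simps)
  have "(1,t+1,f+j) \<in> S"
  proof (rule fill_segment[OF V f(2) f(2) f(1) aY(1), of N 0 N "N - 1" 1])
    show "(N - 1) * t + 1 * a = N * (t + 1)" unfolding N_def by (simp add: algebra_simps)
    show "N * (f + j) \<le> (N - 1) * f + 1 * Y" using Y by (simp add: algebra_simps)
    show "N * y0 + 0 * y0 \<le> N * (f + j)" using False N unfolding j_def by (simp add: mult_left_mono)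
  qed (use N in auto)
  then show ?thesis unfolding j_def by auto
qed

text \<open>Two points congruent modulo L + 1 differ by (L + 1) g times a primitive vector. As L + 1
  \<ge> 2, that vector is a root by \<open>planar_divided_difference\<close>, and the two points
  span a chord longer than L.\<close>

lemma card_height_one_le:
  assumes S: "crystal S" and L: "1 \<le> L"
    and ch: "\<And>p d n. (0,d) \<in> S \<Longrightarrow> (1,p) \<in> S \<Longrightarrow> (1,p + scale2 n d) \<in> S \<Longrightarrow> n \<le> L"
  shows "int (card {r. (1,r) \<in> S}) \<le> (L + 1) * (L + 1)"
proof -
  let ?R = "{r. (1,r) \<in> S}"
  define f where "f = (\<lambda>r::int\<times>int. (fst r mod (L+1), snd r mod (L+1)))"
  have inj: "inj_on f ?R"
  proof (rule inj_onI, rule ccontr)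
    fix r r' assume h: "r \<in> ?R" "r' \<in> ?R" "f r = f r'" "r \<noteq> r'"
    have "L + 1 dvd fst r' - fst r" "L + 1 dvd snd r' - snd r"
      using h(3) unfolding f_def by (auto simp: mod_eq_dvd_iff[symmetric])
    then obtain w1 w2 where w: "fst r' - fst r = (L + 1) * w1" "snd r' - snd r = (L + 1) * w2" by (elim dvdE)
    define g where "g = gcd w1 w2"
    have "w1 \<noteq> 0 \<or> w2 \<noteq> 0" using w h(4) by (auto simp: prod_eq_iff)
    then have g1: "1 \<le> g" unfolding g_def using gcd_pos_int[of w1 w2] by linarith
    obtain d1 d2 where d: "w1 = g * d1" "w2 = g * d2" "coprime d1 d2"
    proof -
      have "gcd w1 w2 \<noteq> 0" using g1 unfolding g_def by linarith
      from gcd_coprime_exists[OF this] show thesis using that unfolding g_def by (metis mult.commute)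
    qed
    have big: "L + 1 \<le> (L + 1) * g" using g1 L by simp
    have "r' = r + scale2 ((L + 1) * g) (d1,d2)" using w d by (cases r; cases r') (auto simp: algebra_simps)
    then have r': "(1,r + scale2 ((L + 1) * g) (d1,d2)) \<in> S" using h(2) by simp
    have two: "2 \<le> (L + 1) * g" using big L by linarith
    have "(0,d1,d2) \<in> S"
      by (rule planar_divided_difference[OF S _ _ r' two]) (use d h(1) in auto)
    then have "(L + 1) * g \<le> L" using ch r' h(1) by blast
    then show False using big by simp
  qed
  have "0 \<le> x mod (L+1) \<and> x mod (L+1) \<le> L" for x
    using pos_mod_bound[of "L+1" x] pos_mod_sign[of "L+1" x] L by linarith
  then have "f ` ?R \<subseteq> {0..L} \<times> {0..L}" unfolding f_def by auto
  then have "card ?R \<le> card ({0..L} \<times> {0..L})" using card_image[OF inj] card_mono[of "{0..L} \<times> {0..L}" "f ` ?R"] by simp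
  moreover have "int (card ({0..L} \<times> {0..L})) = (L + 1) * (L + 1)"
    using L by (simp add: card_cartesian_product)
  ultimately show ?thesis by linarith
qed

section \<open>The count around a longest chord\<close>

lemma long_chord_contradiction:
  assumes V: "vertex_system S" and m: "258 \<le> card {r. (0,r) \<in> S}" and L: "1 \<le> L"
    and ch: "\<And>p d n. (0,d) \<in> S \<Longrightarrow> (1,p) \<in> S \<Longrightarrow> (1,p + scale2 n d) \<in> S \<Longrightarrow> n \<le> L"
    and c0: "(1,0,0) \<in> S" "(1,0,L) \<in> S" and right: "(1,x0,y0) \<in> S" "32 \<le> x0"
  shows False
proof -
  note S = vertex_systemD(1)[OF V] and e = vertex_systemD(2,3)[OF V]
  let ?R = "{r. (1,r) \<in> S}"
  have finR: "finite ?R" by (rule finite_slice[OF S])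
  have sq: "int (card ?R) \<le> (L + 1) * (L + 1)" by (rule card_height_one_le[OF S L ch])
  \<comment> \<open>For L \<le> 10 there would be at most 11 * 11 = 121 points, fewer than
    129.\<close>
  have L11: "11 \<le> L"
  proof (rule ccontr)
    assume "\<not> 11 \<le> L"
    then have "(L + 1) * (L + 1) \<le> 11 * 11" using L by (intro mult_mono) auto
    then show False using sq vertex_system_width(2)[OF V m] by linarith
  qed
  define K where "K = {j. (0,1,j) \<in> S}"
  have "(\<lambda>j. (0::int,1::int,j)) ` K \<subseteq> S" unfolding K_def by auto
  then have "finite ((\<lambda>j. (0::int,1::int,j)) ` K)" using crystal_finite[OF S] finite_subset by blast
  then have finK: "finite K" by (rule finite_imageD) (simp add: inj_on_def)
  have neK: "K \<noteq> {}" using e(1) unfolding K_def by auto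
  define k k' where "k = Max K" and "k' = Min K"
  have kS: "(0,1,k) \<in> S" "(0,1,k') \<in> S"
    using Max_in[OF finK neK] Min_in[OF finK neK] unfolding k_def k'_def K_def by auto
  have kle: "k' \<le> j \<and> j \<le> k" if "(0,1,j) \<in> S" for j
    using that Max_ge[OF finK] Min_le[OF finK] unfolding k_def k'_def K_def by auto
  have kn: "(0,1,k+1) \<notin> S" "(0,1,k'-1) \<notin> S" using kle[of "k+1"] kle[of "k'-1"] by auto
  have sl: "(0,1,j) \<in> S" if "k' \<le> j" "j \<le> k" for j using slope_interval[OF S e(2) kS(2,1) that] .
  define C where "C = (\<lambda>t. {y. (1,t,y) \<in> S})"
  have finC: "finite (C t)" for t
  proof -
    have "(\<lambda>y. (t,y)) ` C t \<subseteq> ?R" unfolding C_def by auto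
    then have "finite ((\<lambda>y. (t,y)) ` C t)" using finR finite_subset by blast
    then show ?thesis by (rule finite_imageD) (simp add: inj_on_def)
  qed
  define hi lo where "hi = (\<lambda>t. Max (C t))" and "lo = (\<lambda>t. Min (C t))"
  have hl: "(1,t,hi t) \<in> S" "(1,t,lo t) \<in> S" if "C t \<noteq> {}" for t
    using Max_in[OF finC that] Min_in[OF finC that] unfolding hi_def lo_def C_def by auto
  have bd: "lo t \<le> y \<and> y \<le> hi t" if "(1,t,y) \<in> S" for t y
    using that Max_ge[OF finC] Min_le[OF finC] unfolding hi_def lo_def C_def by auto
  have hlL: "hi t - lo t \<le> L" if "C t \<noteq> {}" for t
    using ch[OF e(2) hl(2)[OF that], of "hi t - lo t"] hl(1)[OF that] by simp
  let ?X = "fst ` ?R"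
  have finX: "finite ?X" "?X \<noteq> {}" using finR c0 by auto
  define A where "A = Min ?X"
  have A: "A \<le> x" if "(1,x,y) \<in> S" for x y unfolding A_def using finX that by (intro Min_le) force+
  obtain ra rb where rab: "(1,ra) \<in> S" "(1,rb) \<in> S" "64 \<le> fst rb - fst ra" using vertex_system_width(1)[OF V m] by blast
  obtain rA where rA: "(1,rA) \<in> S" "fst rA = A" using Min_in[OF finX] unfolding A_def by force
  have ne: "C t \<noteq> {}" if "A \<le> t" "t \<le> A + 64" for t
  proof -
    have "A \<le> fst ra" using A[of "fst ra" "snd ra"] rab(1) by simp
    then have "t \<le> fst rb" using that rab(3) by linarith
    then show ?thesis
      using crystal_full[OF S e, of A "snd rA" "fst rb" "snd rb" t] rA rab(2) that(1) unfolding C_def by auto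
  qed
  \<comment> \<open>The next column begins at hi t + k' or lower and ends at lo t + k or
    higher.\<close>
  have meet: "k - k' \<le> hi t - lo t + (hi (t+1) - lo (t+1))" if t: "C t \<noteq> {}" "C (t+1) \<noteq> {}" for t
  proof -
    have "(1,t,hi t + 1) \<notin> S" "(1,t,lo t - 1) \<notin> S" using bd[of t "hi t + 1"] bd[of t "lo t - 1"] by auto
    then obtain y1 y2 where "y1 \<le> hi t + k'" "(1,t+1,y1) \<in> S" "lo t + k \<le> y2" "(1,t+1,y2) \<in> S"
      using crystal_columns_meet[OF S e(2) kS(2) kn(2) hl(1)[OF t(1)] _ hl(1)[OF t(2)]]
        columns_meet_upper[OF S e(2) kS(1) kn(1) hl(2)[OF t(1)] _ hl(1)[OF t(2)]] by blast
    then show ?thesis using bd[of "t+1" y1] bd[of "t+1" y2] by linarith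
  qed
  \<comment> \<open>A difference (2, 2 j) is twice the primitive vector (1, j), so j is the slope of
    a root.\<close>
  have slope: "k' \<le> j \<and> j \<le> k" if "(1,0,y) \<in> S" "(1,2,y + 2 * j) \<in> S" for y j
  proof -
    have "(0,1,j) \<in> S" by (rule planar_divided_difference[OF S, of "(1,j)" "(0,y)" 2]) (use that in auto)
    then show ?thesis by (rule kle)
  qed
  have c32: "31 * L \<le> 32 * k - 32 * k' + 62"
  proof -
    obtain y32 where y32: "(1,32,y32) \<in> S" using crystal_full[OF S e c0(1) right(1), of 32] right(2) by auto
    \<comment> \<open>Column 2 is a sixteenth of the way to column 32. The triangle spanned by the
      chord and (32,y32) covers y32 / 16 to (15 L + y32) / 16 there; v1 rounds the upper end down
      and v2 rounds the lower end up.\<close>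
    define v1 v2 where "v1 = (15 * L + y32) div 16" and "v2 = - ((- y32) div 16)"
    have v1: "16 * v1 \<le> 15 * L + y32" "15 * L + y32 \<le> 16 * v1 + 15" unfolding v1_def by linarith+
    have v2: "y32 \<le> 16 * v2" "16 * v2 \<le> y32 + 15" unfolding v2_def by linarith+
    have 1: "(1,2,v1) \<in> S"
      by (rule fill_segment[OF V c0(1) y32 c0(2) y32, of 15 1 16 15 1]) (use v1 L11 in auto)
    have 2: "(1,2,v2) \<in> S"
      by (rule fill_segment[OF V c0(1) y32 c0(2) y32, of 15 1 16 15 1]) (use v2 L11 in auto)
    have mid: "(1,0,1) \<in> S" "(1,0,L-1) \<in> S"
      using crystal_column_interval[OF S e(2) c0, of 1] crystal_column_interval[OF S e(2) c0, of "L-1"] L by auto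
    \<comment> \<open>If v1 is odd, it is compared with the point 1 of the chord instead of 0, at
      the cost of 1; below, L - 1 replaces L in the same way.\<close>
    have "v1 \<le> 2 * k + 1"
    proof (cases "even v1")
      case True
      then obtain j where "v1 = 2 * j" by (elim evenE)
      then show ?thesis using slope[OF c0(1), of j] 1 by auto
    next
      case False
      then obtain j where "v1 = 2 * j + 1" by (elim oddE)
      then show ?thesis using slope[OF mid(1), of j] 1 by (auto simp: add.commute)
    qed
    moreover have "L + 2 * k' - 1 \<le> v2"
    proof (cases "even (v2 - L)")
      case True
      then obtain j where "v2 - L = 2 * j" by (elim evenE)
      then have j: "v2 = L + 2 * j" by simp
      then show ?thesis using slope[OF c0(2), of j] 2 by auto
    next
      case False
      then obtain j where "v2 - L = 2 * j + 1" by (elim oddE)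
      then have j: "v2 = L - 1 + 2 * (j + 1)" by simp
      then show ?thesis using slope[OF mid(2), of "j + 1"] 2 by auto
    qed
    ultimately show ?thesis using v1 v2 by linarith
  qed
  have c9: "9 \<le> k - k'" using c32 L11 by linarith
  \<comment> \<open>The top rises by at least k - 2 l and the bottom, seen in the mirror, by at most
    k' + 2 l. Slopes k - 2 l must stay in the range of roots, and k - k' \<ge> 9 permits this up to
    l = 4.\<close>
  have grow: "hi (A + int l) - lo (A + int l) \<ge> hi (A + int l - 1) - lo (A + int l - 1) + (k - k') - 4 * int l"
    if l: "1 \<le> l" "l \<le> 4" for l :: nat
  proof -
    define t where "t = A + int l - 1"
    have t: "C t \<noteq> {}" "C (t+1) \<noteq> {}" "t + 1 = A + int l" using ne[of t] ne[of "t+1"] l unfolding t_def by auto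
    have 1: "\<exists>y\<ge>hi t + (k - 2 * int l). (1,t+1,y) \<in> S"
      by (rule boundary_growth[OF V _ _ _ t(3) hl(1)[OF t(1)] hl(1)[OF t(2)], where k' = k'])
         (use A sl l c9 in auto)
    have 2: "\<exists>y\<ge>- lo t + (- k' - 2 * int l). (1,t+1,y) \<in> reflect S"
      by (rule boundary_growth[OF vertex_system_reflect[OF V] _ _ _ t(3), where k' = "- k" and ?y0.0 = "- lo (t+1)"])
         (use A sl l c9 hl(2)[OF t(1)] hl(2)[OF t(2)] in auto)
    obtain y1 where y1: "hi t + (k - 2 * int l) \<le> y1" "(1,t+1,y1) \<in> S" using 1 by blast
    obtain y2 where y2: "- lo t + (- k' - 2 * int l) \<le> y2" "(1,t+1,-y2) \<in> S" using 2 by auto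
    show ?thesis using y1 y2 bd[OF y1(2)] bd[OF y2(2)] t(3) unfolding t_def by simp
  qed
  \<comment> \<open>The losses in three columns add up to 4 + 8 + 12 = 24.\<close>
  have "3 * k - 3 * k' \<le> L + 24"
  proof -
    have "hi (A+1) - lo (A+1) \<ge> hi A - lo A + (k - k') - 4" using grow[of 1] by simp
    moreover have "hi (A+2) - lo (A+2) \<ge> hi (A+1) - lo (A+1) + (k - k') - 8" using grow[of 2] by (simp add: add.commute)
    moreover have "hi (A+3) - lo (A+3) \<ge> hi (A+2) - lo (A+2) + (k - k') - 12" using grow[of 3] by (simp add: add.commute)
    moreover have "lo A \<le> hi A" using bd[OF hl(1)[OF ne[of A]]] by simp
    moreover have "hi (A+3) - lo (A+3) \<le> L" by (rule hlL[OF ne]) auto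
    ultimately show ?thesis by linarith
  qed
  \<comment> \<open>Eliminating k - k' leaves 61 L \<le> 954.\<close>
  then have L15: "L \<le> 15" using c32 by linarith
  have cardC: "int (card (C t)) = hi t - lo t + 1" if "C t \<noteq> {}" for t
  proof -
    have "C t = {lo t..hi t}"
    proof (intro set_eqI iffI)
      fix y assume "y \<in> C t"
      then have "(1,t,y) \<in> S" unfolding C_def by simp
      from bd[OF this] show "y \<in> {lo t..hi t}" by simp
    next
      fix y assume "y \<in> {lo t..hi t}"
      then have "(1,t,y) \<in> S"
        using crystal_column_interval[OF S e(2) hl(2)[OF that] hl(1)[OF that], of y] by simp
      then show "y \<in> C t" unfolding C_def by simp
    qed
    moreover have "lo t \<le> hi t" using bd[OF hl(1)[OF that]] by simp
    ultimately show ?thesis by simp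
  qed
  \<comment> \<open>A column of length n has n + 1 points, so two columns of total length 9 have
    11.\<close>
  have pair: "11 \<le> card (C (A + int (2 * i))) + card (C (A + int (2 * i + 1)))" if "i < 32" for i
  proof -
    have n: "C (A + int (2 * i)) \<noteq> {}" "C (A + int (2 * i) + 1) \<noteq> {}" by (rule ne; use that in simp)+
    have "9 \<le> hi (A + int (2*i)) - lo (A + int (2*i)) + (hi (A + int (2*i) + 1) - lo (A + int (2*i) + 1))"
      using meet[OF n] c9 by linarith
    then have "11 \<le> int (card (C (A + int (2 * i)))) + int (card (C (A + int (2 * i) + 1)))"
      using cardC[OF n(1)] cardC[OF n(2)] by linarith
    moreover have "A + int (2 * i + 1) = A + int (2 * i) + 1" by simp
    ultimately show ?thesis by (metis of_nat_add of_nat_le_iff of_nat_numeral)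
  qed
  have "352 = (\<Sum>i<32::nat. 11::nat)" by simp
  also have "\<dots> \<le> (\<Sum>i<32. card (C (A + int (2 * i))) + card (C (A + int (2 * i + 1))))"
    by (rule sum_mono) (use pair in auto)
  also have "\<dots> = (\<Sum>i<32. \<Sum>n\<in>{i*2..<i*2+2}. card (C (A + int n)))"
    by (intro sum.cong refl) (simp add: numeral_2_eq_2 mult.commute)
  also have "\<dots> = (\<Sum>n<32*2. card (C (A + int n)))" by (rule sum.nat_group)
  also have "\<dots> = card (SIGMA n:{..<64::nat}. C (A + int n))" using finC by (simp add: card_SigmaI)
  also have "\<dots> \<le> card ?R"
  proof (rule card_inj_on_le[OF _ _ finR])
    show "inj_on (\<lambda>(n,y). (A + int n, y)) (SIGMA n:{..<64::nat}. C (A + int n))" by (auto simp: inj_on_def)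
    show "(\<lambda>(n,y). (A + int n, y)) ` (SIGMA n:{..<64::nat}. C (A + int n)) \<subseteq> ?R" unfolding C_def by auto
  qed
  finally have "352 \<le> card ?R" .
  moreover have "(L + 1) * (L + 1) \<le> 16 * 16" using L L15 by (intro mult_mono) auto
  ultimately show False using sq by linarith
qed


theorem vertex_system_bound:
  assumes V: "vertex_system S"
  shows "card {r. (0,r) \<in> S} < 258"
proof (rule ccontr)
  assume "\<not> ?thesis"
  then have m: "258 \<le> card {r. (0,r) \<in> S}" by simp
  note S = vertex_systemD(1)[OF V] and e = vertex_systemD(2,3)[OF V]
  let ?Q = "{r. (0,r) \<in> S}" and ?R = "{r. (1,r) \<in> S}"
  define T where "T = {n. \<exists>p d. (0,d) \<in> S \<and> (1,p) \<in> S \<and> (1,p + scale2 n d) \<in> S}"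
  \<comment> \<open>Endpoints and direction determine n, so T is finite and a longest chord
    exists.\<close>
  define f where "f = (\<lambda>(p,q,d). if fst d \<noteq> 0 then fst (q - p) div fst d else snd (q - p) div (snd d::int))"
  have "T \<subseteq> f ` (?R \<times> ?R \<times> ?Q)"
  proof
    fix n assume "n \<in> T"
    then obtain p d where pd: "(0,d) \<in> S" "(1,p) \<in> S" "(1,p + scale2 n d) \<in> S" unfolding T_def by blast
    have "d \<noteq> 0" by (rule root_not_zero[OF S pd(1)])
    then have "n = f (p, p + scale2 n d, d)" unfolding f_def scale2_def by (cases d) (auto simp: zero_prod_def)
    then show "n \<in> f ` (?R \<times> ?R \<times> ?Q)" using pd by (intro image_eqI[of _ _ "(p, p + scale2 n d, d)"]) auto
  qed
  moreover have "finite (f ` (?R \<times> ?R \<times> ?Q))" using finite_slice[OF S] by blast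
  ultimately have finT: "finite T" by (rule finite_subset)
  obtain b1 p1 where c: "corner S (0,1) b1 p1" using corner_exists(1)[OF S e(1,2) e(2)] by blast
  have "1 \<in> T" using corner_step[OF V c] cornerD(1-3)[OF c] unfolding T_def by (metis (mono_tags, lifting) mem_Collect_eq scale2_1)
  define L where "L = Max T"
  have L1: "1 \<le> L" unfolding L_def using finT \<open>1 \<in> T\<close> by (intro Max_ge)
  have "L \<in> T" unfolding L_def using finT \<open>1 \<in> T\<close> by (intro Max_in) auto
  then obtain p d where pd: "(0,d) \<in> S" "(1,p) \<in> S" "(1,p + scale2 L d) \<in> S" unfolding T_def by blast
  have ch: "n \<le> L" if "(0,d) \<in> S" "(1,p) \<in> S" "(1,p + scale2 n d) \<in> S" for p d n
  proof -
    have "n \<in> T" unfolding T_def using that by blast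
    then show ?thesis unfolding L_def by (rule Max_ge[OF finT])
  qed
  obtain b p2 where "corner S d b p2" using corner_exists(1)[OF S e pd(1)] by blast
  note D = cornerD[OF this]
  \<comment> \<open>The longest chord becomes column 0, and b or - b points one column sideways, so
    neither side of the chord can extend 32 columns. Width 64 requires one of them to do so.\<close>
  have side: "x < 32" if ab: "a = b \<or> a = - b" and x: "(1,x,y) \<in> coords S p a d" for a x y
  proof (rule ccontr)
    assume x32: "\<not> x < 32"
    have aS: "(0,a) \<in> S" using ab D(2) crystal_sym[OF S D(2)] by auto
    have cr: "cross a d = 1 \<or> cross a d = - 1" using ab D(4) cross_commute[of b d] by auto
    have V': "vertex_system (coords S p a d)" by (rule vertex_system_coords[OF V cr aS pd(1)])
    have m': "258 \<le> card {r. (0,r) \<in> coords S p a d}" using m card_roots_coords[OF S cr, of p] by linarith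
    have ch': "n \<le> L" if h: "(0,d') \<in> coords S p a d" "(1,p') \<in> coords S p a d" "(1,p' + scale2 n d') \<in> coords S p a d" for p' d' n
    proof -
      obtain d1 d2 q1 q2 where dq: "d' = (d1,d2)" "p' = (q1,q2)" by (cases d'; cases p')
      have "(0, scale2 d1 a + scale2 d2 d) \<in> S" "(1, p + scale2 q1 a + scale2 q2 d) \<in> S"
        "(1, p + scale2 (q1 + n * d1) a + scale2 (q2 + n * d2) d) \<in> S" using h unfolding dq by simp_all
      moreover have "p + scale2 (q1 + n * d1) a + scale2 (q2 + n * d2) d =
        p + scale2 q1 a + scale2 q2 d + scale2 n (scale2 d1 a + scale2 d2 d)"
        by (cases p; cases a; cases d) (simp add: algebra_simps)
      ultimately show ?thesis using ch by metis
    qed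
    show False
      by (rule long_chord_contradiction[OF V' m' L1 ch' _ _ x]) (use pd x32 in auto)
  qed
  have cr: "cross b d = 1 \<or> cross b d = - 1" using D(4) cross_commute[of b d] by auto
  have V': "vertex_system (coords S p b d)" by (rule vertex_system_coords[OF V cr D(2) pd(1)])
  have m': "258 \<le> card {r. (0,r) \<in> coords S p b d}" using m card_roots_coords[OF S cr, of p] by linarith
  obtain r r' where r: "(1,r) \<in> coords S p b d" "(1,r') \<in> coords S p b d" "64 \<le> fst r' - fst r"
    using vertex_system_width(1)[OF V' m'] by blast
  have "fst r' < 32" using side[of b "fst r'" "snd r'"] r(2) by simp
  moreover have "- fst r < 32"
    using side[of "- b" "- fst r" "snd r"] r(1) by (cases r) (simp add: scale2_minus)
  ultimately show False using r(3) by linarith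
qed

section \<open>From arrangements to integral root systems\<close>

lemma crystallographicD:
  assumes "crystallographic A R"
  shows "finite R" "0 \<notin> R" "A = kerf ` R"
    "\<alpha> \<in> R \<Longrightarrow> - \<alpha> \<in> R" "\<alpha> \<in> R \<Longrightarrow> c *\<^sub>R \<alpha> \<in> R \<Longrightarrow> c *\<^sub>R \<alpha> = \<alpha> \<or> c *\<^sub>R \<alpha> = - \<alpha>"
    "K \<in> chambers A \<Longrightarrow> \<exists>B. independent B \<and> span B = UNIV \<and> K = {(\<Sum>v\<in>B. a v *\<^sub>R v) | a. \<forall>v\<in>B. 0 < a v}"
    "K \<in> chambers A \<Longrightarrow> \<beta> \<in> R \<Longrightarrow> \<exists>c::_ \<Rightarrow> int. \<beta> = (\<Sum>\<alpha>\<in>walls R K. of_int (c \<alpha>) *\<^sub>R \<alpha>)"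
proof -
  have line: "{c *\<^sub>R \<alpha> | c. True} \<inter> R = {\<alpha>, - \<alpha>}" if "\<alpha> \<in> R" for \<alpha>
    using assms that unfolding crystallographic_def by blast
  show "\<alpha> \<in> R \<Longrightarrow> - \<alpha> \<in> R" using line by blast
  show "\<alpha> \<in> R \<Longrightarrow> c *\<^sub>R \<alpha> \<in> R \<Longrightarrow> c *\<^sub>R \<alpha> = \<alpha> \<or> c *\<^sub>R \<alpha> = - \<alpha>" using line by blast
qed (use assms in \<open>unfold crystallographic_def simplicial_arrangement_def, blast+\<close>)

text \<open>A negative value at w would dominate the sum once w is given a large enough
  coefficient.\<close>

lemma nonneg_on_cone_generator:
  fixes \<alpha> :: "'a::euclidean_space"
  assumes B: "finite B" "w \<in> B" and n: "\<And>a. (\<And>v. v \<in> B \<Longrightarrow> 0 < a v) \<Longrightarrow> 0 \<le> \<alpha> \<bullet> (\<Sum>v\<in>B. a v *\<^sub>R v)"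
  shows "0 \<le> \<alpha> \<bullet> w"
proof (rule ccontr)
  assume neg: "\<not> 0 \<le> \<alpha> \<bullet> w"
  define s where "s = (\<Sum>v\<in>B - {w}. \<alpha> \<bullet> v)"
  define M where "M = (\<bar>s\<bar> + 1) / - (\<alpha> \<bullet> w)"
  have M: "0 < M" "M * (\<alpha> \<bullet> w) = - (\<bar>s\<bar> + 1)" using neg unfolding M_def by (auto simp: field_simps)
  define a where "a = (\<lambda>v. if v = w then M else 1)"
  have "0 \<le> \<alpha> \<bullet> (\<Sum>v\<in>B. a v *\<^sub>R v)" using M by (intro n) (simp add: a_def)
  also have "(\<Sum>v\<in>B. a v *\<^sub>R v) = M *\<^sub>R w + (\<Sum>v\<in>B - {w}. v)"
    using B by (simp add: sum.remove a_def)
  also have "\<alpha> \<bullet> \<dots> = M * (\<alpha> \<bullet> w) + s" by (simp add: inner_add_right inner_sum_right s_def)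
  finally show False using M by linarith
qed

lemma inner_zero_on_spanning:
  fixes \<alpha> :: "'a::euclidean_space"
  assumes "span B = UNIV" "\<And>w. w \<in> B \<Longrightarrow> \<alpha> \<bullet> w = 0"
  shows "\<alpha> = 0"
proof -
  have "\<alpha> \<in> span B" using assms(1) by simp
  then have "orthogonal \<alpha> \<alpha>" using assms(2) by (intro orthogonal_to_span[of \<alpha> B \<alpha>]) (auto simp: orthogonal_def)
  then show ?thesis by (simp add: orthogonal_def)
qed

text \<open>A form nonnegative on the cone vanishes at a point of the closure only if that point is
  combined from generators on which the form vanishes. These must span a plane, so exactly two
  generators are zeros of the wall.\<close>

lemma wall_generator:
  fixes \<alpha> :: "real^3"
  assumes B: "independent B" "span B = UNIV" and K: "K = {(\<Sum>v\<in>B. a v *\<^sub>R v) | a. \<forall>v\<in>B. 0 < a v}"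
    and w: "\<alpha> \<in> walls R K" "0 \<notin> R"
  shows "\<exists>w\<in>B. 0 < \<alpha> \<bullet> w \<and> (\<forall>w'\<in>B. w' \<noteq> w \<longrightarrow> \<alpha> \<bullet> w' = 0)"
proof -
  have finB: "finite B" using B(1) by (rule independent_imp_finite)
  have a: "\<alpha> \<noteq> 0" "\<And>x. x \<in> K \<Longrightarrow> 0 \<le> \<alpha> \<bullet> x" "span (kerf \<alpha> \<inter> closure K) = kerf \<alpha>"
    using w unfolding walls_def by auto
  have cB: "card B = 3" using dim_eq_card_independent[OF B(1)] B(2) dim_span[of B] by (simp add: dim_UNIV)
  have nn: "0 \<le> \<alpha> \<bullet> w" if "w \<in> B" for w
  proof (rule nonneg_on_cone_generator[OF finB that])
    fix c assume "\<And>v. v \<in> B \<Longrightarrow> (0::real) < c v"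
    then have "(\<Sum>v\<in>B. c v *\<^sub>R v) \<in> K" unfolding K by blast
    then show "0 \<le> \<alpha> \<bullet> (\<Sum>v\<in>B. c v *\<^sub>R v)" by (rule a(2))
  qed
  define Z where "Z = {w \<in> B. \<alpha> \<bullet> w = 0}"
  let ?r = "representation B"
  have lin: "linear (\<lambda>x. ?r x w)" for w
    by (rule linearI) (use B in \<open>simp_all add: representation_add representation_scale\<close>)
  have exp: "(\<Sum>v\<in>B. ?r x v *\<^sub>R v) = x" for x
    using B finB by (intro sum_representation_eq) auto
  have "K \<subseteq> {x. 0 \<le> ?r x w}" if "w \<in> B" for w
  proof
    fix x assume "x \<in> K"
    then obtain c where c: "x = (\<Sum>v\<in>B. c v *\<^sub>R v)" "\<forall>v\<in>B. 0 < c v" unfolding K by blast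
    have "?r x w = (\<Sum>v\<in>B. ?r (c v *\<^sub>R v) w)" unfolding c(1) by (rule linear_sum[OF lin])
    also have "\<dots> = (\<Sum>v\<in>B. c v *\<^sub>R ?r v w)" by (simp add: linear_scale[OF lin])
    also have "\<dots> = (\<Sum>v\<in>B. if v = w then c v else 0)"
      by (intro sum.cong refl) (use B in \<open>simp add: representation_basis\<close>)
    also have "\<dots> = c w" using finB that by simp
    finally show "x \<in> {x. 0 \<le> ?r x w}" using c(2) that by (simp add: less_imp_le)
  qed
  moreover have "closed {x. 0 \<le> ?r x w}" for w
    by (intro closed_Collect_le continuous_on_const linear_continuous_on) (use lin linear_conv_bounded_linear in blast)
  ultimately have cl: "0 \<le> ?r x w" if "x \<in> closure K" "w \<in> B" for x w
    using closure_minimal that by blast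
  have "kerf \<alpha> \<inter> closure K \<subseteq> span Z"
  proof
    fix x assume x: "x \<in> kerf \<alpha> \<inter> closure K"
    have "0 = \<alpha> \<bullet> (\<Sum>v\<in>B. ?r x v *\<^sub>R v)" using x unfolding exp kerf_def by simp
    also have "\<dots> = (\<Sum>v\<in>B. ?r x v * (\<alpha> \<bullet> v))" by (simp add: inner_sum_right)
    finally have vz: "\<forall>v\<in>B. ?r x v * (\<alpha> \<bullet> v) = 0"
      using sum_nonneg_eq_0_iff[OF finB, of "\<lambda>v. ?r x v * (\<alpha> \<bullet> v)"] cl x nn by auto
    have sp: "?r x v *\<^sub>R v \<in> span Z" if "v \<in> B" for v
    proof (cases "\<alpha> \<bullet> v = 0")
      case True
      then have "v \<in> Z" using that unfolding Z_def by simp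
      then show ?thesis by (intro span_scale span_base)
    next
      case False
      then have "?r x v = 0" using bspec[OF vz that] by simp
      then show ?thesis by (simp add: span_zero)
    qed
    have "(\<Sum>v\<in>B. ?r x v *\<^sub>R v) \<in> span Z" by (rule span_sum) (rule sp)
    then show "x \<in> span Z" by (simp only: exp)
  qed
  then have "span (kerf \<alpha> \<inter> closure K) \<subseteq> span Z" by (rule span_minimal) (rule subspace_span)
  then have "kerf \<alpha> \<subseteq> span Z" unfolding a(3) .
  then have "dim (kerf \<alpha>) \<le> card Z"
    by (rule dim_le_card) (use finB in \<open>simp add: Z_def\<close>)
  moreover have "dim (kerf \<alpha>) = 2" using dim_hyperplane[OF a(1)] unfolding kerf_def by simp
  ultimately have cZ: "2 \<le> card Z" by simp
  have ZB: "Z \<subseteq> B" unfolding Z_def by auto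
  have "Z \<noteq> B" using inner_zero_on_spanning[OF B(2)] a(1) unfolding Z_def by blast
  then have "card Z < 3" using ZB finB cB psubset_card_mono[of B Z] by auto
  then have "card (B - Z) = 1" using cZ ZB finB cB card_Diff_subset[of Z B] by (simp add: finite_subset)
  then obtain w where w: "B - Z = {w}" by (auto simp: card_1_singleton_iff)
  have "w \<in> B" "0 < \<alpha> \<bullet> w" using w nn[of w] unfolding Z_def by (auto simp: less_le)
  moreover have "\<alpha> \<bullet> w' = 0" if "w' \<in> B" "w' \<noteq> w" for w' using w that unfolding Z_def by auto
  ultimately show ?thesis by blast
qed

text \<open>Different walls are positive at different generators, as the roots are reduced, and the
  walls span because all roots are combinations of them; so there are three. Walls and generators
  are dual up to positive factors, and pairing a positive root with the generators shows that its
  coefficients are nonnegative.\<close>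

lemma chamber_basis:
  fixes R :: "(real^3) set"
  assumes C: "crystallographic A R" and sp: "\<And>x. (\<And>r. r \<in> R \<Longrightarrow> r \<bullet> x = 0) \<Longrightarrow> x = 0"
    and v: "\<And>r. r \<in> R \<Longrightarrow> r \<bullet> v \<noteq> 0"
  shows "\<exists>\<beta>1 \<beta>2 \<beta>3. \<beta>1 \<in> R \<and> \<beta>2 \<in> R \<and> \<beta>3 \<in> R \<and> 0 < \<beta>1 \<bullet> v \<and> 0 < \<beta>2 \<bullet> v \<and> 0 < \<beta>3 \<bullet> v \<and>
    (\<forall>x1 x2 x3::real. x1 *\<^sub>R \<beta>1 + x2 *\<^sub>R \<beta>2 + x3 *\<^sub>R \<beta>3 = 0 \<longrightarrow> x1 = 0 \<and> x2 = 0 \<and> x3 = 0) \<and>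
    (\<forall>r\<in>R. \<exists>c1 c2 c3::int. r = of_int c1 *\<^sub>R \<beta>1 + of_int c2 *\<^sub>R \<beta>2 + of_int c3 *\<^sub>R \<beta>3 \<and>
       (0 < r \<bullet> v \<longrightarrow> 0 \<le> c1 \<and> 0 \<le> c2 \<and> 0 \<le> c3))"
proof -
  note D = crystallographicD[OF C]
  define K where "K = connected_component_set (- \<Union>A) v"
  have vA: "v \<in> - \<Union>A" using v unfolding D(3) kerf_def by auto
  have KA: "K \<in> chambers A" unfolding K_def chambers_def using vA by blast
  have vK: "v \<in> K" unfolding K_def using vA by (simp add: connected_component_refl_eq)
  have conK: "connected K" unfolding K_def by (rule connected_connected_component)
  have Ksub: "K \<subseteq> - \<Union>A" unfolding K_def by (rule connected_component_subset)
  have pos: "0 < r \<bullet> x" if r: "r \<in> R" "0 < r \<bullet> v" and x: "x \<in> K" for r x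
  proof (rule ccontr)
    assume "\<not> 0 < r \<bullet> x"
    then obtain z where "z \<in> K" "r \<bullet> z = 0"
      using connected_ivt_hyperplane[OF conK x vK, of r 0] r(2) by auto
    then show False using Ksub r(1) unfolding D(3) kerf_def by blast
  qed
  obtain B where B: "independent B" "span B = UNIV" and K: "K = {(\<Sum>v\<in>B. a v *\<^sub>R v) | a. \<forall>v\<in>B. 0 < a v}"
    using D(6)[OF KA] by blast
  have finB: "finite B" using B(1) by (rule independent_imp_finite)
  have cB: "card B = 3" using dim_eq_card_independent[OF B(1)] B(2) dim_span[of B] by (simp add: dim_UNIV)
  have nn: "0 \<le> r \<bullet> w" if r: "r \<in> R" "0 < r \<bullet> v" and w: "w \<in> B" for r w
  proof (rule nonneg_on_cone_generator[OF finB w])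
    fix c assume "\<And>v. v \<in> B \<Longrightarrow> (0::real) < c v"
    then have "(\<Sum>v\<in>B. c v *\<^sub>R v) \<in> K" unfolding K by blast
    then show "0 \<le> r \<bullet> (\<Sum>v\<in>B. c v *\<^sub>R v)" using pos[OF r] by (simp add: less_imp_le)
  qed
  define W where "W = walls R K"
  have WR: "W \<subseteq> R" unfolding W_def walls_def by auto
  have finW: "finite W" using D(1) WR finite_subset by blast
  have "\<forall>\<alpha>\<in>W. \<exists>w. w \<in> B \<and> 0 < \<alpha> \<bullet> w \<and> (\<forall>w'\<in>B. w' \<noteq> w \<longrightarrow> \<alpha> \<bullet> w' = 0)"
    using wall_generator[OF B K _ D(2)] unfolding W_def by blast
  from bchoice[OF this] obtain j where
    j: "\<And>\<alpha>. \<alpha> \<in> W \<Longrightarrow> j \<alpha> \<in> B \<and> 0 < \<alpha> \<bullet> j \<alpha> \<and> (\<forall>w'\<in>B. w' \<noteq> j \<alpha> \<longrightarrow> \<alpha> \<bullet> w' = 0)" by blast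
  have inj: "inj_on j W"
  proof (rule inj_onI)
    fix \<alpha> \<alpha>' assume h: "\<alpha> \<in> W" "\<alpha>' \<in> W" "j \<alpha> = j \<alpha>'"
    define c where "c = (\<alpha> \<bullet> j \<alpha>) / (\<alpha>' \<bullet> j \<alpha>)"
    have p: "0 < \<alpha> \<bullet> j \<alpha>" "0 < \<alpha>' \<bullet> j \<alpha>" using j[OF h(1)] j[OF h(2)] h(3) by auto
    have "\<alpha> - c *\<^sub>R \<alpha>' = 0"
    proof (rule inner_zero_on_spanning[OF B(2)])
      fix w assume w: "w \<in> B"
      show "(\<alpha> - c *\<^sub>R \<alpha>') \<bullet> w = 0"
        using j[OF h(1)] j[OF h(2)] h(3) w p unfolding c_def by (cases "w = j \<alpha>") (auto simp: inner_diff_left)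
    qed
    then have e: "\<alpha> = c *\<^sub>R \<alpha>'" by simp
    then have "\<alpha> = \<alpha>' \<or> \<alpha> = - \<alpha>'" using D(5)[of \<alpha>' c] h WR by auto
    then show "\<alpha> = \<alpha>'" using p by auto
  qed
  have "card W \<le> card B" using j finB by (intro card_inj_on_le[OF inj]) auto
  moreover have "3 \<le> card W"
  proof -
    have "span W = UNIV"
    proof (rule ccontr)
      assume "span W \<noteq> UNIV"
      then obtain x where x: "x \<noteq> 0" "\<forall>y\<in>span W. x \<bullet> y = 0" using span_not_UNIV_orthogonal by blast
      have "r \<bullet> x = 0" if r: "r \<in> R" for r
      proof -
        obtain c :: "_ \<Rightarrow> int" where e: "r = (\<Sum>\<alpha>\<in>W. of_int (c \<alpha>) *\<^sub>R \<alpha>)"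
          using D(7)[OF KA r] unfolding W_def by blast
        have "r \<in> span W" unfolding e by (intro span_sum span_scale span_base)
        then show ?thesis using x(2) by (simp add: inner_commute)
      qed
      then show False using sp x(1) by blast
    qed
    then show ?thesis using dim_le_card[of UNIV W] finW by (simp add: dim_UNIV)
  qed
  ultimately have "card W = 3" using cB by simp
  then obtain \<beta>1 \<beta>2 \<beta>3 where W: "W = {\<beta>1, \<beta>2, \<beta>3}" and ne: "\<beta>1 \<noteq> \<beta>2" "\<beta>1 \<noteq> \<beta>3" "\<beta>2 \<noteq> \<beta>3"
    unfolding card_3_iff by blast
  have zero: "\<alpha> \<bullet> j \<alpha>' = 0" if "\<alpha> \<in> W" "\<alpha>' \<in> W" "\<alpha> \<noteq> \<alpha>'" for \<alpha> \<alpha>'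
    using j[OF that(1)] j[OF that(2)] inj_onD[OF inj _ that(1,2)] that(3) by metis
  have ev: "(x1 *\<^sub>R \<beta>1 + x2 *\<^sub>R \<beta>2 + x3 *\<^sub>R \<beta>3) \<bullet> j \<beta>1 = x1 * (\<beta>1 \<bullet> j \<beta>1)"
    "(x1 *\<^sub>R \<beta>1 + x2 *\<^sub>R \<beta>2 + x3 *\<^sub>R \<beta>3) \<bullet> j \<beta>2 = x2 * (\<beta>2 \<bullet> j \<beta>2)"
    "(x1 *\<^sub>R \<beta>1 + x2 *\<^sub>R \<beta>2 + x3 *\<^sub>R \<beta>3) \<bullet> j \<beta>3 = x3 * (\<beta>3 \<bullet> j \<beta>3)" for x1 x2 x3
    using zero ne unfolding W by (simp_all add: inner_add_left)
  have jp: "0 < \<beta>1 \<bullet> j \<beta>1" "0 < \<beta>2 \<bullet> j \<beta>2" "0 < \<beta>3 \<bullet> j \<beta>3" "j \<beta>1 \<in> B" "j \<beta>2 \<in> B" "j \<beta>3 \<in> B" using j unfolding W by auto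
  have ind: "x1 = 0 \<and> x2 = 0 \<and> x3 = 0" if "x1 *\<^sub>R \<beta>1 + x2 *\<^sub>R \<beta>2 + x3 *\<^sub>R \<beta>3 = 0" for x1 x2 x3
    using ev[of x1 x2 x3] jp(1-3) unfolding that by auto
  have ex: "\<exists>c1 c2 c3::int. r = of_int c1 *\<^sub>R \<beta>1 + of_int c2 *\<^sub>R \<beta>2 + of_int c3 *\<^sub>R \<beta>3 \<and>
       (0 < r \<bullet> v \<longrightarrow> 0 \<le> c1 \<and> 0 \<le> c2 \<and> 0 \<le> c3)" if r: "r \<in> R" for r
  proof -
    obtain c :: "_ \<Rightarrow> int" where "r = (\<Sum>\<alpha>\<in>W. of_int (c \<alpha>) *\<^sub>R \<alpha>)" using D(7)[OF KA r] unfolding W_def by blast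
    then have e: "r = of_int (c \<beta>1) *\<^sub>R \<beta>1 + of_int (c \<beta>2) *\<^sub>R \<beta>2 + of_int (c \<beta>3) *\<^sub>R \<beta>3"
      unfolding W using ne by (simp add: add.assoc)
    have "0 \<le> c \<beta>1 \<and> 0 \<le> c \<beta>2 \<and> 0 \<le> c \<beta>3" if p: "0 < r \<bullet> v"
    proof -
      have "0 \<le> of_int (c \<beta>1) * (\<beta>1 \<bullet> j \<beta>1)" "0 \<le> of_int (c \<beta>2) * (\<beta>2 \<bullet> j \<beta>2)" "0 \<le> of_int (c \<beta>3) * (\<beta>3 \<bullet> j \<beta>3)"
        using nn[OF r p jp(4)] nn[OF r p jp(5)] nn[OF r p jp(6)] ev[of "of_int (c \<beta>1)" "of_int (c \<beta>2)" "of_int (c \<beta>3)"]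
        unfolding e[symmetric] by simp_all
      then show ?thesis using jp(1-3) by (simp add: zero_le_mult_iff)
    qed
    then show ?thesis using e by blast
  qed
  have pv: "0 < \<beta> \<bullet> v" if "\<beta> \<in> W" for \<beta>
  proof -
    have "0 \<le> \<beta> \<bullet> v" using that vK unfolding W_def walls_def by auto
    then show ?thesis using v[of \<beta>] that WR by (auto simp: less_le)
  qed
  have bW: "\<beta>1 \<in> W" "\<beta>2 \<in> W" "\<beta>3 \<in> W" unfolding W by auto
  have all: "\<forall>x1 x2 x3::real. x1 *\<^sub>R \<beta>1 + x2 *\<^sub>R \<beta>2 + x3 *\<^sub>R \<beta>3 = 0 \<longrightarrow> x1 = 0 \<and> x2 = 0 \<and> x3 = 0"
    by (intro allI impI) (rule ind)
  show ?thesis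
    by (rule exI[of _ \<beta>1], rule exI[of _ \<beta>2], rule exI[of _ \<beta>3])
       (intro conjI subsetD[OF WR] pv bW all, rule ballI, erule ex)
qed

lemma roots_span:
  fixes R :: "(real^3) set"
  assumes C: "crystallographic A R" and rk: "arr_rank A = 3" and x: "\<And>r. r \<in> R \<Longrightarrow> r \<bullet> x = 0"
  shows "x = 0"
proof -
  have "3 - dim (\<Inter>A) = 3" using rk unfolding arr_rank_def by simp
  then have "dim (\<Inter>A) = 0" by arith
  then have "\<Inter>A \<subseteq> {0}" by simp
  moreover have "x \<in> \<Inter>A" using x crystallographicD(3)[OF C] unfolding kerf_def by auto
  ultimately show ?thesis by blast
qed

text \<open>The strict signs at v0 persist on an open set, which finitely many hyperplanes, being
  null sets, cannot cover.\<close>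

lemma generic_vector_near:
  fixes R :: "'a::euclidean_space set"
  assumes R: "finite R" "0 \<notin> R"
  obtains v where "\<And>r. r \<in> R \<Longrightarrow> r \<bullet> v \<noteq> 0" "\<And>r. r \<in> R \<Longrightarrow> 0 < r \<bullet> v0 \<Longrightarrow> 0 < r \<bullet> v"
proof -
  define U where "U = (\<Inter>r\<in>{r \<in> R. 0 < r \<bullet> v0}. {v. 0 < r \<bullet> v})"
  have "open U" unfolding U_def using R(1) by (intro open_INT) (auto simp: open_halfspace_gt)
  moreover have "v0 \<in> U" unfolding U_def by auto
  ultimately have "\<not> negligible U" using open_not_negligible by blast
  moreover have "negligible (\<Union>r\<in>R. {v. r \<bullet> v = 0})"
    using R by (intro negligible_Union) (auto intro!: negligible_hyperplane)
  ultimately obtain v where "v \<in> U" "v \<notin> (\<Union>r\<in>R. {v. r \<bullet> v = 0})" using negligible_subset by blast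
  then show thesis by (intro that[of v]) (auto simp: U_def)
qed

lemma dual_point:
  fixes a b c :: "real^3"
  assumes "\<And>x. a \<bullet> x = 0 \<Longrightarrow> b \<bullet> x = 0 \<Longrightarrow> c \<bullet> x = 0 \<Longrightarrow> x = 0"
  shows "\<exists>v. a \<bullet> v = p \<and> b \<bullet> v = q \<and> c \<bullet> v = r"
proof -
  define f :: "real^3 \<Rightarrow> real^3" where "f = (\<lambda>x. vector [a \<bullet> x, b \<bullet> x, c \<bullet> x])"
  have "linear f"
    by (rule linearI) (simp_all add: f_def vec_eq_iff forall_3 vector_3 inner_add_right)
  moreover have "inj f"
    using \<open>linear f\<close> assms by (auto simp: linear_injective_0 f_def vec_eq_iff forall_3 vector_3)
  ultimately have "surj f" by (rule linear_injective_imp_surjective) simp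
  then obtain v where "f v = vector [p, q, r]" by (metis surjD)
  then show ?thesis by (auto simp: f_def vec_eq_iff forall_3 vector_3)
qed

text \<open>Perturb v0 into a chamber that keeps its strict signs. If two walls of this chamber were
  nonzero at v0, every root vanishing at v0 would be a multiple of the third wall, and X would
  contain a plane.\<close>

lemma basis_through_line:
  fixes R :: "(real^3) set"
  assumes C: "crystallographic A R" and rk: "arr_rank A = 3"
    and X: "S \<subseteq> A" "X = \<Inter>S" "dim X = 1" and v0: "v0 \<in> X" "v0 \<noteq> 0"
  obtains \<gamma> a b where "\<gamma> \<in> R" "a \<in> R" "b \<in> R" "\<gamma> \<bullet> v0 \<noteq> 0" "a \<bullet> v0 = 0" "b \<bullet> v0 = 0"
    "\<And>x1 x2 x3::real. x1 *\<^sub>R \<gamma> + x2 *\<^sub>R a + x3 *\<^sub>R b = 0 \<Longrightarrow> x1 = 0 \<and> x2 = 0 \<and> x3 = 0"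
    "\<And>r. r \<in> R \<Longrightarrow> \<exists>c1 c2 c3::int. r = of_int c1 *\<^sub>R \<gamma> + of_int c2 *\<^sub>R a + of_int c3 *\<^sub>R b"
proof -
  note D = crystallographicD[OF C]
  obtain v where v: "\<And>r. r \<in> R \<Longrightarrow> r \<bullet> v \<noteq> 0" and near: "\<And>r. r \<in> R \<Longrightarrow> 0 < r \<bullet> v0 \<Longrightarrow> 0 < r \<bullet> v"
    by (rule generic_vector_near[OF D(1,2), of v0]) blast
  obtain \<beta>1 \<beta>2 \<beta>3 where \<beta>: "\<beta>1 \<in> R" "\<beta>2 \<in> R" "\<beta>3 \<in> R" and bp: "0 < \<beta>1 \<bullet> v" "0 < \<beta>2 \<bullet> v" "0 < \<beta>3 \<bullet> v"
    and ind: "\<And>x1 x2 x3::real. x1 *\<^sub>R \<beta>1 + x2 *\<^sub>R \<beta>2 + x3 *\<^sub>R \<beta>3 = 0 \<Longrightarrow> x1 = 0 \<and> x2 = 0 \<and> x3 = 0"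
    and ex: "\<And>r. r \<in> R \<Longrightarrow> \<exists>c1 c2 c3::int. r = of_int c1 *\<^sub>R \<beta>1 + of_int c2 *\<^sub>R \<beta>2 + of_int c3 *\<^sub>R \<beta>3 \<and>
       (0 < r \<bullet> v \<longrightarrow> 0 \<le> c1 \<and> 0 \<le> c2 \<and> 0 \<le> c3)"
    using chamber_basis[OF C roots_span[OF C rk] v] by metis
  have nn: "0 \<le> \<beta> \<bullet> v0" if b: "\<beta> \<in> R" "0 < \<beta> \<bullet> v" for \<beta>
    using near[OF D(4)[OF b(1)]] b(2) by force
  have n0: "\<not> (\<beta>1 \<bullet> v0 = 0 \<and> \<beta>2 \<bullet> v0 = 0 \<and> \<beta>3 \<bullet> v0 = 0)"
  proof
    assume h: "\<beta>1 \<bullet> v0 = 0 \<and> \<beta>2 \<bullet> v0 = 0 \<and> \<beta>3 \<bullet> v0 = 0"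
    have "r \<bullet> v0 = 0" if r: "r \<in> R" for r
      using ex[OF r] h by (auto simp: inner_add_left)
    then show False using roots_span[OF C rk] v0(2) by blast
  qed
  have two: "\<beta> \<bullet> v0 = 0 \<or> \<beta>' \<bullet> v0 = 0"
    if b: "\<beta> \<in> R" "\<beta>' \<in> R" "\<beta>'' \<in> R" and p: "0 < \<beta> \<bullet> v" "0 < \<beta>' \<bullet> v" "0 < \<beta>'' \<bullet> v"
    and e: "\<And>r. r \<in> R \<Longrightarrow> 0 < r \<bullet> v \<Longrightarrow>
      \<exists>c1 c2 c3::int. r = of_int c1 *\<^sub>R \<beta> + of_int c2 *\<^sub>R \<beta>' + of_int c3 *\<^sub>R \<beta>'' \<and> 0 \<le> c1 \<and> 0 \<le> c2 \<and> 0 \<le> c3"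
    for \<beta> \<beta>' \<beta>''
  proof (rule ccontr)
    assume n: "\<not> ?thesis"
    then have np: "0 < \<beta> \<bullet> v0" "0 < \<beta>' \<bullet> v0" using nn b p by (auto simp: less_le)
    have pos: "\<exists>c::real. r = c *\<^sub>R \<beta>''" if r: "r \<in> R" "r \<bullet> v0 = 0" "0 < r \<bullet> v" for r
    proof -
      obtain c1 c2 c3 :: int where c: "r = of_int c1 *\<^sub>R \<beta> + of_int c2 *\<^sub>R \<beta>' + of_int c3 *\<^sub>R \<beta>''"
        "0 \<le> c1" "0 \<le> c2" "0 \<le> c3" using e[OF r(1,3)] by blast
      have "of_int c1 * (\<beta> \<bullet> v0) + of_int c2 * (\<beta>' \<bullet> v0) + of_int c3 * (\<beta>'' \<bullet> v0) = 0"
        using r(2) unfolding c(1) by (simp add: inner_add_left)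
      moreover have "0 \<le> of_int c1 * (\<beta> \<bullet> v0)" "0 \<le> of_int c2 * (\<beta>' \<bullet> v0)" "0 \<le> of_int c3 * (\<beta>'' \<bullet> v0)"
        using c np nn[OF b(3) p(3)] by simp_all
      ultimately have "of_int c1 * (\<beta> \<bullet> v0) = 0" "of_int c2 * (\<beta>' \<bullet> v0) = 0" by linarith+
      then have "c1 = 0" "c2 = 0" using np by auto
      then show ?thesis using c(1) by auto
    qed
    have all: "\<exists>c::real. r = c *\<^sub>R \<beta>''" if r: "r \<in> R" "r \<bullet> v0 = 0" for r
    proof (cases "0 < r \<bullet> v")
      case True then show ?thesis using pos r by blast
    next
      case False
      then have "0 < (- r) \<bullet> v" using v[OF r(1)] by auto
      then obtain c :: real where "- r = c *\<^sub>R \<beta>''" using pos[of "- r"] D(4)[OF r(1)] r(2) by auto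
      then have "r = (- c) *\<^sub>R \<beta>''" by (metis minus_minus scaleR_minus_left)
      then show ?thesis by blast
    qed
    have "kerf \<beta>'' \<subseteq> X"
    proof
      fix x assume x: "x \<in> kerf \<beta>''"
      have "x \<in> H" if H: "H \<in> S" for H
      proof -
        obtain r where r: "r \<in> R" "H = kerf r" using H X(1) D(3) by blast
        have "r \<bullet> v0 = 0" using v0(1) X(2) H r(2) unfolding kerf_def by auto
        then obtain c :: real where "r = c *\<^sub>R \<beta>''" using all r(1) by blast
        then show ?thesis using x r(2) unfolding kerf_def by simp
      qed
      then show "x \<in> X" using X(2) by blast
    qed
    then have "dim (kerf \<beta>'') \<le> 1" using dim_subset X(3) by metis
    moreover have "\<beta>'' \<noteq> 0" using b(3) D(2) by blast
    ultimately show False using dim_hyperplane[of \<beta>''] unfolding kerf_def by simp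
  qed
  have ex0: "\<exists>c1 c2 c3::int. r = of_int c1 *\<^sub>R \<beta>1 + of_int c2 *\<^sub>R \<beta>2 + of_int c3 *\<^sub>R \<beta>3 \<and> 0 \<le> c1 \<and> 0 \<le> c2 \<and> 0 \<le> c3"
    if "r \<in> R" "0 < r \<bullet> v" for r
    using ex[OF that(1)] that(2) by simp
  have t12: "\<beta>1 \<bullet> v0 = 0 \<or> \<beta>2 \<bullet> v0 = 0" by (rule two[OF \<beta> bp ex0])
  have t13: "\<beta>1 \<bullet> v0 = 0 \<or> \<beta>3 \<bullet> v0 = 0"
  proof (rule two[OF \<beta>(1,3,2) bp(1,3,2)])
    fix r assume "r \<in> R" "0 < r \<bullet> v"
    from ex0[OF this] obtain c1 c2 c3 :: int
      where "r = of_int c1 *\<^sub>R \<beta>1 + of_int c2 *\<^sub>R \<beta>2 + of_int c3 *\<^sub>R \<beta>3" "0 \<le> c1" "0 \<le> c2" "0 \<le> c3" by blast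
    then show "\<exists>c1 c2 c3::int. r = of_int c1 *\<^sub>R \<beta>1 + of_int c2 *\<^sub>R \<beta>3 + of_int c3 *\<^sub>R \<beta>2 \<and> 0 \<le> c1 \<and> 0 \<le> c2 \<and> 0 \<le> c3"
      by (rule_tac exI[of _ c1], rule_tac exI[of _ c3], rule_tac exI[of _ c2]) simp
  qed
  have t23: "\<beta>2 \<bullet> v0 = 0 \<or> \<beta>3 \<bullet> v0 = 0"
  proof (rule two[OF \<beta>(2,3,1) bp(2,3,1)])
    fix r assume "r \<in> R" "0 < r \<bullet> v"
    from ex0[OF this] obtain c1 c2 c3 :: int
      where "r = of_int c1 *\<^sub>R \<beta>1 + of_int c2 *\<^sub>R \<beta>2 + of_int c3 *\<^sub>R \<beta>3" "0 \<le> c1" "0 \<le> c2" "0 \<le> c3" by blast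
    then show "\<exists>c1 c2 c3::int. r = of_int c1 *\<^sub>R \<beta>2 + of_int c2 *\<^sub>R \<beta>3 + of_int c3 *\<^sub>R \<beta>1 \<and> 0 \<le> c1 \<and> 0 \<le> c2 \<and> 0 \<le> c3"
      by (rule_tac exI[of _ c2], rule_tac exI[of _ c3], rule_tac exI[of _ c1]) simp
  qed
  consider "\<beta>1 \<bullet> v0 \<noteq> 0" "\<beta>2 \<bullet> v0 = 0" "\<beta>3 \<bullet> v0 = 0" | "\<beta>2 \<bullet> v0 \<noteq> 0" "\<beta>1 \<bullet> v0 = 0" "\<beta>3 \<bullet> v0 = 0"
    | "\<beta>3 \<bullet> v0 \<noteq> 0" "\<beta>1 \<bullet> v0 = 0" "\<beta>2 \<bullet> v0 = 0" using t12 t13 t23 n0 by blast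
  then show thesis
  proof cases
    case 1
    show ?thesis
    proof (rule that[OF \<beta> 1 ind])
      fix r assume "r \<in> R"
      from ex[OF this] show "\<exists>c1 c2 c3::int. r = of_int c1 *\<^sub>R \<beta>1 + of_int c2 *\<^sub>R \<beta>2 + of_int c3 *\<^sub>R \<beta>3"
        by (elim exE conjE) (intro exI)
    qed
  next
    case 2
    show ?thesis
    proof (rule that[OF \<beta>(2,1,3) 2])
      fix x1 x2 x3 :: real assume "x1 *\<^sub>R \<beta>2 + x2 *\<^sub>R \<beta>1 + x3 *\<^sub>R \<beta>3 = 0"
      then show "x1 = 0 \<and> x2 = 0 \<and> x3 = 0" using ind[of x2 x1 x3] by (simp add: ac_simps)
    next
      fix r assume r: "r \<in> R"
      obtain c1 c2 c3 :: int where "r = of_int c1 *\<^sub>R \<beta>1 + of_int c2 *\<^sub>R \<beta>2 + of_int c3 *\<^sub>R \<beta>3"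
        using ex[OF r] by (elim exE conjE) simp
      then show "\<exists>c1 c2 c3::int. r = of_int c1 *\<^sub>R \<beta>2 + of_int c2 *\<^sub>R \<beta>1 + of_int c3 *\<^sub>R \<beta>3"
        by (rule_tac exI[of _ c2], rule_tac exI[of _ c1], rule_tac exI[of _ c3]) simp
    qed
  next
    case 3
    show ?thesis
    proof (rule that[OF \<beta>(3,1,2) 3])
      fix x1 x2 x3 :: real assume "x1 *\<^sub>R \<beta>3 + x2 *\<^sub>R \<beta>1 + x3 *\<^sub>R \<beta>2 = 0"
      then show "x1 = 0 \<and> x2 = 0 \<and> x3 = 0" using ind[of x2 x3 x1] by (simp add: ac_simps)
    next
      fix r assume r: "r \<in> R"
      obtain c1 c2 c3 :: int where "r = of_int c1 *\<^sub>R \<beta>1 + of_int c2 *\<^sub>R \<beta>2 + of_int c3 *\<^sub>R \<beta>3"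
        using ex[OF r] by (elim exE conjE) simp
      then show "\<exists>c1 c2 c3::int. r = of_int c1 *\<^sub>R \<beta>3 + of_int c2 *\<^sub>R \<beta>1 + of_int c3 *\<^sub>R \<beta>2"
        by (rule_tac exI[of _ c3], rule_tac exI[of _ c1], rule_tac exI[of _ c2]) simp
    qed
  qed
qed

section \<open>Integer coordinates for the roots\<close>

definition lattice_point :: "real^3 \<Rightarrow> real^3 \<Rightarrow> real^3 \<Rightarrow> v3 \<Rightarrow> real^3" where
  "lattice_point g a b = (\<lambda>(h, x, y). of_int h *\<^sub>R g + of_int x *\<^sub>R a + of_int y *\<^sub>R b)"

lemma lattice_point_lin:
  "lattice_point g a b (z + z') = lattice_point g a b z + lattice_point g a b z'"
  "lattice_point g a b (- z) = - lattice_point g a b z"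
  "lattice_point g a b (scale3 n z) = of_int n *\<^sub>R lattice_point g a b z"
  by (cases z; cases z'; simp add: lattice_point_def algebra_simps)+

lemma lattice_point_inj:
  assumes "\<And>x1 x2 x3::real. x1 *\<^sub>R g + x2 *\<^sub>R a + x3 *\<^sub>R b = 0 \<Longrightarrow> x1 = 0 \<and> x2 = 0 \<and> x3 = 0"
    and "lattice_point g a b z = lattice_point g a b z'"
  shows "z = z'"
proof -
  obtain h x y h' x' y' where z: "z = (h,x,y)" "z' = (h',x',y')" by (cases z; cases z')
  have "(of_int h - of_int h') *\<^sub>R g + (of_int x - of_int x') *\<^sub>R a + (of_int y - of_int y') *\<^sub>R b = 0"
    using assms(2) unfolding z lattice_point_def by (simp add: algebra_simps)
  from assms(1)[OF this] show ?thesis unfolding z by simp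
qed

text \<open>An integral form is evaluation at the vector v that has the prescribed inner products
  with g, a and b. Generic forms thus correspond to points of chambers, where
  \<open>chamber_basis\<close> applies.\<close>

lemma crystal_coordinates:
  fixes R :: "(real^3) set"
  assumes C: "crystallographic A R" and rk: "arr_rank A = 3" and gR: "g \<in> R" "a \<in> R" "b \<in> R"
    and ind: "\<And>x1 x2 x3::real. x1 *\<^sub>R g + x2 *\<^sub>R a + x3 *\<^sub>R b = 0 \<Longrightarrow> x1 = 0 \<and> x2 = 0 \<and> x3 = 0"
    and ex: "\<And>r. r \<in> R \<Longrightarrow> \<exists>c1 c2 c3::int. r = of_int c1 *\<^sub>R g + of_int c2 *\<^sub>R a + of_int c3 *\<^sub>R b"
  shows "crystal {z. lattice_point g a b z \<in> R}"
proof -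
  note D = crystallographicD[OF C]
  let ?T = "lattice_point g a b"
  let ?S = "{z. ?T z \<in> R}"
  have inj: "z = z'" if "?T z = ?T z'" for z z' by (rule lattice_point_inj[OF ind that])
  have surj: "\<exists>z. r = ?T z" if r: "r \<in> R" for r
  proof -
    obtain c1 c2 c3 :: int where "r = of_int c1 *\<^sub>R g + of_int c2 *\<^sub>R a + of_int c3 *\<^sub>R b" using ex[OF r] by blast
    then show ?thesis by (intro exI[of _ "(c1,c2,c3)"]) (simp add: lattice_point_def)
  qed
  have "finite (?T -` R)" by (rule finite_vimageI[OF D(1)]) (use inj in \<open>auto simp: inj_on_def\<close>)
  then have "finite ?S" by (simp add: vimage_def)
  moreover have "0 \<notin> ?S" using D(2) by (simp add: lattice_point_def zero_prod_def)
  moreover have "- r \<in> ?S" if "r \<in> ?S" for r using that D(4) by (simp add: lattice_point_lin)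
  moreover have "s = r \<or> s = - r"
    if h: "r \<in> ?S" "s \<in> ?S" "m \<noteq> 0" "scale3 m r = scale3 n s" for r s m n
  proof -
    have e: "of_int m *\<^sub>R ?T r = of_int n *\<^sub>R ?T s" using arg_cong[OF h(4), of ?T] by (simp add: lattice_point_lin)
    have "?T r = (1 / of_int m) *\<^sub>R (of_int m *\<^sub>R ?T r)" using h(3) by simp
    also have "\<dots> = (of_int n / of_int m) *\<^sub>R ?T s" unfolding e by simp
    finally have f: "?T r = (of_int n / of_int m) *\<^sub>R ?T s" .
    then have "?T r = ?T s \<or> ?T r = - ?T s" using D(5)[of "?T s" "of_int n / of_int m"] h(1,2) by auto
    then have "?T s = ?T r \<or> ?T s = ?T (- r)" by (auto simp: lattice_point_lin)
    then show ?thesis using inj by blast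
  qed
  moreover have "\<exists>b1 b2 b3 c1 c2 c3. posbasis ?S (\<lambda>r. 0 < u r) b1 b2 b3 c1 c2 c3"
    if u: "linform u" "\<forall>r\<in>?S. u r \<noteq> 0" for u
  proof -
    have van: "x = 0" if x: "g \<bullet> x = 0" "a \<bullet> x = 0" "b \<bullet> x = 0" for x
    proof (rule roots_span[OF C rk])
      fix r assume "r \<in> R"
      then show "r \<bullet> x = 0" using ex x by (force simp: inner_add_left)
    qed
    obtain v where v: "g \<bullet> v = of_int (u (1,0,0))" "a \<bullet> v = of_int (u (0,1,0))" "b \<bullet> v = of_int (u (0,0,1))"
      using dual_point[OF van] by blast
    have uv: "?T z \<bullet> v = of_int (u z)" for z
    proof -
      obtain h x y where z: "z = (h,x,y)" by (cases z)
      show ?thesis unfolding z lattice_point_def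
        using linform_coords[OF u(1), of h x y] v by (simp add: inner_add_left)
    qed
    have "r \<bullet> v \<noteq> 0" if r: "r \<in> R" for r using surj[OF r] u(2) uv r by auto
    then obtain \<beta>1 \<beta>2 \<beta>3 where \<beta>: "\<beta>1 \<in> R" "\<beta>2 \<in> R" "\<beta>3 \<in> R"
      and ind': "\<And>x1 x2 x3::real. x1 *\<^sub>R \<beta>1 + x2 *\<^sub>R \<beta>2 + x3 *\<^sub>R \<beta>3 = 0 \<Longrightarrow> x1 = 0 \<and> x2 = 0 \<and> x3 = 0"
      and ex': "\<And>r. r \<in> R \<Longrightarrow> \<exists>c1 c2 c3::int. r = of_int c1 *\<^sub>R \<beta>1 + of_int c2 *\<^sub>R \<beta>2 + of_int c3 *\<^sub>R \<beta>3 \<and>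
       (0 < r \<bullet> v \<longrightarrow> 0 \<le> c1 \<and> 0 \<le> c2 \<and> 0 \<le> c3)"
      using chamber_basis[OF C roots_span[OF C rk]] by metis
    obtain b1 b2 b3 where b: "\<beta>1 = ?T b1" "\<beta>2 = ?T b2" "\<beta>3 = ?T b3" using surj \<beta> by meson
    obtain g1 g2 g3 :: int where g: "g = of_int g1 *\<^sub>R \<beta>1 + of_int g2 *\<^sub>R \<beta>2 + of_int g3 *\<^sub>R \<beta>3" using ex'[OF gR(1)] by blast
    obtain a1 a2 a3 :: int where a: "a = of_int a1 *\<^sub>R \<beta>1 + of_int a2 *\<^sub>R \<beta>2 + of_int a3 *\<^sub>R \<beta>3" using ex'[OF gR(2)] by blast
    obtain d1 d2 d3 :: int where d: "b = of_int d1 *\<^sub>R \<beta>1 + of_int d2 *\<^sub>R \<beta>2 + of_int d3 *\<^sub>R \<beta>3" using ex'[OF gR(3)] by blast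
    \<comment> \<open>The base change from g, a, b to the walls, extended to the whole
      lattice.\<close>
    define c1 c2 c3 where "c1 = (\<lambda>(h,x,y). g1 * h + a1 * x + d1 * y)" and "c2 = (\<lambda>(h,x,y). g2 * h + a2 * x + d2 * y)"
      and "c3 = (\<lambda>(h,x,y). g3 * h + a3 * x + d3 * y)"
    have lc: "linform c1" "linform c2" "linform c3" unfolding c1_def c2_def c3_def by (rule linformI; simp)+
    have T: "?T z = of_int (c1 z) *\<^sub>R \<beta>1 + of_int (c2 z) *\<^sub>R \<beta>2 + of_int (c3 z) *\<^sub>R \<beta>3" for z
    proof -
      obtain h x y where z: "z = (h,x,y)" by (cases z)
      have "?T z = of_int h *\<^sub>R (of_int g1 *\<^sub>R \<beta>1 + of_int g2 *\<^sub>R \<beta>2 + of_int g3 *\<^sub>R \<beta>3)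
        + of_int x *\<^sub>R (of_int a1 *\<^sub>R \<beta>1 + of_int a2 *\<^sub>R \<beta>2 + of_int a3 *\<^sub>R \<beta>3)
        + of_int y *\<^sub>R (of_int d1 *\<^sub>R \<beta>1 + of_int d2 *\<^sub>R \<beta>2 + of_int d3 *\<^sub>R \<beta>3)"
        unfolding z lattice_point_def g[symmetric] a[symmetric] d[symmetric] by simp
      also have "\<dots> = of_int (c1 z) *\<^sub>R \<beta>1 + of_int (c2 z) *\<^sub>R \<beta>2 + of_int (c3 z) *\<^sub>R \<beta>3"
        unfolding z c1_def c2_def c3_def by (simp add: algebra_simps)
      finally show ?thesis .
    qed
    have uniq: "x1 = y1 \<and> x2 = y2 \<and> x3 = y3"
      if "x1 *\<^sub>R \<beta>1 + x2 *\<^sub>R \<beta>2 + x3 *\<^sub>R \<beta>3 = y1 *\<^sub>R \<beta>1 + y2 *\<^sub>R \<beta>2 + y3 *\<^sub>R \<beta>3" for x1 x2 x3 y1 y2 y3 :: real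
    proof -
      have "(x1 - y1) *\<^sub>R \<beta>1 + (x2 - y2) *\<^sub>R \<beta>2 + (x3 - y3) *\<^sub>R \<beta>3 = 0" using that by (simp add: algebra_simps)
      from ind'[OF this] show ?thesis by simp
    qed
    have del: "c1 b1 = 1" "c2 b1 = 0" "c3 b1 = 0" "c1 b2 = 0" "c2 b2 = 1" "c3 b2 = 0" "c1 b3 = 0" "c2 b3 = 0" "c3 b3 = 1"
      using uniq[of "of_int (c1 b1)" "of_int (c2 b1)" "of_int (c3 b1)" 1 0 0] T[of b1]
        uniq[of "of_int (c1 b2)" "of_int (c2 b2)" "of_int (c3 b2)" 0 1 0] T[of b2]
        uniq[of "of_int (c1 b3)" "of_int (c2 b3)" "of_int (c3 b3)" 0 0 1] T[of b3] unfolding b[symmetric] by auto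
    have "z = scale3 (c1 z) b1 + scale3 (c2 z) b2 + scale3 (c3 z) b3" for z
      by (rule inj) (simp only: lattice_point_lin b[symmetric], rule T)
    then have fr: "frame b1 b2 b3 c1 c2 c3" unfolding frame_def using lc del by blast
    have "0 \<le> c1 r \<and> 0 \<le> c2 r \<and> 0 \<le> c3 r" if r: "r \<in> ?S" "0 < u r" for r
    proof -
      have p: "0 < ?T r \<bullet> v" using r(2) uv by simp
      obtain k1 k2 k3 :: int where k: "?T r = of_int k1 *\<^sub>R \<beta>1 + of_int k2 *\<^sub>R \<beta>2 + of_int k3 *\<^sub>R \<beta>3"
        "0 \<le> k1" "0 \<le> k2" "0 \<le> k3" using ex'[of "?T r"] r(1) p by blast
      then show ?thesis using uniq[of "of_int (c1 r)" "of_int (c2 r)" "of_int (c3 r)" "of_int k1" "of_int k2" "of_int k3"] T[of r] by simp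
    qed
    then have "posbasis ?S (\<lambda>r. 0 < u r) b1 b2 b3 c1 c2 c3" unfolding posbasis_def using fr \<beta> b by simp
    then show ?thesis by blast
  qed
  ultimately show ?thesis unfolding crystal_def by blast
qed

text \<open>V splits into the line of v0 and the kernel of \<pi>. This kernel is the only hyperplane
  that avoids v0; any other is the sum of the line and its trace on the kernel.\<close>

lemma reducible_if_separated:
  fixes R :: "(real^3) set"
  assumes C: "crystallographic A R" and p: "\<pi> \<in> R" "\<pi> \<bullet> v0 \<noteq> 0"
    and sep: "\<And>r. r \<in> R \<Longrightarrow> r \<bullet> v0 = 0 \<or> r = \<pi> \<or> r = - \<pi>"
  shows "reducible_arrangement A"
proof -
  note D = crystallographicD[OF C]
  let ?V1 = "span {v0}" and ?V2 = "kerf \<pi>"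
  let ?A2 = "(\<lambda>r. kerf r \<inter> kerf \<pi>) ` {r \<in> R. r \<bullet> v0 = 0}"
  have v0: "v0 \<noteq> 0" using p(2) by auto
  have sub: "subspace (kerf r)" for r :: "real^3" unfolding kerf_def by (rule subspace_hyperplane)
  have dk: "dim (kerf r) = 2" if "r \<in> R" for r
    using dim_hyperplane[of r] that D(2) unfolding kerf_def by (cases "r = 0") auto
  have v0V: "c *\<^sub>R v0 \<in> ?V1" for c by (intro span_scale span_base) simp
  define c where "c = (\<lambda>x. (\<pi> \<bullet> x) / (\<pi> \<bullet> v0))"
  have c: "x - c x *\<^sub>R v0 \<in> ?V2" for x unfolding c_def kerf_def using p(2) by (simp add: inner_diff_right)
  have n1: "?V1 \<inter> ?V2 = {0}"
  proof -
    have "x = 0" if "x \<in> ?V1" "x \<in> ?V2" for x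
      using that p(2) unfolding kerf_def span_singleton by auto
    moreover have "0 \<in> ?V1 \<inter> ?V2" by (simp add: span_zero kerf_def)
    ultimately show ?thesis by blast
  qed
  have n2: "dsum ?V1 ?V2 = UNIV"
  proof -
    have "x \<in> dsum ?V1 ?V2" for x
      unfolding dsum_def using v0V[of "c x"] c[of x] by (intro CollectI exI[of _ "c x *\<^sub>R v0"] exI[of _ "x - c x *\<^sub>R v0"]) simp
    then show ?thesis by blast
  qed
  have n3: "?V1 \<noteq> {0}" using v0V[of 1] v0 by auto
  have n4: "?V2 \<noteq> {0}" using dk[OF p(1)] by (metis dim_eq_0 order_refl zero_neq_numeral)
  have n5: "arrangement_in ?V1 {{0}}"
    unfolding arrangement_in_def using v0 by (simp add: span_zero dim_singleton)
  have n6: "arrangement_in ?V2 ?A2"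
    unfolding arrangement_in_def
  proof (intro conjI ballI)
    show "finite ?A2" using D(1) by simp
    fix H assume "H \<in> ?A2"
    then obtain r where r: "r \<in> R" "r \<bullet> v0 = 0" "H = kerf r \<inter> ?V2" by blast
    show "subspace H" unfolding r(3) by (intro subspace_inter sub)
    show "H \<subseteq> ?V2" unfolding r(3) by blast
    \<comment> \<open>\<open>kerf r\<close> contains v0 while \<open>kerf \<pi>\<close> does not, so
      the two planes together span V and meet in a line.\<close>
    have "x \<in> {x + y |x y. x \<in> kerf r \<and> y \<in> ?V2}" for x
    proof -
      have "c x *\<^sub>R v0 \<in> kerf r" using r(2) unfolding kerf_def by simp
      then show ?thesis using c[of x] by (intro CollectI exI[of _ "c x *\<^sub>R v0"] exI[of _ "x - c x *\<^sub>R v0"]) simp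
    qed
    then have "{x + y |x y. x \<in> kerf r \<and> y \<in> ?V2} = UNIV" by blast
    then show "dim H + 1 = dim ?V2"
      using dim_sums_Int[OF sub[of r] sub[of \<pi>]] dk[OF r(1)] dk[OF p(1)] unfolding r(3) by simp
  qed
  have n7: "A = (\<lambda>H. dsum H ?V2) ` {{0}} \<union> (\<lambda>H. dsum ?V1 H) ` ?A2"
  proof -
    have 1: "dsum {0} ?V2 = ?V2" unfolding dsum_def by auto
    have 2: "dsum ?V1 (kerf r \<inter> ?V2) = kerf r" if r: "r \<bullet> v0 = 0" for r
    proof
      show "dsum ?V1 (kerf r \<inter> ?V2) \<subseteq> kerf r"
        unfolding dsum_def span_singleton kerf_def using r by (auto simp: inner_add_right)
      show "kerf r \<subseteq> dsum ?V1 (kerf r \<inter> ?V2)"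
      proof
        fix x assume "x \<in> kerf r"
        then have "x - c x *\<^sub>R v0 \<in> kerf r" using r unfolding kerf_def by (simp add: inner_diff_right)
        then show "x \<in> dsum ?V1 (kerf r \<inter> ?V2)" unfolding dsum_def using v0V[of "c x"] c[of x]
          by (intro CollectI exI[of _ "c x *\<^sub>R v0"] exI[of _ "x - c x *\<^sub>R v0"]) simp
      qed
    qed
    have "kerf ` R = insert ?V2 (kerf ` {r \<in> R. r \<bullet> v0 = 0})"
    proof
      have neg: "kerf (- \<pi>) = kerf \<pi>" unfolding kerf_def by simp
      have "kerf r \<in> insert ?V2 (kerf ` {r \<in> R. r \<bullet> v0 = 0})" if "r \<in> R" for r
        using sep[OF that] that neg by auto
      then show "kerf ` R \<subseteq> insert ?V2 (kerf ` {r \<in> R. r \<bullet> v0 = 0})" by blast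
    qed (use p in auto)
    moreover have "(\<lambda>H. dsum ?V1 H) ` ?A2 = kerf ` {r \<in> R. r \<bullet> v0 = 0}"
      unfolding image_image using 2 by (intro image_cong) auto
    ultimately show ?thesis unfolding D(3) by (simp add: 1)
  qed
  show ?thesis unfolding reducible_arrangement_def
    by (rule exI[of _ ?V1], rule exI[of _ ?V2], rule exI[of _ "{{0}}"], rule exI[of _ ?A2])
       (intro conjI subspace_span sub n1 n2 n3 n4 n5 n6 n7)
qed

text \<open>Positive roots for a generic vector already give all the kernels, and negation matches
  them with the negative roots.\<close>

lemma twice_card_kerf_le:
  fixes R :: "'a::euclidean_space set"
  assumes R: "finite R" "0 \<notin> R" "\<And>r. r \<in> R \<Longrightarrow> - r \<in> R"
  shows "2 * card (kerf ` R) \<le> card R"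
proof -
  obtain v where v: "\<And>r. r \<in> R \<Longrightarrow> r \<bullet> v \<noteq> 0" by (rule generic_vector_near[OF R(1,2)]) blast
  define P where "P = {r \<in> R. 0 < r \<bullet> v}"
  have PR: "r \<in> P \<or> - r \<in> P" if "r \<in> R" for r
    using v[OF that] R(3)[OF that] that unfolding P_def by auto
  have finP: "finite P" unfolding P_def using R(1) by simp
  have "kerf ` R \<subseteq> kerf ` P"
  proof
    fix H assume "H \<in> kerf ` R"
    then obtain r where r: "r \<in> R" "H = kerf r" by blast
    have "kerf (- r) = kerf r" unfolding kerf_def by simp
    then show "H \<in> kerf ` P" using PR[OF r(1)] r(2) by (metis imageI)
  qed
  then have "card (kerf ` R) \<le> card P" using surj_card_le[OF finP] by blast
  moreover have "card (P \<union> uminus ` P) = card P + card (uminus ` P)"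
    using finP by (intro card_Un_disjoint) (auto simp: P_def)
  moreover have "card (uminus ` P) = card P" by (rule card_image) simp
  moreover have "card (P \<union> uminus ` P) \<le> card R" using R by (intro card_mono) (auto simp: P_def)
  ultimately show ?thesis by linarith
qed

theorem theorem5p4:
  fixes A :: "(real^3) set set" and R :: "(real^3) set"
  assumes "crystallographic A R"
    and "irreducible_arrangement A"
    and "arr_rank A = 3"
  shows "\<forall>X. (\<exists>S\<subseteq>A. X = \<Inter>S) \<and> dim X = 1 \<longrightarrow> card {H\<in>A. X \<subseteq> H} \<le> 128"
proof (intro allI impI, elim conjE exE)
  fix X S
  assume X: "S \<subseteq> A" "X = \<Inter>S" "dim X = 1"
  note C = assms(1) and D = crystallographicD[OF assms(1)]
  have "\<not> X \<subseteq> {0}" using X(3) dim_eq_0[of X] by simp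
  then obtain v0 where v0: "v0 \<in> X" "v0 \<noteq> 0" by blast
  obtain g a b where R3: "g \<in> R" "a \<in> R" "b \<in> R" and g0: "g \<bullet> v0 \<noteq> 0" and ab0: "a \<bullet> v0 = 0" "b \<bullet> v0 = 0"
    and ind: "\<And>x1 x2 x3::real. x1 *\<^sub>R g + x2 *\<^sub>R a + x3 *\<^sub>R b = 0 \<Longrightarrow> x1 = 0 \<and> x2 = 0 \<and> x3 = 0"
    and ex: "\<And>r. r \<in> R \<Longrightarrow> \<exists>c1 c2 c3::int. r = of_int c1 *\<^sub>R g + of_int c2 *\<^sub>R a + of_int c3 *\<^sub>R b"
    by (rule basis_through_line[OF C assms(3) X v0]) blast
  let ?T = "lattice_point g a b"
  define Z where "Z = {z. ?T z \<in> R}"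
  have cZ: "crystal Z" unfolding Z_def by (rule crystal_coordinates[OF C assms(3) R3 ind ex])
  have surj: "\<exists>z\<in>Z. r = ?T z" if r: "r \<in> R" for r
  proof -
    obtain c1 c2 c3 :: int where "r = of_int c1 *\<^sub>R g + of_int c2 *\<^sub>R a + of_int c3 *\<^sub>R b" using ex[OF r] by blast
    then show ?thesis using r by (intro bexI[of _ "(c1,c2,c3)"]) (simp_all add: Z_def lattice_point_def)
  qed
  have Tv: "?T (h,q) \<bullet> v0 = of_int h * (g \<bullet> v0)" for h q
    by (cases q) (simp add: lattice_point_def inner_add_left ab0)
  have "vertex_system Z"
    unfolding vertex_system_def
  proof (intro conjI cZ allI impI)
    show "(0,1,0) \<in> Z" "(0,0,1) \<in> Z" using R3 by (simp_all add: Z_def lattice_point_def)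
    fix p assume p: "(1,p) \<in> Z"
    show "\<exists>r\<in>Z. fst r \<noteq> 0 \<and> r \<noteq> (1,p) \<and> r \<noteq> - (1,p)"
    proof (rule ccontr)
      assume no: "\<not> ?thesis"
      have "r \<bullet> v0 = 0 \<or> r = ?T (1,p) \<or> r = - ?T (1,p)" if r: "r \<in> R" for r
      proof -
        obtain z where z: "z \<in> Z" "r = ?T z" using surj[OF r] by blast
        have "fst z = 0 \<or> z = (1,p) \<or> z = - (1,p)" using no z(1) by blast
        then show ?thesis using z(2) Tv[of "fst z" "snd z"] lattice_point_lin(2)[of g a b "(1,p)"] by auto
      qed
      then have "reducible_arrangement A"
        by (rule reducible_if_separated[OF C, rotated 2]) (use p g0 Tv[of 1 p] in \<open>simp_all add: Z_def\<close>)
      then show False using assms(2) unfolding irreducible_arrangement_def by blast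
    qed
  qed
  then have bound: "card {q. (0,q) \<in> Z} < 258" by (rule vertex_system_bound)
  \<comment> \<open>A root whose kernel contains X vanishes at v0, so R0 accounts for all
    hyperplanes through X. Fewer than 258 roots, in opposite pairs, leave at most 128
    kernels.\<close>
  define R0 where "R0 = {r \<in> R. r \<bullet> v0 = 0}"
  have "R0 \<subseteq> (\<lambda>q. ?T (0,q)) ` {q. (0,q) \<in> Z}"
  proof
    fix r assume r: "r \<in> R0"
    then obtain z where z: "z \<in> Z" "r = ?T z" using surj unfolding R0_def by blast
    have "fst z = 0" using r z(2) Tv[of "fst z" "snd z"] g0 unfolding R0_def by simp
    then have "z = (0, snd z)" by (metis prod.collapse)
    then show "r \<in> (\<lambda>q. ?T (0,q)) ` {q. (0,q) \<in> Z}" using z by (metis (mono_tags) imageI mem_Collect_eq)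
  qed
  then have "card R0 \<le> card {q. (0,q) \<in> Z}" by (rule surj_card_le[OF finite_slice[OF cZ]])
  moreover have "2 * card (kerf ` R0) \<le> card R0"
    by (rule twice_card_kerf_le) (use D(1,2,4) in \<open>auto simp: R0_def\<close>)
  moreover have "card {H \<in> A. X \<subseteq> H} \<le> card (kerf ` R0)"
  proof (rule card_mono)
    show "finite (kerf ` R0)" unfolding R0_def using D(1) by simp
    show "{H \<in> A. X \<subseteq> H} \<subseteq> kerf ` R0"
      unfolding R0_def D(3) using v0(1) by (auto simp: kerf_def)
  qed
  ultimately show "card {H \<in> A. X \<subseteq> H} \<le> 128" using bound by linarith
qed

end
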